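(* Let $A$ be a commutative ring (not necessarily Noetherian) of prime characteristic $p$ that is coherent and regular, where regular means that every finitely generated ideal of $A$ has finite projective dimension. Then the following statements hold. (i) The Frobenius map $F: A\to A$, $a\mapsto a^p$, is flat. (ii) If $A$ is equipped with a normalized value map, then every finitely generated ideal $\mathfrak{a}$ of $A$ is tightly closed, i.e. $\mathfrak{a}^\ast=\mathfrak{a}$.
   Context: All rings are commutative with identity. A ring is coherent if each of its finitely generated ideals is finitely presented. A ring (not necessarily Noetherian) is called regular if each of its finitely generated ideals has finite projective dimension. A value map on a ring $A$ is a map $v:A\to\mathbb{R}\cup\{\infty\}$ such that (1) $v(ab)=v(a)+v(b)$ for all $a,b\in A$; (2) $v(a+b)\ge\min\{v(a),v(b)\}$ for all $a,b\in A$; (3) $v(a)=\infty$ if and only if $a=0$. It is normalized if $v(a)\ge 0$ for every $a\in A$ and $v(a)>0$ for every non-unit $a\in A$. For $A$ of prime characteristic $p$ and an ideal $I$ of $A$, let $A^0$ be the complement in $A$ of the union of the minimal primes of $A$, and for $q=p^e$ let $I^{[q]}$ be the ideal generated by the $q$-th powers of all elements of $I$. The tight closure $I^\ast$ of $I$ is the set of $x\in A$ such that there exists $c\in A^0$ with $cx^q\in I^{[q]}$ for all $q=p^e\gg 0$. *)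

theory Defs
  imports "HOL-Algebra.Algebra" "HOL-Library.Extended_Real"
begin

section \<open>Modules\<close>

definition mod_hom ::
  "('a, 'k) ring_scheme \<Rightarrow> ('a, 'b, 'm) module_scheme \<Rightarrow> ('a, 'c, 'n) module_scheme \<Rightarrow> ('b \<Rightarrow> 'c) set"
  where "mod_hom R M N =
    {f \<in> carrier M \<rightarrow> carrier N.
      (\<forall>x\<in>carrier M. \<forall>y\<in>carrier M. f (x \<oplus>\<^bsub>M\<^esub> y) = f x \<oplus>\<^bsub>N\<^esub> f y) \<and>
      (\<forall>a\<in>carrier R. \<forall>x\<in>carrier M. f (a \<odot>\<^bsub>M\<^esub> x) = a \<odot>\<^bsub>N\<^esub> f x)}"

text \<open>The fields \<open>mult\<close> and \<open>one\<close> are part of every module record of the library but play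
  no role in the locale \<^locale>\<open>module\<close>.\<close>

definition ideal_module :: "('a, 'k) ring_scheme \<Rightarrow> 'a set \<Rightarrow> ('a, 'a) module"
  where "ideal_module R I =
    \<lparr>carrier = I, monoid.mult = monoid.mult R, one = one R, ring.zero = ring.zero R,
     ring.add = ring.add R, smult = monoid.mult R\<rparr>"

definition free_module :: "('a, 'k) ring_scheme \<Rightarrow> nat \<Rightarrow> ('a, nat \<Rightarrow> 'a) module"
  where "free_module R n =
    \<lparr>carrier = {..<n} \<rightarrow>\<^sub>E carrier R,
     monoid.mult = (\<lambda>x y. \<lambda>i\<in>{..<n}. x i \<otimes>\<^bsub>R\<^esub> y i),
     one = (\<lambda>i\<in>{..<n}. \<one>\<^bsub>R\<^esub>),
     ring.zero = (\<lambda>i\<in>{..<n}. \<zero>\<^bsub>R\<^esub>),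
     ring.add = (\<lambda>x y. \<lambda>i\<in>{..<n}. x i \<oplus>\<^bsub>R\<^esub> y i),
     smult = (\<lambda>a x. \<lambda>i\<in>{..<n}. a \<otimes>\<^bsub>R\<^esub> x i)\<rparr>"

definition restrict_scalars ::
  "('a \<Rightarrow> 'b) \<Rightarrow> ('b, 'k) ring_scheme \<Rightarrow> ('a, 'b) module"
  where "restrict_scalars f S =
    \<lparr>carrier = carrier S, monoid.mult = monoid.mult S, one = one S, ring.zero = ring.zero S,
     ring.add = ring.add S, smult = (\<lambda>a x. f a \<otimes>\<^bsub>S\<^esub> x)\<rparr>"

text \<open>\<open>R\<^sup>m \<rightarrow> R\<^sup>n \<rightarrow> M \<rightarrow> 0\<close> is exact for suitable \<open>m\<close> and \<open>n\<close>.\<close>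

definition finitely_presented :: "('a, 'k) ring_scheme \<Rightarrow> ('a, 'b, 'm) module_scheme \<Rightarrow> bool"
  where "finitely_presented R M \<longleftrightarrow> module R M \<and>
    (\<exists>m n \<psi> \<phi>.
      \<psi> \<in> mod_hom R (free_module R m) (free_module R n) \<and>
      \<phi> \<in> mod_hom R (free_module R n) M \<and>
      \<psi> ` carrier (free_module R m) = a_kernel (free_module R n) M \<phi> \<and>
      \<phi> ` carrier (free_module R n) = carrier M)"

text \<open>The lifting property. HOL cannot quantify over all types inside a definition, so the test
  modules \<open>M\<close> and \<open>N\<close> live on the type \<open>'b \<Rightarrow> 'a\<close>. For a nonzero ring \<open>R\<close> nothing is lost:
  this type holds both a copy of \<open>P\<close> (indicator functions of points) and the free module on the
  set \<open>carrier P\<close> (functions of finite support), and lifting the identity of \<open>P\<close> along the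
  canonical surjection between these two already makes \<open>P\<close> a direct summand of a free module.\<close>

definition projective_module :: "('a, 'k) ring_scheme \<Rightarrow> ('a, 'b) module \<Rightarrow> bool"
  where "projective_module R P \<longleftrightarrow> module R P \<and>
    (\<forall>(M :: ('a, 'b \<Rightarrow> 'a) module) (N :: ('a, 'b \<Rightarrow> 'a) module) g h.
      module R M \<longrightarrow> module R N \<longrightarrow>
      g \<in> mod_hom R M N \<longrightarrow> g ` carrier M = carrier N \<longrightarrow>
      h \<in> mod_hom R P N \<longrightarrow>
      (\<exists>k \<in> mod_hom R P M. \<forall>x\<in>carrier P. g (k x) = h x))"

text \<open>\<open>\<dots> \<rightarrow> P 2 \<rightarrow> P 1 \<rightarrow> P 0 \<rightarrow> M \<rightarrow> 0\<close> is exact, with differentials \<open>d i : P (i + 1) \<rightarrow> P i\<close> and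
  augmentation \<open>\<epsilon> : P 0 \<rightarrow> M\<close>.\<close>

definition projective_resolution ::
  "('a, 'k) ring_scheme \<Rightarrow> ('a, 'b) module \<Rightarrow>
   (nat \<Rightarrow> ('a, 'u) module) \<Rightarrow> (nat \<Rightarrow> 'u \<Rightarrow> 'u) \<Rightarrow> ('u \<Rightarrow> 'b) \<Rightarrow> bool"
  where "projective_resolution R M P d \<epsilon> \<longleftrightarrow> module R M \<and>
    (\<forall>i. projective_module R (P i)) \<and>
    (\<forall>i. d i \<in> mod_hom R (P (Suc i)) (P i)) \<and>
    \<epsilon> \<in> mod_hom R (P 0) M \<and>
    \<epsilon> ` carrier (P 0) = carrier M \<and>
    d 0 ` carrier (P (Suc 0)) = a_kernel (P 0) M \<epsilon> \<and>
    (\<forall>i. d (Suc i) ` carrier (P (Suc (Suc i))) = a_kernel (P (Suc i)) (P i) (d i))"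

text \<open>The type argument \<open>'u\<close> is the type on which the modules of the resolution live. A module on
  \<open>'b\<close> of finite projective dimension has a finite projective resolution on every type that is
  at least as large as \<open>'b\<close> and \<open>nat \<Rightarrow> 'a\<close>; statements that assume finite projective
  dimension should keep \<open>'u\<close> as a free type variable, which covers resolutions on any type.\<close>

definition finite_projective_dimension ::
  "'u itself \<Rightarrow> ('a, 'k) ring_scheme \<Rightarrow> ('a, 'b) module \<Rightarrow> bool"
  where "finite_projective_dimension _ R M \<longleftrightarrow>
    (\<exists>(P :: nat \<Rightarrow> ('a, 'u) module) d \<epsilon> n.
      projective_resolution R M P d \<epsilon> \<and> (\<forall>i>n. carrier (P i) = {\<zero>\<^bsub>P i\<^esub>}))"


section \<open>Tensor products and flatness\<close>

text \<open>\<open>M \<otimes>\<^sub>R N\<close> as an abelian group: the free abelian group on \<open>M \<times> N\<close> modulo the subgroup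
  generated by the bilinearity relations.\<close>

definition tensor_relations ::
  "('a, 'k) ring_scheme \<Rightarrow> ('a, 'b) module \<Rightarrow> ('a, 'c) module \<Rightarrow> ('b \<times> 'c \<Rightarrow>\<^sub>0 int) set"
  where "tensor_relations R M N =
    {frag_of (x \<oplus>\<^bsub>M\<^esub> x', y) - frag_of (x, y) - frag_of (x', y) | x x' y.
       x \<in> carrier M \<and> x' \<in> carrier M \<and> y \<in> carrier N} \<union>
    {frag_of (x, y \<oplus>\<^bsub>N\<^esub> y') - frag_of (x, y) - frag_of (x, y') | x y y'.
       x \<in> carrier M \<and> y \<in> carrier N \<and> y' \<in> carrier N} \<union>
    {frag_of (a \<odot>\<^bsub>M\<^esub> x, y) - frag_of (x, a \<odot>\<^bsub>N\<^esub> y) | a x y.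
       a \<in> carrier R \<and> x \<in> carrier M \<and> y \<in> carrier N}"

definition tensor_kernel ::
  "('a, 'k) ring_scheme \<Rightarrow> ('a, 'b) module \<Rightarrow> ('a, 'c) module \<Rightarrow> ('b \<times> 'c \<Rightarrow>\<^sub>0 int) set"
  where "tensor_kernel R M N =
    generate (free_Abelian_group (carrier M \<times> carrier N)) (tensor_relations R M N)"

definition tensor_product ::
  "('a, 'k) ring_scheme \<Rightarrow> ('a, 'b) module \<Rightarrow> ('a, 'c) module \<Rightarrow> ('b \<times> 'c \<Rightarrow>\<^sub>0 int) set monoid"
  where "tensor_product R M N =
    free_Abelian_group (carrier M \<times> carrier N) Mod tensor_kernel R M N"

text \<open>The map \<open>id \<otimes> f : M \<otimes>\<^sub>R N \<rightarrow> M \<otimes>\<^sub>R N'\<close> induced by \<open>f : N \<rightarrow> N'\<close>. All representatives \<open>z\<close> of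
  a coset \<open>Z\<close> give the same coset, so the union is just that coset.\<close>

definition tensor_map ::
  "('a, 'k) ring_scheme \<Rightarrow> ('a, 'b) module \<Rightarrow> ('a, 'd) module \<Rightarrow> ('c \<Rightarrow> 'd) \<Rightarrow>
   ('b \<times> 'c \<Rightarrow>\<^sub>0 int) set \<Rightarrow> ('b \<times> 'd \<Rightarrow>\<^sub>0 int) set"
  where "tensor_map R M N' f Z =
    (\<Union>z\<in>Z. tensor_kernel R M N' #>\<^bsub>free_Abelian_group (carrier M \<times> carrier N')\<^esub>
       frag_extend (\<lambda>(x, y). frag_of (x, f y)) z)"

text \<open>The type argument \<open>'n\<close> is the type of the modules \<open>N \<rightarrow> N'\<close> against which flatness is
  tested; a theorem concluding flatness with \<open>'n\<close> a free type variable covers all modules.\<close>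

definition flat_module :: "'n itself \<Rightarrow> ('a, 'k) ring_scheme \<Rightarrow> ('a, 'b) module \<Rightarrow> bool"
  where "flat_module _ R M \<longleftrightarrow> module R M \<and>
    (\<forall>(N :: ('a, 'n) module) (N' :: ('a, 'n) module) f.
      module R N \<longrightarrow> module R N' \<longrightarrow>
      f \<in> mod_hom R N N' \<longrightarrow> inj_on f (carrier N) \<longrightarrow>
      inj_on (tensor_map R M N' f) (carrier (tensor_product R M N)))"

definition flat_ring_hom ::
  "'n itself \<Rightarrow> ('a, 'k) ring_scheme \<Rightarrow> ('b, 'l) ring_scheme \<Rightarrow> ('a \<Rightarrow> 'b) \<Rightarrow> bool"
  where "flat_ring_hom T R S f \<longleftrightarrow>
    f \<in> ring_hom R S \<and> flat_module T R (restrict_scalars f S)"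


section \<open>Coherent regular rings\<close>

definition fg_ideal :: "('a, 'k) ring_scheme \<Rightarrow> 'a set \<Rightarrow> bool"
  where "fg_ideal R I \<longleftrightarrow> (\<exists>S. finite S \<and> S \<subseteq> carrier R \<and> I = Idl\<^bsub>R\<^esub> S)"

definition coherent_ring :: "('a, 'k) ring_scheme \<Rightarrow> bool"
  where "coherent_ring R \<longleftrightarrow> cring R \<and>
    (\<forall>I. fg_ideal R I \<longrightarrow> finitely_presented R (ideal_module R I))"

definition regular_ring :: "'u itself \<Rightarrow> ('a, 'k) ring_scheme \<Rightarrow> bool"
  where "regular_ring T R \<longleftrightarrow> cring R \<and>
    (\<forall>I. fg_ideal R I \<longrightarrow> finite_projective_dimension T R (ideal_module R I))"


section \<open>Prime characteristic and tight closure\<close>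

text \<open>The additive order of \<open>1\<close>, which is \<open>0\<close> if this order is infinite.\<close>

definition ring_char :: "('a, 'k) ring_scheme \<Rightarrow> nat"
  where "ring_char R = group.ord (add_monoid R) \<one>\<^bsub>R\<^esub>"

definition frobenius :: "('a, 'k) ring_scheme \<Rightarrow> nat \<Rightarrow> 'a \<Rightarrow> 'a"
  where "frobenius R p a = a [^]\<^bsub>R\<^esub> p"

definition minimal_prime :: "('a, 'k) ring_scheme \<Rightarrow> 'a set \<Rightarrow> bool"
  where "minimal_prime R P \<longleftrightarrow> primeideal P R \<and> (\<forall>Q. primeideal Q R \<longrightarrow> Q \<subseteq> P \<longrightarrow> Q = P)"

definition off_minimal_primes :: "('a, 'k) ring_scheme \<Rightarrow> 'a set"
  where "off_minimal_primes R = carrier R - \<Union>{P. minimal_prime R P}"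

definition bracket_power :: "('a, 'k) ring_scheme \<Rightarrow> 'a set \<Rightarrow> nat \<Rightarrow> 'a set"
  where "bracket_power R I q = Idl\<^bsub>R\<^esub> ((\<lambda>x. x [^]\<^bsub>R\<^esub> q) ` I)"

definition tight_closure :: "('a, 'k) ring_scheme \<Rightarrow> nat \<Rightarrow> 'a set \<Rightarrow> 'a set"
  where "tight_closure R p I =
    {x \<in> carrier R. \<exists>c \<in> off_minimal_primes R. \<exists>e\<^sub>0. \<forall>e\<ge>e\<^sub>0.
       c \<otimes>\<^bsub>R\<^esub> x [^]\<^bsub>R\<^esub> (p ^ e) \<in> bracket_power R I (p ^ e)}"


section \<open>Value maps\<close>

definition value_map :: "('a, 'k) ring_scheme \<Rightarrow> ('a \<Rightarrow> ereal) \<Rightarrow> bool"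
  where "value_map R v \<longleftrightarrow>
    (\<forall>a\<in>carrier R. v a \<noteq> -\<infinity>) \<and>
    (\<forall>a\<in>carrier R. \<forall>b\<in>carrier R. v (a \<otimes>\<^bsub>R\<^esub> b) = v a + v b) \<and>
    (\<forall>a\<in>carrier R. \<forall>b\<in>carrier R. v (a \<oplus>\<^bsub>R\<^esub> b) \<ge> min (v a) (v b)) \<and>
    (\<forall>a\<in>carrier R. v a = \<infinity> \<longleftrightarrow> a = \<zero>\<^bsub>R\<^esub>)"

definition normalized_value_map :: "('a, 'k) ring_scheme \<Rightarrow> ('a \<Rightarrow> ereal) \<Rightarrow> bool"
  where "normalized_value_map R v \<longleftrightarrow> value_map R v \<and>
    (\<forall>a\<in>carrier R. v a \<ge> 0) \<and> (\<forall>a\<in>carrier R - Units R. v a > 0)"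

end

theory Submission
  imports Defs "HOL-Computational_Algebra.Primes"
begin

text \<open>
Flatness of the Frobenius map means that the relations between the \<open>p\<close>-th powers of ring elements
\<open>a\<^sub>1, \<dots>, a\<^sub>m\<close> are generated by the \<open>p\<close>-th powers of the relations between the \<open>a\<^sub>i\<close>
(\<open>frobenius_syzygies\<close>). Over a coherent ring the ideal generated by the \<open>a\<^sub>i\<close> has a resolution by
finite free modules. Raising all matrix entries to the power \<open>p\<close> gives a complex again, and the claim
is that it is still exact at the first place.

The core is a fact about every commutative ring of characteristic \<open>p\<close>: if a bounded complex of finite
free modules is acyclic in positive degrees, then so is its \<open>p\<close>-th power (\<open>frobenius_acyclic_free\<close>).
This is usually a consequence of the acyclicity criterion of Buchsbaum and Eisenbud, since powers do
not change the grade of the ideals of minors. Here it is proved by induction on the total rank. After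
an entry \<open>x\<close> of the last map has been inverted, a trivial summand splits off (\<open>pivot_acyclic\<close>), so that
the homology of the \<open>p\<close>-th power is killed by powers of \<open>x\<close>. On the other hand, the entries of the last
map of an acyclic complex, if its source is not zero, have grade at least the length of the complex
(\<open>koszul_exact_top_entries\<close>), and homology that is torsion with respect to elements of such grade
vanishes (\<open>acyclic_of_torsion\<close>). Grade is expressed by Koszul cohomology, and both facts are short
chases in a double complex.

Regularity provides a finite resolution by projective modules, which need be neither free nor finitely
generated. Comparing it with the infinite resolution by finite free modules shows that far out the
latter has a map \<open>\<phi>\<close> with \<open>\<phi> h \<phi> = \<phi>\<close> (\<open>comparison_split\<close>). Locally on the spectrum such a complex
is homotopy equivalent to a finite one, and \<open>frobenius_acyclic_split\<close> reduces it to the bounded case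
by inverting either an entry of \<open>\<phi>\<close> or an element that kills \<open>\<phi>\<close>. These elements generate the unit
ideal.

Flatness with respect to an injective linear map follows by computing the tensor product as a
quotient of a direct sum of copies of the ring (\<open>frobenius_tensor_injective\<close>). For the second claim,
let \<open>x\<close> be in the tight closure of \<open>I\<close>, with multiplier \<open>c\<close>. By flatness \<open>c\<close> lies in all high bracket powers
of the ideal of all \<open>y\<close> with \<open>y * x \<in> I\<close>, which is finitely generated. If \<open>x\<close> is not in \<open>I\<close>, the
generators are not units, their values are bounded below by a positive number, and the value of \<open>c\<close>
exceeds every bound (\<open>tight_closure_fg_ideal\<close>).
\<close>

section \<open>Matrices over a localized quotient ring\<close>

text \<open>The set \<open>N\<close> consists of the elements that become zero in the localization of \<open>R/N\<close> at \<open>S\<close>. This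
localization is not constructed, since the inductions below invert one element after another and
each step would lead to a new type. Instead, an equation in it is a membership in \<open>N\<close>, and a
solution in it is a solution in \<open>R\<close> up to a factor in \<open>S\<close>.\<close>

locale localized_quotient =
  fixes N S :: "'r::comm_ring_1 set"
  assumes zero_N: "0 \<in> N"
    and add_N: "\<And>x y. x \<in> N \<Longrightarrow> y \<in> N \<Longrightarrow> x + y \<in> N"
    and mult_N: "\<And>r x. x \<in> N \<Longrightarrow> r * x \<in> N"
    and one_S: "1 \<in> S"
    and mult_S: "\<And>s t. s \<in> S \<Longrightarrow> t \<in> S \<Longrightarrow> s * t \<in> S"
    and saturated: "\<And>s x. s \<in> S \<Longrightarrow> s * x \<in> N \<Longrightarrow> x \<in> N"
begin

lemma mult_N_right: "x \<in> N \<Longrightarrow> x * r \<in> N"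
  using mult_N[of x r] by (simp add: mult.commute)

lemma uminus_N: "x \<in> N \<Longrightarrow> - x \<in> N"
  using mult_N[of x "-1"] by simp

lemma diff_N: "x \<in> N \<Longrightarrow> y \<in> N \<Longrightarrow> x - y \<in> N"
  using add_N[of x "- y"] uminus_N[of y] by simp

lemma sum_N: "(\<And>i. i \<in> I \<Longrightarrow> f i \<in> N) \<Longrightarrow> sum f I \<in> N"
  by (induction I rule: infinite_finite_induct) (auto intro: zero_N add_N)

lemma N_cong: "x - y \<in> N \<Longrightarrow> x \<in> N \<longleftrightarrow> y \<in> N"
  using add_N[of "x - y" y] diff_N[of x "x - y"] by auto

lemma common_denominator:
  assumes "finite I"
    and "\<And>i. i \<in> I \<Longrightarrow> \<exists>s\<in>S. \<exists>w. Q i s w"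
    and scale: "\<And>i s t w. i \<in> I \<Longrightarrow> t \<in> S \<Longrightarrow> Q i s w \<Longrightarrow> \<exists>w'. Q i (t * s) w'"
  shows "\<exists>s\<in>S. \<exists>w. \<forall>i\<in>I. Q i s (w i)"
proof -
  have "\<exists>s\<in>S. \<forall>i\<in>I. \<exists>w. Q i s w"
    using assms
  proof (induction I rule: finite_induct)
    case empty
    show ?case using one_S by blast
  next
    case (insert j I)
    have "\<exists>s\<in>S. \<forall>i\<in>I. \<exists>w. Q i s w"
    proof (rule insert.IH)
      show "\<exists>s\<in>S. \<exists>w. Q i s w" if "i \<in> I" for i
        using insert.prems(1) that by simp
      show "\<exists>w'. Q i (t * s) w'" if "i \<in> I" "t \<in> S" "Q i s w" for i s t w
        using insert.prems(2)[OF _ that(2,3)] that(1) by simp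
    qed
    then obtain s where s: "s \<in> S" "\<forall>i\<in>I. \<exists>w. Q i s w" by blast
    from insert.prems(1)[of j] obtain t w where t: "t \<in> S" "Q j t w" by auto
    have "\<exists>w. Q i (t * s) w" if "i \<in> I" for i
      using that s t(1) insert.prems(2)[of i t s] by blast
    moreover have "\<exists>w. Q j (t * s) w"
      using insert.prems(2)[of j s t w] s t by (auto simp: mult.commute)
    ultimately show ?case using mult_S[OF t(1) s(1)] by blast
  qed
  then show ?thesis by metis
qed

end

text \<open>The set of column indices is an argument, because pivots delete rows and columns without
renumbering the others.\<close>

definition lin :: "'j set \<Rightarrow> ('i \<Rightarrow> 'j \<Rightarrow> 'r::comm_ring_1) \<Rightarrow> ('j \<Rightarrow> 'r) \<Rightarrow> 'i \<Rightarrow> 'r"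
  where "lin B M v j = (\<Sum>k\<in>B. M j k * v k)"

abbreviation (input) row :: "('k \<Rightarrow> 'r) \<Rightarrow> nat \<Rightarrow> 'k \<Rightarrow> 'r"
  where "row a \<equiv> \<lambda>_. a"

abbreviation (input) bdry ::
    "(nat \<Rightarrow> 'k set) \<Rightarrow> (nat \<Rightarrow> 'j \<Rightarrow> 'k \<Rightarrow> 'r::comm_ring_1) \<Rightarrow> nat \<Rightarrow> ('k \<Rightarrow> 'r) \<Rightarrow> 'j \<Rightarrow> 'r"
  where "bdry B \<phi> i \<equiv> lin (B (Suc i)) (\<phi> i)"

lemma lin_add: "lin B M (\<lambda>k. v k + w k) j = lin B M v j + lin B M w j"
  by (simp add: lin_def distrib_left sum.distrib)

lemma lin_diff: "lin B M (\<lambda>k. v k - w k) j = lin B M v j - lin B M w j"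
  by (simp add: lin_def right_diff_distrib sum_subtractf)

lemma lin_scale: "lin B M (\<lambda>k. r * v k) j = r * lin B M v j"
  by (simp add: lin_def sum_distrib_left mult.left_commute)

lemma lin_zero: "lin B M (\<lambda>k. 0) j = 0"
  by (simp add: lin_def)

lemma lin_lin: "lin B f (lin Y g w) j = (\<Sum>l\<in>Y. (\<Sum>k\<in>B. f j k * g k l) * w l)"
proof -
  have "lin B f (lin Y g w) j = (\<Sum>k\<in>B. \<Sum>l\<in>Y. f j k * g k l * w l)"
    by (simp add: lin_def sum_distrib_left mult.assoc)
  also have "\<dots> = (\<Sum>l\<in>Y. \<Sum>k\<in>B. f j k * g k l * w l)" by (rule sum.swap)
  finally show ?thesis by (simp add: sum_distrib_right)
qed

text \<open>Exactness of \<open>R\<^sup>Z \<rightarrow> R\<^sup>Y \<rightarrow> R\<^sup>B\<close> in the middle, with matrices \<open>g\<close> and \<open>f\<close>, after passing to the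
localization.\<close>

definition exact_at ::
  "'r::comm_ring_1 set \<Rightarrow> 'r set \<Rightarrow> nat set \<Rightarrow> nat set \<Rightarrow> nat set \<Rightarrow>
    (nat \<Rightarrow> nat \<Rightarrow> 'r) \<Rightarrow> (nat \<Rightarrow> nat \<Rightarrow> 'r) \<Rightarrow> bool"
  where "exact_at N S B Y Z f g \<longleftrightarrow>
    (\<forall>v. (\<forall>j\<in>B. lin Y f v j \<in> N) \<longrightarrow> (\<exists>s\<in>S. \<exists>w. \<forall>k\<in>Y. s * v k - lin Z g w k \<in> N))"

text \<open>The matrix \<open>\<phi> i\<close> maps the free module on \<open>B (i + 1)\<close> to the free module on \<open>B i\<close>. The number \<open>n\<close>
is the index of the last matrix that is looked at; homology in degree \<open>0\<close> is never restricted.\<close>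

definition complex_upto :: "'r::comm_ring_1 set \<Rightarrow> nat \<Rightarrow> (nat \<Rightarrow> nat set) \<Rightarrow> (nat \<Rightarrow> nat \<Rightarrow> nat \<Rightarrow> 'r) \<Rightarrow> bool"
  where "complex_upto N n B \<phi> \<longleftrightarrow>
    (\<forall>m<n. \<forall>j\<in>B m. \<forall>l\<in>B (Suc (Suc m)). (\<Sum>k\<in>B (Suc m). \<phi> m j k * \<phi> (Suc m) k l) \<in> N)"

definition acyclic_upto ::
  "'r::comm_ring_1 set \<Rightarrow> 'r set \<Rightarrow> nat \<Rightarrow> (nat \<Rightarrow> nat set) \<Rightarrow> (nat \<Rightarrow> nat \<Rightarrow> nat \<Rightarrow> 'r) \<Rightarrow> bool"
  where "acyclic_upto N S n B \<phi> \<longleftrightarrow>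
    (\<forall>m<n. exact_at N S (B m) (B (Suc m)) (B (Suc (Suc m))) (\<phi> m) (\<phi> (Suc m)))"

section \<open>Koszul cohomology and finite free complexes\<close>

text \<open>The Koszul differential on cochains that are defined on all tuples of indices instead of the
alternating ones. The second equation is the contracting homotopy: putting the index \<open>i\<close> in front
of a tuple shows that multiplication by \<open>x i\<close> is homotopic to zero. Together with \<open>kos_kos\<close> this is
all that is used of Koszul cohomology.\<close>

fun kos :: "('e \<Rightarrow> 'r::comm_ring_1) \<Rightarrow> ('e list \<Rightarrow> 'r) \<Rightarrow> 'e list \<Rightarrow> 'r"
  where
    "kos x c [] = 0"
  | "kos x c (i # l) = x i * c l - kos x (\<lambda>m. c (i # m)) l"

lemma kos_diff: "kos x (\<lambda>m. c m - d m) l = kos x c l - kos x d l"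
  by (induction l arbitrary: c d) (simp_all add: algebra_simps)

lemma kos_scale: "kos x (\<lambda>m. r * c m) l = r * kos x c l"
  by (induction l arbitrary: c) (simp_all add: algebra_simps)

lemma kos_zero: "kos x (\<lambda>m. 0) l = 0"
  using kos_scale[of x 0 "\<lambda>m. 0" l] by simp

lemma kos_add: "kos x (\<lambda>m. c m + d m) l = kos x c l + kos x d l"
  by (induction l arbitrary: c d) (simp_all add: algebra_simps)

lemma kos_sum: "kos x (\<lambda>m. \<Sum>k\<in>B. c k m) l = (\<Sum>k\<in>B. kos x (c k) l)"
  by (induction B rule: infinite_finite_induct) (simp_all add: kos_zero kos_add)

lemma kos_kos: "kos x (kos x c) l = 0"
proof (induction l arbitrary: c)
  case (Cons i l)
  have "kos x (\<lambda>m. kos x c (i # m)) l = x i * kos x c l - kos x (kos x (\<lambda>m. c (i # m))) l"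
    by (simp add: kos_diff kos_scale)
  then show ?case by (simp add: Cons.IH)
qed simp

lemma kos_lin: "kos x (\<lambda>m. lin B M (c m) j) l = lin B M (\<lambda>k. kos x (\<lambda>m. c m k) l) j"
  by (simp add: lin_def kos_sum kos_scale)

definition tuples :: "'e set \<Rightarrow> nat \<Rightarrow> 'e list set"
  where "tuples E k = {l. set l \<subseteq> E \<and> length l = k}"

lemma finite_tuples: "finite E \<Longrightarrow> finite (tuples E k)"
  unfolding tuples_def by (rule finite_lists_length_eq)

lemma tuples_Suc: "i # l \<in> tuples E (Suc k) \<longleftrightarrow> i \<in> E \<and> l \<in> tuples E k"
  by (auto simp: tuples_def)

lemma tuples_0: "tuples E 0 = {[]}"
  by (auto simp: tuples_def)

text \<open>Vanishing of cohomology in degree \<open>k\<close>. Vanishing in all degrees below \<open>n\<close> takes the place of the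
statement that the elements \<open>x\<close> generate an ideal of grade at least \<open>n\<close>.\<close>

definition koszul_exact ::
  "'r::comm_ring_1 set \<Rightarrow> 'r set \<Rightarrow> 'e set \<Rightarrow> ('e \<Rightarrow> 'r) \<Rightarrow> nat \<Rightarrow> bool"
  where "koszul_exact N S E x k \<longleftrightarrow>
    (\<forall>c. (\<forall>l\<in>tuples E (Suc k). kos x c l \<in> N) \<longrightarrow>
      (\<exists>s\<in>S. \<exists>b. \<forall>l\<in>tuples E k. s * c l - kos x b l \<in> N))"

context localized_quotient
begin

lemma lin_N: "(\<And>k. k \<in> B \<Longrightarrow> v k \<in> N) \<Longrightarrow> lin B M v j \<in> N"
  by (auto simp: lin_def intro!: sum_N mult_N)

lemma lin_lin_N:
  assumes "\<And>l. l \<in> Y \<Longrightarrow> (\<Sum>k\<in>B. f j k * g k l) \<in> N"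
  shows "lin B f (lin Y g w) j \<in> N"
  unfolding lin_lin by (intro sum_N mult_N_right assms)

lemma kos_N:
  assumes "\<And>m. m \<in> tuples E k \<Longrightarrow> c m \<in> N" "l \<in> tuples E (Suc k)"
  shows "kos x c l \<in> N"
  using assms
proof (induction l arbitrary: c k)
  case Nil
  then show ?case by (simp add: zero_N)
next
  case (Cons i l)
  have l: "i \<in> E" "l \<in> tuples E k" using Cons.prems(2) by (simp_all add: tuples_Suc)
  have "kos x (\<lambda>m. c (i # m)) l \<in> N"
  proof (cases k)
    case 0
    then have "l = []" using l by (simp add: tuples_0)
    then show ?thesis by (simp add: zero_N)
  next
    case (Suc k')
    show ?thesis
      by (rule Cons.IH[of k']) (use Cons.prems(1) l Suc in \<open>auto simp: tuples_Suc\<close>)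
  qed
  then show ?case using l Cons.prems(1) by (auto intro!: diff_N mult_N)
qed

lemma koszul_exact_vec:
  assumes K: "koszul_exact N S E x k" and fin: "finite B"
    and c: "\<forall>l\<in>tuples E (Suc k). \<forall>j\<in>B. kos x (\<lambda>m. c m j) l \<in> N"
  shows "\<exists>s\<in>S. \<exists>b. \<forall>j\<in>B. \<forall>l\<in>tuples E k. s * c l j - kos x (\<lambda>m. b m j) l \<in> N"
proof -
  have "\<exists>s\<in>S. \<exists>b. \<forall>j\<in>B. \<forall>l\<in>tuples E k. s * c l j - kos x (b j) l \<in> N"
  proof (rule common_denominator[OF fin])
    fix j assume "j \<in> B"
    then show "\<exists>s\<in>S. \<exists>b. \<forall>l\<in>tuples E k. s * c l j - kos x b l \<in> N"
      using K[unfolded koszul_exact_def, rule_format, of "\<lambda>m. c m j"] c by blast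
  next
    fix j s t b
    assume "t \<in> S" and b: "\<forall>l\<in>tuples E k. s * c l j - kos x b l \<in> N"
    have "t * s * c l j - kos x (\<lambda>m. t * b m) l \<in> N" if "l \<in> tuples E k" for l
      using mult_N[of "s * c l j - kos x b l" t] b that by (simp add: kos_scale algebra_simps)
    then show "\<exists>w. \<forall>l\<in>tuples E k. t * s * c l j - kos x w l \<in> N" by blast
  qed
  then obtain s b where s: "s \<in> S" and b: "\<forall>j\<in>B. \<forall>l\<in>tuples E k. s * c l j - kos x (b j) l \<in> N" by blast
  have "\<exists>b. \<forall>j\<in>B. \<forall>l\<in>tuples E k. s * c l j - kos x (\<lambda>m. b m j) l \<in> N"
    by (rule exI[of _ "\<lambda>l j. b j l"]) (use b in simp)
  then show ?thesis using s by blast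
qed

lemma exact_at_cochain:
  assumes ex: "exact_at N S B Y Z f g" and fin: "finite L"
    and c: "\<forall>l\<in>L. \<forall>j\<in>B. lin Y f (c l) j \<in> N"
  shows "\<exists>s\<in>S. \<exists>w. \<forall>l\<in>L. \<forall>k\<in>Y. s * c l k - lin Z g (w l) k \<in> N"
proof (rule common_denominator[OF fin])
  fix l assume "l \<in> L"
  then show "\<exists>s\<in>S. \<exists>w. \<forall>k\<in>Y. s * c l k - lin Z g w k \<in> N"
    using ex[unfolded exact_at_def, rule_format, of "c l"] c by blast
next
  fix l s t w
  assume "t \<in> S" and w: "\<forall>k\<in>Y. s * c l k - lin Z g w k \<in> N"
  have "t * s * c l k - lin Z g (\<lambda>k. t * w k) k \<in> N" if "k \<in> Y" for k
    using mult_N[of "s * c l k - lin Z g w k" t] w that by (simp add: lin_scale algebra_simps)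
  then show "\<exists>w. \<forall>k\<in>Y. t * s * c l k - lin Z g w k \<in> N" by blast
qed

text \<open>A chase in the double complex of Koszul cochains with values in the modules of the complex \<open>\<phi>\<close>.
If \<open>\<phi> c\<close> is the coboundary of \<open>b\<close>, then \<open>\<phi> b\<close> is a cocycle, hence a coboundary by Koszul exactness
in the lower degree, and the same problem arises for \<open>b\<close>, with both degrees lowered by one. In
Koszul degree \<open>0\<close> there are no coboundaries and the exactness of \<open>\<phi>\<close> gives the answer.\<close>

lemma koszul_descent:
  assumes cx: "complex_upto N n B \<phi>" and ac: "acyclic_upto N S n B \<phi>"
    and fin: "\<And>i. finite (B i)" and E: "finite E"
  shows "k \<le> i \<Longrightarrow> i < n \<Longrightarrow> (\<And>j. j < k \<Longrightarrow> koszul_exact N S E x j) \<Longrightarrow> s \<in> S \<Longrightarrow>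
    (\<And>l j. l \<in> tuples E k \<Longrightarrow> j \<in> B i \<Longrightarrow>
       s * bdry B \<phi> i (c l) j - kos x (\<lambda>m. b m j) l \<in> N) \<Longrightarrow>
    \<exists>s\<in>S. \<exists>a w. \<forall>l\<in>tuples E k. \<forall>j\<in>B (Suc i).
       s * c l j - kos x (\<lambda>m. a m j) l - bdry B \<phi> (Suc i) (w l) j \<in> N"
proof (induction k arbitrary: i s c b)
  case 0
  have "bdry B \<phi> i (c l) j \<in> N" if "l \<in> tuples E 0" "j \<in> B i" for l j
    using 0(4) 0(5)[OF that] that(1) saturated by (auto simp: tuples_0)
  with exact_at_cochain[of "B i" "B (Suc i)" "B (Suc (Suc i))" "\<phi> i" "\<phi> (Suc i)" "tuples E 0" c]
  obtain s' w where "s' \<in> S" "\<forall>l\<in>tuples E 0. \<forall>k\<in>B (Suc i). s' * c l k - bdry B \<phi> (Suc i) (w l) k \<in> N"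
    using ac 0(2) by (auto simp: acyclic_upto_def finite_tuples E)
  then show ?case
    by (intro bexI[of _ s'] exI[of _ "\<lambda>_ _. 0"] exI[of _ w]) (auto simp: tuples_0)
next
  case (Suc k)
  then obtain i' where i: "i = Suc i'" by (cases i) auto
  have cxi: "bdry B \<phi> m (bdry B \<phi> (Suc m) v) j \<in> N"
    if "m < n" "j \<in> B m" for m v j
    using cx that by (auto intro!: lin_lin_N simp: complex_upto_def)
  \<comment> \<open>\<open>\<phi> b\<close> is a cocycle\<close>
  have "kos x (\<lambda>m. lin (B i) (\<phi> i') (b m) j) l \<in> N"
    if l: "l \<in> tuples E (Suc k)" and j: "j \<in> B i'" for l j
  proof -
    let ?D = "\<lambda>j. s * bdry B \<phi> i (c l) j - kos x (\<lambda>m. b m j) l"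
    have "lin (B i) (\<phi> i') ?D j \<in> N"
      using Suc.prems(5)[OF l] by (intro lin_N)
    moreover have "lin (B i) (\<phi> i') ?D j =
      s * lin (B i) (\<phi> i') (bdry B \<phi> i (c l)) j - kos x (\<lambda>m. lin (B i) (\<phi> i') (b m) j) l"
      by (simp add: lin_diff lin_scale kos_lin)
    moreover have "s * lin (B i) (\<phi> i') (bdry B \<phi> i (c l)) j \<in> N"
      using cxi[of i' j "c l"] j Suc.prems(2) i by (auto intro: mult_N)
    ultimately show ?thesis by (metis diff_N minus_diff_eq diff_diff_eq2 add_diff_cancel_left')
  qed
  with koszul_exact_vec[of E x k "B i'" "\<lambda>m. lin (B i) (\<phi> i') (b m)"] Suc.prems(3)[of k] fin
  obtain s' b' where s': "s' \<in> S" and b': "\<forall>j\<in>B i'. \<forall>l\<in>tuples E k.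
      s' * lin (B i) (\<phi> i') (b l) j - kos x (\<lambda>m. b' m j) l \<in> N" by auto
  have "\<exists>s\<in>S. \<exists>a w. \<forall>l\<in>tuples E k. \<forall>j\<in>B (Suc i').
       s * b l j - kos x (\<lambda>m. a m j) l - lin (B (Suc (Suc i'))) (\<phi> (Suc i')) (w l) j \<in> N"
    by (rule Suc.IH[of i' s' b b']) (use Suc.prems i s' b' in auto)
  then obtain s2 a w where s2: "s2 \<in> S" and aw: "\<And>l j. l\<in>tuples E k \<Longrightarrow> j\<in>B i \<Longrightarrow>
       s2 * b l j - kos x (\<lambda>m. a m j) l - bdry B \<phi> i (w l) j \<in> N"
    unfolding i by blast
  define c' where "c' l = (\<lambda>j. s2 * s * c l j - kos x (\<lambda>m. w m j) l)" for l
  have cy: "\<forall>l\<in>tuples E (Suc k). \<forall>j\<in>B i. bdry B \<phi> i (c' l) j \<in> N"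
  proof (intro ballI)
    fix l j assume l: "l \<in> tuples E (Suc k)" and j: "j \<in> B i"
    have "kos x (\<lambda>l. s2 * b l j - kos x (\<lambda>m. a m j) l - bdry B \<phi> i (w l) j) l \<in> N"
      by (rule kos_N[OF _ l]) (use aw j in auto)
    then have 1: "s2 * kos x (\<lambda>m. b m j) l - bdry B \<phi> i (\<lambda>j. kos x (\<lambda>m. w m j) l) j \<in> N"
      by (simp add: kos_diff kos_scale kos_kos kos_lin)
    have 2: "s2 * (s * bdry B \<phi> i (c l) j - kos x (\<lambda>m. b m j) l) \<in> N"
      using Suc.prems(5)[OF l j] by (rule mult_N)
    show "bdry B \<phi> i (c' l) j \<in> N"
      using add_N[OF 1 2] by (simp add: c'_def lin_diff lin_scale algebra_simps)
  qed
  have ex: "exact_at N S (B i) (B (Suc i)) (B (Suc (Suc i))) (\<phi> i) (\<phi> (Suc i))"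
    using ac Suc.prems(2) by (simp add: acyclic_upto_def)
  obtain s3 w' where s3: "s3 \<in> S" and w': "\<And>l j. l\<in>tuples E (Suc k) \<Longrightarrow> j\<in>B (Suc i) \<Longrightarrow>
      s3 * c' l j - bdry B \<phi> (Suc i) (w' l) j \<in> N"
    using exact_at_cochain[OF ex finite_tuples[OF E] cy] by blast
  have "(s3 * (s2 * s)) * c l j - kos x (\<lambda>m. s3 * w m j) l - bdry B \<phi> (Suc i) (w' l) j \<in> N"
    if "l \<in> tuples E (Suc k)" "j \<in> B (Suc i)" for l j
    using w'[OF that] by (simp add: c'_def kos_scale algebra_simps)
  then show ?case
    using s3 s2 Suc.prems(4)
    by (intro bexI[of _ "s3 * (s2 * s)"] exI[of _ "\<lambda>m j. s3 * w m j"] exI[of _ w']) (auto intro: mult_S)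
qed

text \<open>This is the part of the Auslander--Buchsbaum formula that is needed: the entries of the last map
of an acyclic complex have grade at least the length of the complex, if the last module is not zero.
Place a cocycle \<open>c\<close> at a basis
vector \<open>q\<close> of the last module. The last map multiplies it by entries \<open>x\<close>, and these act by zero on
Koszul cohomology; so its image is a coboundary, and by \<open>koszul_descent\<close> so is \<open>c\<close>, because nothing
maps into the last module.\<close>

lemma koszul_exact_top_entries:
  assumes cx: "complex_upto N (Suc n) B \<phi>" and ac: "acyclic_upto N S (Suc n) B \<phi>"
    and fin: "\<And>i. finite (B i)" and top: "B (Suc (Suc n)) = {}" and ne: "B (Suc n) \<noteq> {}"
  shows "k \<le> n \<Longrightarrow> koszul_exact N S (B n \<times> B (Suc n)) (\<lambda>(j, l). \<phi> n j l) k"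
proof (induction k rule: less_induct)
  case (less k)
  let ?E = "B n \<times> B (Suc n)" and ?x = "\<lambda>(j, l). \<phi> n j l"
  obtain q where q: "q \<in> B (Suc n)" using ne by blast
  show ?case unfolding koszul_exact_def
  proof (intro allI impI)
    fix c assume c: "\<forall>l\<in>tuples ?E (Suc k). kos ?x c l \<in> N"
    define C where "C l = (\<lambda>j. if j = q then c l else 0)" for l
    define b where "b l = (\<lambda>j. c ((j, q) # l))" for l
    have "\<exists>s\<in>S. \<exists>a w. \<forall>l\<in>tuples ?E k. \<forall>j\<in>B (Suc n).
       s * C l j - kos ?x (\<lambda>m. a m j) l - bdry B \<phi> (Suc n) (w l) j \<in> N"
    proof (rule koszul_descent[OF cx ac fin, of ?E k n ?x 1 C b])
      fix l j assume l: "l \<in> tuples ?E k" and j: "j \<in> B n"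
      have "bdry B \<phi> n (C l) j = \<phi> n j q * c l"
        using q fin by (simp add: lin_def C_def if_distrib cong: if_cong)
      moreover have "kos ?x c ((j, q) # l) \<in> N"
        using c[rule_format, of "(j, q) # l"] l j q by (simp add: tuples_Suc del: kos.simps)
      ultimately show "1 * bdry B \<phi> n (C l) j - kos ?x (\<lambda>m. b m j) l \<in> N"
        by (simp add: b_def)
    qed (use less fin one_S in auto)
    then obtain s a w where s: "s \<in> S" and aw: "\<forall>l\<in>tuples ?E k. \<forall>j\<in>B (Suc n).
       s * C l j - kos ?x (\<lambda>m. a m j) l - bdry B \<phi> (Suc n) (w l) j \<in> N" by blast
    have "s * c l - kos ?x (\<lambda>m. a m q) l \<in> N" if "l \<in> tuples ?E k" for l
      using aw[rule_format, OF that q] by (simp add: C_def top lin_def)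
    then show "\<exists>s\<in>S. \<exists>b. \<forall>l\<in>tuples ?E k. s * c l - kos ?x b l \<in> N"
      using s by (intro bexI[of _ s] exI[of _ "\<lambda>m. a m q"]) auto
  qed
qed

text \<open>The chase of \<open>koszul_descent\<close> in the opposite direction. If the coboundary of \<open>c\<close> is \<open>\<psi> w\<close>, then the
exactness of \<open>\<psi>\<close> shows that the coboundary of \<open>w\<close> is again of this form, with both degrees raised
by one. In the last module of the complex the coboundary is zero, and Koszul exactness applies.\<close>

lemma koszul_ascent:
  assumes cx: "complex_upto N n B \<psi>" and fin: "\<And>i. finite (B i)" and E: "finite E"
    and top: "B (Suc n) = {}" and K: "\<And>j. j < n \<Longrightarrow> koszul_exact N S E x j"
  shows "k < i \<Longrightarrow> i \<le> n \<Longrightarrow>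
    (\<And>m. i \<le> m \<Longrightarrow> m < n \<Longrightarrow> exact_at N S (B m) (B (Suc m)) (B (Suc (Suc m))) (\<psi> m) (\<psi> (Suc m))) \<Longrightarrow>
    s \<in> S \<Longrightarrow>
    (\<And>l j. l \<in> tuples E (Suc k) \<Longrightarrow> j \<in> B i \<Longrightarrow>
       s * kos x (\<lambda>m. c m j) l - bdry B \<psi> i (w l) j \<in> N) \<Longrightarrow>
    \<exists>s\<in>S. \<exists>a w. \<forall>l\<in>tuples E k. \<forall>j\<in>B i.
       s * c l j - kos x (\<lambda>m. a m j) l - bdry B \<psi> i (w l) j \<in> N"
proof (induction "n - i" arbitrary: i k s c w)
  case 0
  then have i: "i = n" by simp
  have "kos x (\<lambda>m. c m j) l \<in> N" if "l \<in> tuples E (Suc k)" "j \<in> B i" for l j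
    using 0(6)[OF that] 0(5) saturated by (auto simp: i top lin_def)
  with koszul_exact_vec[OF K fin, of k "i" c] 0 obtain s' b
    where s': "s' \<in> S" and b: "\<forall>j\<in>B i. \<forall>l\<in>tuples E k. s' * c l j - kos x (\<lambda>m. b m j) l \<in> N"
    by auto
  then show ?case
    by (intro bexI[of _ s'] exI[of _ b]) (auto simp: i top lin_def)
next
  case (Suc d)
  have i: "i < n" using Suc.hyps(2) by simp
  have cy: "\<forall>l\<in>tuples E (Suc (Suc k)). \<forall>j\<in>B i.
      bdry B \<psi> i (\<lambda>q. kos x (\<lambda>m. w m q) l) j \<in> N"
  proof (intro ballI)
    fix l j assume l: "l \<in> tuples E (Suc (Suc k))" and j: "j \<in> B i"
    have "kos x (\<lambda>l. s * kos x (\<lambda>m. c m j) l - bdry B \<psi> i (w l) j) l \<in> N"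
      by (rule kos_N[OF _ l]) (use Suc.prems(5) j in auto)
    then show "bdry B \<psi> i (\<lambda>q. kos x (\<lambda>m. w m q) l) j \<in> N"
      using uminus_N by (fastforce simp: kos_diff kos_scale kos_kos kos_lin)
  qed
  have ex: "exact_at N S (B i) (B (Suc i)) (B (Suc (Suc i))) (\<psi> i) (\<psi> (Suc i))"
    using Suc.prems(3) i by simp
  obtain s1 w1 where s1: "s1 \<in> S" and w1: "\<And>l j. l\<in>tuples E (Suc (Suc k)) \<Longrightarrow> j\<in>B (Suc i) \<Longrightarrow>
      s1 * kos x (\<lambda>m. w m j) l - bdry B \<psi> (Suc i) (w1 l) j \<in> N"
    using exact_at_cochain[OF ex finite_tuples[OF E] cy] by blast
  have "\<exists>s\<in>S. \<exists>a w'. \<forall>l\<in>tuples E (Suc k). \<forall>j\<in>B (Suc i).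
       s * w l j - kos x (\<lambda>m. a m j) l - bdry B \<psi> (Suc i) (w' l) j \<in> N"
    by (rule Suc.hyps(1)[of "Suc i" "Suc k" s1 w w1]) (use Suc.hyps(2) Suc.prems i s1 w1 in auto)
  then obtain s2 u t where s2: "s2 \<in> S" and ut: "\<And>l j. l\<in>tuples E (Suc k) \<Longrightarrow> j\<in>B (Suc i) \<Longrightarrow>
       s2 * w l j - kos x (\<lambda>m. u m j) l - bdry B \<psi> (Suc i) (t l) j \<in> N"
    by blast
  define c' where "c' l = (\<lambda>j. s2 * s * c l j - bdry B \<psi> i (u l) j)" for l
  have cy: "\<forall>l\<in>tuples E (Suc k). \<forall>j\<in>B i. kos x (\<lambda>m. c' m j) l \<in> N"
  proof (intro ballI)
    fix l j assume l: "l \<in> tuples E (Suc k)" and j: "j \<in> B i"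
    have 1: "s2 * (s * kos x (\<lambda>m. c m j) l - bdry B \<psi> i (w l) j) \<in> N"
      using Suc.prems(5)[OF l j] by (rule mult_N)
    have "bdry B \<psi> i (\<lambda>q. s2 * w l q - kos x (\<lambda>m. u m q) l -
        bdry B \<psi> (Suc i) (t l) q) j \<in> N"
      by (rule lin_N) (use ut l in auto)
    then have 2: "s2 * bdry B \<psi> i (w l) j - kos x (\<lambda>m. bdry B \<psi> i (u m) j) l
       - bdry B \<psi> i (bdry B \<psi> (Suc i) (t l)) j \<in> N"
      by (simp add: lin_diff lin_scale kos_lin)
    have 3: "bdry B \<psi> i (bdry B \<psi> (Suc i) (t l)) j \<in> N"
      using cx i j by (auto intro!: lin_lin_N simp: complex_upto_def)
    show "kos x (\<lambda>m. c' m j) l \<in> N" using add_N[OF 1 add_N[OF 2 3]]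
      by (simp add: c'_def kos_diff kos_scale algebra_simps)
  qed
  have "k < n" using Suc.prems(1) i by simp
  then obtain s3 b
    where s3: "s3 \<in> S" and b: "\<And>j l. j\<in>B i \<Longrightarrow> l\<in>tuples E k \<Longrightarrow> s3 * c' l j - kos x (\<lambda>m. b m j) l \<in> N"
    using koszul_exact_vec[OF K fin cy] by blast
  have "(s3 * (s2 * s)) * c l j - kos x (\<lambda>m. b m j) l - bdry B \<psi> i (\<lambda>q. s3 * u l q) j \<in> N"
    if "l \<in> tuples E k" "j \<in> B i" for l j
    using b[OF that(2,1)] by (simp add: c'_def lin_scale algebra_simps)
  then show ?case
    using s3 s2 Suc.prems(4)
    by (intro bexI[of _ "s3 * (s2 * s)"] exI[of _ b] exI[of _ "\<lambda>l q. s3 * u l q"]) (auto intro: mult_S)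
qed

end

context localized_quotient
begin

definition in_image :: "nat set \<Rightarrow> nat set \<Rightarrow> (nat \<Rightarrow> nat \<Rightarrow> 'r) \<Rightarrow> (nat \<Rightarrow> 'r) \<Rightarrow> bool"
  where "in_image Y Z g v \<longleftrightarrow> (\<exists>s\<in>S. \<exists>w. \<forall>k\<in>Y. s * v k - lin Z g w k \<in> N)"

lemma exact_at_iff: "exact_at N S B Y Z f g \<longleftrightarrow> (\<forall>v. (\<forall>j\<in>B. lin Y f v j \<in> N) \<longrightarrow> in_image Y Z g v)"
  by (simp add: exact_at_def in_image_def)

lemma in_image_scale:
  assumes "in_image Y Z g v"
  shows "in_image Y Z g (\<lambda>k. q * v k)"
proof -
  obtain s w where s: "s \<in> S" and w: "\<forall>k\<in>Y. s * v k - lin Z g w k \<in> N"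
    using assms unfolding in_image_def by blast
  have "s * (q * v k) - lin Z g (\<lambda>k. q * w k) k \<in> N" if "k \<in> Y" for k
    using mult_N[OF w[rule_format, OF that], of q] unfolding lin_scale by (simp add: algebra_simps)
  then show ?thesis unfolding in_image_def using s by blast
qed

lemma in_image_add:
  assumes "in_image Y Z g v" "in_image Y Z g v'"
  shows "in_image Y Z g (\<lambda>k. v k + v' k)"
proof -
  obtain s w where s: "s \<in> S" and w: "\<forall>k\<in>Y. s * v k - lin Z g w k \<in> N"
    using assms(1) unfolding in_image_def by blast
  obtain s' w' where s': "s' \<in> S" and w': "\<forall>k\<in>Y. s' * v' k - lin Z g w' k \<in> N"
    using assms(2) unfolding in_image_def by blast
  have "(s * s') * (v k + v' k) - lin Z g (\<lambda>k. s' * w k + s * w' k) k \<in> N" if "k \<in> Y" for k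
    using add_N[OF mult_N[OF w[rule_format, OF that], of s'] mult_N[OF w'[rule_format, OF that], of s]]
    unfolding lin_add lin_scale by (simp add: algebra_simps)
  then show ?thesis unfolding in_image_def using mult_S[OF s s'] by blast
qed

lemma in_image_saturated:
  assumes t: "t \<in> S" and v: "in_image Y Z g (\<lambda>k. t * v k)"
  shows "in_image Y Z g v"
proof -
  obtain s w where s: "s \<in> S" and w: "\<forall>k\<in>Y. s * (t * v k) - lin Z g w k \<in> N"
    using v unfolding in_image_def by blast
  then have "\<forall>k\<in>Y. (s * t) * v k - lin Z g w k \<in> N" by (simp add: mult.assoc)
  then show ?thesis unfolding in_image_def using mult_S[OF s t] by blast
qed

text \<open>The acyclicity lemma of Peskine and Szpiro: homology that is torsion with respect to elements of
grade at least the length of the complex is zero. Exactness is proved from the last module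
downwards. If all \<open>x e * v\<close> are images, then \<open>v\<close> is a Koszul cochain of degree \<open>0\<close> whose coboundary is
an image, and \<open>koszul_ascent\<close> says that \<open>v\<close> itself is an image.\<close>

lemma acyclic_of_torsion:
  fixes x :: "'e \<Rightarrow> 'r"
  assumes cx: "complex_upto N n B \<psi>" and fin: "\<And>i. finite (B i)" and E: "finite E"
    and top: "B (Suc n) = {}" and K: "\<And>j. j < n \<Longrightarrow> koszul_exact N S E x j"
    and tors: "\<And>e i v. e \<in> E \<Longrightarrow> i < n \<Longrightarrow> (\<forall>j\<in>B i. bdry B \<psi> i v j \<in> N) \<Longrightarrow>
      \<exists>m. in_image (B (Suc i)) (B (Suc (Suc i))) (\<psi> (Suc i)) (\<lambda>k. x e ^ m * v k)"
  shows "acyclic_upto N S n B \<psi>"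
proof -
  have "exact_at N S (B i) (B (Suc i)) (B (Suc (Suc i))) (\<psi> i) (\<psi> (Suc i))" if "i < n" for i
    using that
  proof (induction "n - i" arbitrary: i rule: less_induct)
    case (less i)
    have ex: "exact_at N S (B m) (B (Suc m)) (B (Suc (Suc m))) (\<psi> m) (\<psi> (Suc m))"
      if "Suc i \<le> m" "m < n" for m
      using less.hyps[of m] less.prems that by simp
    let ?D = "in_image (B (Suc i)) (B (Suc (Suc i))) (\<psi> (Suc i))"
    \<comment> \<open>a \<open>1\<close>-tuple is \<open>[e]\<close>, so the preimages of the multiples \<open>x e * v\<close> form a cochain of degree \<open>1\<close>\<close>
    have closed: "?D v" if v: "\<forall>e\<in>E. ?D (\<lambda>k. x e * v k)" for v
    proof -
      have "\<exists>s\<in>S. \<exists>w. \<forall>e\<in>E. \<forall>k\<in>B (Suc i).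
          s * (x e * v k) - bdry B \<psi> (Suc i) (w e) k \<in> N"
      proof (rule common_denominator[OF E])
        show "\<exists>s\<in>S. \<exists>w. \<forall>k\<in>B (Suc i). s * (x e * v k) - bdry B \<psi> (Suc i) w k \<in> N"
          if "e \<in> E" for e
          using v that unfolding in_image_def by blast
        show "\<exists>w. \<forall>k\<in>B (Suc i). t * s * (x e * v k) - bdry B \<psi> (Suc i) w k \<in> N"
          if w: "\<forall>k\<in>B (Suc i). s * (x e * v k) - bdry B \<psi> (Suc i) w k \<in> N"
          for e s t w
        proof (intro exI[of _ "\<lambda>k. t * w k"] ballI)
          fix k assume "k \<in> B (Suc i)"
          then show "t * s * (x e * v k) - bdry B \<psi> (Suc i) (\<lambda>k. t * w k) k \<in> N"
            using mult_N[OF w[rule_format], of k t] unfolding lin_scale by (simp add: algebra_simps)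
        qed
      qed
      then obtain s w where s: "s \<in> S" and w: "\<And>e k. e \<in> E \<Longrightarrow> k \<in> B (Suc i) \<Longrightarrow>
          s * (x e * v k) - bdry B \<psi> (Suc i) (w e) k \<in> N" by blast
      have "\<exists>s\<in>S. \<exists>a w. \<forall>l\<in>tuples E 0. \<forall>j\<in>B (Suc i).
         s * v j - kos x (\<lambda>m. a m j) l - bdry B \<psi> (Suc i) (w l) j \<in> N"
      proof (rule koszul_ascent[OF cx fin E top K, of 0 "Suc i" s "\<lambda>l. v" "\<lambda>l. w (hd l)"])
        fix l j assume l: "l \<in> tuples E (Suc 0)" and j: "j \<in> B (Suc i)"
        then obtain e where "l = [e]" "e \<in> E"
          by (cases l) (auto simp: tuples_def)
        then show "s * kos x (\<lambda>m. v j) l - bdry B \<psi> (Suc i) (w (hd l)) j \<in> N"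
          using w[of e j] j by simp
      qed (use less.prems s ex in auto)
      then show ?thesis unfolding in_image_def tuples_0 by auto
    qed
    \<comment> \<open>lower one of the exponents \<open>m e\<close> at a time\<close>
    have radical: "?D v" if "\<forall>e\<in>E. ?D (\<lambda>k. x e ^ m e * v k)" for m v
      using that
    proof (induction "sum m E" arbitrary: m v rule: less_induct)
      case less
      show ?case
      proof (rule closed, intro ballI)
        fix e assume e: "e \<in> E"
        show "?D (\<lambda>k. x e * v k)"
        proof (cases "m e")
          case 0
          then have "?D v" using less.prems e by auto
          then show ?thesis by (rule in_image_scale)
        next
          case (Suc q)
          define m' where "m' = m(e := q)"
          show ?thesis
          proof (rule less.hyps[of m'])
            show "sum m' E < sum m E"
              by (rule sum_strict_mono_ex1) (use E e Suc in \<open>auto simp: m'_def\<close>)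
            show "\<forall>f\<in>E. ?D (\<lambda>k. x f ^ m' f * (x e * v k))"
            proof
              fix f assume f: "f \<in> E"
              define r where "r = (if f = e then 1 else x e)"
              have "x f ^ m' f * x e = r * x f ^ m f"
                using Suc by (auto simp: m'_def r_def mult.commute)
              then have eq: "x f ^ m' f * (x e * v k) = r * (x f ^ m f * v k)" for k
                by (metis mult.assoc)
              show "?D (\<lambda>k. x f ^ m' f * (x e * v k))"
                unfolding eq by (rule in_image_scale) (use less.prems f in blast)
            qed
          qed
        qed
      qed
    qed
    show ?case unfolding exact_at_iff
    proof (intro allI impI)
      fix v assume v: "\<forall>j\<in>B i. bdry B \<psi> i v j \<in> N"
      have "\<forall>e\<in>E. \<exists>m. ?D (\<lambda>k. x e ^ m * v k)"
        using tors[OF _ less.prems v] by blast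
      then have "\<exists>m. \<forall>e\<in>E. ?D (\<lambda>k. x e ^ m e * v k)" by (rule bchoice)
      then show "?D v" using radical by blast
    qed
  qed
  then show ?thesis by (simp add: acyclic_upto_def)
qed

end

section \<open>Inverting an element\<close>

text \<open>Passing from \<open>N\<close> and \<open>S\<close> to the following two sets inverts the element \<open>x\<close>.\<close>

definition invert_null :: "'r::comm_ring_1 set \<Rightarrow> 'r \<Rightarrow> 'r set"
  where "invert_null N x = {y. \<exists>k. x ^ k * y \<in> N}"

definition invert_units :: "'r::comm_ring_1 set \<Rightarrow> 'r \<Rightarrow> 'r set"
  where "invert_units S x = {s * x ^ k | s k. s \<in> S}"

context localized_quotient
begin

lemma pow_N_mono: "x ^ k * y \<in> N \<Longrightarrow> k \<le> l \<Longrightarrow> x ^ l * y \<in> N"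
  using mult_N[of "x ^ k * y" "x ^ (l - k)"] by (simp add: mult.assoc[symmetric] power_add[symmetric])

lemma invert_null_common:
  assumes "finite I" "\<And>i. i \<in> I \<Longrightarrow> f i \<in> invert_null N x"
  shows "\<exists>k. \<forall>i\<in>I. x ^ k * f i \<in> N"
proof -
  have "\<forall>i\<in>I. \<exists>k. x ^ k * f i \<in> N" using assms(2) by (auto simp: invert_null_def)
  then have "\<exists>k. \<forall>i\<in>I. x ^ k i * f i \<in> N" by (rule bchoice)
  then obtain k where k: "\<forall>i\<in>I. x ^ k i * f i \<in> N" ..
  have "x ^ sum k I * f i \<in> N" if "i \<in> I" for i
    by (rule pow_N_mono[of x "k i"])
      (use k[rule_format, OF that] member_le_sum[of i I k] that assms(1) in simp_all)
  then show ?thesis by blast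
qed

lemma N_subset_invert: "N \<subseteq> invert_null N x"
  by (auto simp: invert_null_def intro: exI[of _ 0])

lemma S_subset_invert: "S \<subseteq> invert_units S x"
proof
  fix s assume "s \<in> S"
  then show "s \<in> invert_units S x"
    unfolding invert_units_def by (metis (mono_tags, lifting) mem_Collect_eq mult.right_neutral power_0)
qed

lemma pow_in_invert_units: "x ^ k \<in> invert_units S x"
  unfolding invert_units_def using one_S by (metis (mono_tags, lifting) mem_Collect_eq mult.left_neutral)

lemma localized_quotient_invert: "localized_quotient (invert_null N x) (invert_units S x)"
proof
  show "0 \<in> invert_null N x" using N_subset_invert zero_N by blast
  show "a + b \<in> invert_null N x" if ab: "a \<in> invert_null N x" "b \<in> invert_null N x" for a b
  proof -
    obtain k l where "x ^ k * a \<in> N" "x ^ l * b \<in> N" using ab by (auto simp: invert_null_def)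
    then have "x ^ (k + l) * a \<in> N" "x ^ (k + l) * b \<in> N" using pow_N_mono[of x k a "k + l"] pow_N_mono[of x l b "k + l"] by simp_all
    then have "x ^ (k + l) * (a + b) \<in> N" using add_N by (simp add: distrib_left)
    then show ?thesis by (auto simp: invert_null_def)
  qed
  show "r * a \<in> invert_null N x" if "a \<in> invert_null N x" for r a
    using that mult_N[of _ r] by (fastforce simp: invert_null_def mult.left_commute)
  show "1 \<in> invert_units S x" using pow_in_invert_units[of x 0] by simp
  show "s * t \<in> invert_units S x" if su: "s \<in> invert_units S x" "t \<in> invert_units S x" for s t
  proof -
    obtain s' k t' l where "s = s' * x ^ k" "t = t' * x ^ l" and st: "s' \<in> S" "t' \<in> S"
      using su by (auto simp: invert_units_def)
    then have "s * t = (s' * t') * x ^ (k + l)" by (simp add: power_add algebra_simps)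
    then show ?thesis using mult_S[OF st] by (auto simp: invert_units_def)
  qed
  show "a \<in> invert_null N x" if s: "s \<in> invert_units S x" and a: "s * a \<in> invert_null N x" for s a
  proof -
    obtain s' k where s': "s = s' * x ^ k" "s' \<in> S" using s by (auto simp: invert_units_def)
    obtain l where "x ^ l * (s * a) \<in> N" using a by (auto simp: invert_null_def)
    then have "s' * (x ^ (l + k) * a) \<in> N" by (simp add: s' power_add algebra_simps)
    then show ?thesis using saturated[OF s'(2)] by (auto simp: invert_null_def)
  qed
qed

lemma acyclic_invert:
  assumes fin: "\<And>i. finite (B i)" and ac: "acyclic_upto N S n B \<phi>"
  shows "acyclic_upto (invert_null N x) (invert_units S x) n B \<phi>"
  unfolding acyclic_upto_def exact_at_def
proof (intro allI impI)
  fix m v assume m: "m < n"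
    and v: "\<forall>j\<in>B m. bdry B \<phi> m v j \<in> invert_null N x"
  obtain k where k: "\<forall>j\<in>B m. x ^ k * bdry B \<phi> m v j \<in> N"
    using invert_null_common[OF fin, of m "bdry B \<phi> m v" x] v by blast
  then have "\<forall>j\<in>B m. bdry B \<phi> m (\<lambda>q. x ^ k * v q) j \<in> N"
    by (simp add: lin_scale)
  then obtain s w where s: "s \<in> S" and w: "\<forall>q\<in>B (Suc m).
      s * (x ^ k * v q) - bdry B \<phi> (Suc m) w q \<in> N"
    using ac m unfolding acyclic_upto_def exact_at_def by blast
  have "s * x ^ k \<in> invert_units S x" using s by (auto simp: invert_units_def)
  moreover have "\<forall>q\<in>B (Suc m). s * x ^ k * v q - bdry B \<phi> (Suc m) w q \<in> invert_null N x"
    using w N_subset_invert by (auto simp: mult.assoc)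
  ultimately show "\<exists>s\<in>invert_units S x. \<exists>w. \<forall>k\<in>B (Suc m).
      s * v k - bdry B \<phi> (Suc m) w k \<in> invert_null N x" by blast
qed

text \<open>What exactness after inverting \<open>x\<close> says before it: homology is killed by powers of \<open>x\<close>.\<close>

lemma torsion_of_invert:
  assumes fin: "\<And>i. finite (B i)" and ac: "acyclic_upto (invert_null N x) (invert_units S x) n B \<psi>"
    and i: "i < n" and v: "\<forall>j\<in>B i. bdry B \<psi> i v j \<in> N"
  shows "\<exists>m. in_image (B (Suc i)) (B (Suc (Suc i))) (\<psi> (Suc i)) (\<lambda>k. x ^ m * v k)"
proof -
  obtain s w where s: "s \<in> invert_units S x" and w: "\<forall>k\<in>B (Suc i).
      s * v k - bdry B \<psi> (Suc i) w k \<in> invert_null N x"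
    using ac i v N_subset_invert unfolding acyclic_upto_def exact_at_def by (meson subsetD)
  obtain t k where t: "t \<in> S" "s = t * x ^ k" using s by (auto simp: invert_units_def)
  obtain l where l: "\<forall>k\<in>B (Suc i). x ^ l * (s * v k - bdry B \<psi> (Suc i) w k) \<in> N"
    using invert_null_common[OF fin, of "Suc i" "\<lambda>k. s * v k - bdry B \<psi> (Suc i) w k" x] w
    by blast
  have "t * (x ^ (k + l) * v q) - bdry B \<psi> (Suc i) (\<lambda>q. x ^ l * w q) q \<in> N"
    if "q \<in> B (Suc i)" for q
    using l[rule_format, OF that] unfolding lin_scale by (simp add: t power_add algebra_simps)
  then show ?thesis unfolding in_image_def using t(1) by blast
qed

end

section \<open>Pivots\<close>

text \<open>Gaussian elimination at the entry \<open>M r c\<close> without division: this is \<open>M r c\<close> times the Schur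
complement of that entry, with a zero row \<open>r\<close> and a zero column \<open>c\<close>.\<close>

definition pivot :: "(nat \<Rightarrow> nat \<Rightarrow> 'r::comm_ring_1) \<Rightarrow> nat \<Rightarrow> nat \<Rightarrow> nat \<Rightarrow> nat \<Rightarrow> 'r"
  where "pivot M r c j k = M r c * M j k - M j c * M r k"

lemma pivot_row: "pivot M r c r k = 0"
  by (simp add: pivot_def)

lemma pivot_col: "pivot M r c j c = 0"
  by (simp add: pivot_def mult.commute)

lemma lin_pivot:
  assumes "finite C"
  shows "lin (C - {c}) (pivot M r c) v j = M r c * lin C M v j - M j c * lin C M v r"
proof -
  have "lin (C - {c}) (pivot M r c) v j = lin C (pivot M r c) v j"
    unfolding lin_def by (rule sum.mono_neutral_left) (use assms in \<open>auto simp: pivot_col\<close>)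
  also have "\<dots> = M r c * lin C M v j - M j c * lin C M v r"
    by (simp add: lin_def pivot_def left_diff_distrib sum_subtractf sum_distrib_left mult.assoc)
  finally show ?thesis .
qed

lemma lin_remove: "finite C \<Longrightarrow> c \<in> C \<Longrightarrow> lin C M v j = M j c * v c + lin (C - {c}) M v j"
  by (simp add: lin_def sum.remove)

lemma lin_upd_notin: "c \<notin> C \<Longrightarrow> lin C M (v(c := y)) j = lin C M v j"
  unfolding lin_def by (rule sum.cong) auto

context localized_quotient
begin

text \<open>If the entry \<open>a = M r c\<close> is invertible, then \<open>R \<rightarrow> R\<close> with the map \<open>a\<close> splits off from a complex that
contains \<open>M\<close>, and the pivot is the matrix that remains. The maps between the two complexes are
\<open>v j \<mapsto> a * v j - M j c * v r\<close> on the target of \<open>M\<close>, and on its source the vector with the coordinate at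
\<open>c\<close> chosen such that \<open>M\<close> maps it to a vector with coordinate \<open>0\<close> at \<open>r\<close>. The splitting changes the
complex in two modules, so that exactness is compared in four positions.\<close>

context
  fixes M :: "nat \<Rightarrow> nat \<Rightarrow> 'r" and A C r c
  assumes fin: "finite A" "finite C" and r: "r \<in> A" and c: "c \<in> C" and a: "M r c \<in> S"
begin

lemma exact_pivot_target:
  assumes g: "\<And>k. k \<in> Y \<Longrightarrow> (\<Sum>j\<in>A. g k j * M j c) \<in> N"
  shows "exact_at N S D Y (A - {r}) f g \<longleftrightarrow> exact_at N S D Y A f g"
proof
  assume ex: "exact_at N S D Y (A - {r}) f g"
  show "exact_at N S D Y A f g" unfolding exact_at_def
  proof (intro allI impI)
    fix v assume "\<forall>j\<in>D. lin Y f v j \<in> N"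
    then obtain s w where "s \<in> S" "\<forall>k\<in>Y. s * v k - lin (A - {r}) g w k \<in> N"
      using ex unfolding exact_at_def by blast
    moreover have "lin A g (w(r := 0)) k = lin (A - {r}) g w k" for k
      using r fin by (simp add: lin_remove lin_upd_notin)
    ultimately show "\<exists>s\<in>S. \<exists>w. \<forall>k\<in>Y. s * v k - lin A g w k \<in> N" by metis
  qed
next
  assume ex: "exact_at N S D Y A f g"
  show "exact_at N S D Y (A - {r}) f g" unfolding exact_at_def
  proof (intro allI impI)
    fix v assume "\<forall>j\<in>D. lin Y f v j \<in> N"
    then obtain s w where s: "s \<in> S" and w: "\<forall>k\<in>Y. s * v k - lin A g w k \<in> N"
      using ex unfolding exact_at_def by blast
    define w' where "w' = (\<lambda>j. M r c * w j - w r * M j c)"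
    have "M r c * s * v k - lin (A - {r}) g w' k \<in> N" if k: "k \<in> Y" for k
    proof -
      have "lin (A - {r}) g w' k = lin A g w' k"
        using r fin by (simp add: lin_remove w'_def)
      also have "\<dots> = M r c * lin A g w k - w r * (\<Sum>j\<in>A. g k j * M j c)"
        unfolding w'_def lin_diff lin_scale by (simp add: lin_def)
      finally have "M r c * s * v k - lin (A - {r}) g w' k =
          M r c * (s * v k - lin A g w k) + w r * (\<Sum>j\<in>A. g k j * M j c)"
        by (simp add: algebra_simps)
      then show ?thesis using w g k by (auto intro!: add_N mult_N)
    qed
    then show "\<exists>s\<in>S. \<exists>w. \<forall>k\<in>Y. s * v k - lin (A - {r}) g w k \<in> N"
      using mult_S[OF a s] by blast
  qed
qed

lemma exact_pivot_rows:
  assumes g: "\<And>k. k \<in> D \<Longrightarrow> (\<Sum>j\<in>A. g k j * M j c) \<in> N"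
  shows "exact_at N S D (A - {r}) (C - {c}) g (pivot M r c) \<longleftrightarrow> exact_at N S D A C g M"
proof
  assume ex: "exact_at N S D (A - {r}) (C - {c}) g (pivot M r c)"
  show "exact_at N S D A C g M" unfolding exact_at_def
  proof (intro allI impI)
    fix v assume v: "\<forall>j\<in>D. lin A g v j \<in> N"
    define v' where "v' = (\<lambda>j. M r c * v j - v r * M j c)"
    have "lin (A - {r}) g v' k \<in> N" if k: "k \<in> D" for k
    proof -
      have "lin (A - {r}) g v' k = lin A g v' k"
        using r fin by (simp add: lin_remove v'_def)
      also have "\<dots> = M r c * lin A g v k - v r * (\<Sum>j\<in>A. g k j * M j c)"
        unfolding v'_def lin_diff lin_scale by (simp add: lin_def)
      finally show ?thesis using v g k by (auto intro!: diff_N mult_N)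
    qed
    then obtain s w where s: "s \<in> S"
      and w: "\<forall>k\<in>A - {r}. s * v' k - lin (C - {c}) (pivot M r c) w k \<in> N"
      using ex unfolding exact_at_def by blast
    define u where "u = (\<lambda>k. M r c * w k + (if k = c then s * v r - lin C M w r else 0))"
    have u: "lin C M u j = M r c * lin C M w j + M j c * (s * v r - lin C M w r)" for j
      using fin c by (simp add: u_def lin_add lin_scale) (simp add: lin_def if_distrib cong: if_cong)
    have "M r c * s * v j - lin C M u j \<in> N" if j: "j \<in> A" for j
    proof (cases "j = r")
      case True
      then show ?thesis using u[of r] zero_N by (simp add: algebra_simps)
    next
      case False
      have "M r c * s * v j - lin C M u j = s * v' j - lin (C - {c}) (pivot M r c) w j"
        using fin by (simp add: u lin_pivot v'_def algebra_simps)
      then show ?thesis using w j False by auto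
    qed
    then show "\<exists>s\<in>S. \<exists>w. \<forall>k\<in>A. s * v k - lin C M w k \<in> N"
      using mult_S[OF a s] by blast
  qed
next
  assume ex: "exact_at N S D A C g M"
  show "exact_at N S D (A - {r}) (C - {c}) g (pivot M r c)" unfolding exact_at_def
  proof (intro allI impI)
    fix v assume v: "\<forall>j\<in>D. lin (A - {r}) g v j \<in> N"
    have "\<forall>j\<in>D. lin A g (v(r := 0)) j \<in> N"
      using v r fin by (simp add: lin_remove lin_upd_notin)
    then obtain s w where s: "s \<in> S" and w: "\<forall>k\<in>A. s * (v(r := 0)) k - lin C M w k \<in> N"
      using ex unfolding exact_at_def by blast
    have "M r c * s * v k - lin (C - {c}) (pivot M r c) w k \<in> N" if k: "k \<in> A - {r}" for k
    proof -
      have "lin C M w r \<in> N" using w r uminus_N[of "- lin C M w r"] by force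
      moreover have "s * v k - lin C M w k \<in> N" using w k by auto
      moreover have "M r c * s * v k - lin (C - {c}) (pivot M r c) w k =
          M r c * (s * v k - lin C M w k) + M k c * lin C M w r"
        using fin by (simp add: lin_pivot algebra_simps)
      ultimately show ?thesis by (auto intro!: add_N mult_N)
    qed
    then show "\<exists>s\<in>S. \<exists>w. \<forall>k\<in>A - {r}. s * v k - lin (C - {c}) (pivot M r c) w k \<in> N"
      using mult_S[OF a s] by blast
  qed
qed

lemma exact_pivot_cols:
  assumes h: "\<And>l. l \<in> Z \<Longrightarrow> (\<Sum>k\<in>C. M r k * h k l) \<in> N"
  shows "exact_at N S (A - {r}) (C - {c}) Z (pivot M r c) h \<longleftrightarrow> exact_at N S A C Z M h"
proof
  assume ex: "exact_at N S (A - {r}) (C - {c}) Z (pivot M r c) h"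
  show "exact_at N S A C Z M h" unfolding exact_at_def
  proof (intro allI impI)
    fix v assume v: "\<forall>j\<in>A. lin C M v j \<in> N"
    have "\<forall>j\<in>A - {r}. lin (C - {c}) (pivot M r c) v j \<in> N"
      using v r fin by (auto simp: lin_pivot intro!: diff_N mult_N)
    then obtain s w where s: "s \<in> S" and w: "\<forall>k\<in>C - {c}. s * v k - lin Z h w k \<in> N"
      using ex unfolding exact_at_def by blast
    have "lin C M (\<lambda>k. s * v k - lin Z h w k) r \<in> N"
    proof -
      have "lin C M (lin Z h w) r \<in> N" by (intro lin_lin_N h)
      then show ?thesis using v r by (auto simp: lin_diff lin_scale intro!: diff_N mult_N)
    qed
    moreover have "lin (C - {c}) M (\<lambda>k. s * v k - lin Z h w k) r \<in> N"
      by (rule lin_N) (use w in auto)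
    ultimately have "M r c * (s * v c - lin Z h w c) \<in> N"
      using c fin diff_N by (fastforce simp: lin_remove)
    then have "s * v c - lin Z h w c \<in> N" using a saturated by blast
    then have "\<forall>k\<in>C. s * v k - lin Z h w k \<in> N" using w by auto
    then show "\<exists>s\<in>S. \<exists>w. \<forall>k\<in>C. s * v k - lin Z h w k \<in> N" using s by blast
  qed
next
  assume ex: "exact_at N S A C Z M h"
  show "exact_at N S (A - {r}) (C - {c}) Z (pivot M r c) h" unfolding exact_at_def
  proof (intro allI impI)
    fix v assume v: "\<forall>j\<in>A - {r}. lin (C - {c}) (pivot M r c) v j \<in> N"
    define u where "u = (\<lambda>k. M r c * v k + (if k = c then - lin C M v r else 0))"
    have u: "lin C M u j = M r c * lin C M v j - M j c * lin C M v r" for j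
      using fin c by (simp add: u_def lin_add lin_scale) (simp add: lin_def if_distrib cong: if_cong)
    have "lin C M u j \<in> N" if "j \<in> A" for j
      using v[rule_format, of j] that zero_N fin by (cases "j = r") (simp_all add: u lin_pivot)
    then obtain s w where s: "s \<in> S" and w: "\<forall>k\<in>C. s * u k - lin Z h w k \<in> N"
      using ex unfolding exact_at_def by blast
    have "M r c * s * v k - lin Z h w k \<in> N" if "k \<in> C - {c}" for k
      using w[rule_format, of k] that by (simp add: u_def algebra_simps)
    then show "\<exists>s\<in>S. \<exists>w. \<forall>k\<in>C - {c}. s * v k - lin Z h w k \<in> N"
      using mult_S[OF a s] by blast
  qed
qed

lemma exact_pivot_source:
  assumes h: "\<And>l. l \<in> Z \<Longrightarrow> (\<Sum>k\<in>C. M r k * h k l) \<in> N"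
  shows "exact_at N S (C - {c}) Z W h t \<longleftrightarrow> exact_at N S C Z W h t"
proof -
  have "lin Z h v c \<in> N" if v: "\<forall>j\<in>C - {c}. lin Z h v j \<in> N" for v
  proof -
    have "lin C M (lin Z h v) r \<in> N" by (intro lin_lin_N h)
    moreover have "lin (C - {c}) M (lin Z h v) r \<in> N" by (rule lin_N) (use v in auto)
    ultimately have "M r c * lin Z h v c \<in> N"
      using c fin diff_N by (fastforce simp: lin_remove)
    then show ?thesis using a saturated by blast
  qed
  then have "(\<forall>j\<in>C - {c}. lin Z h v j \<in> N) \<longleftrightarrow> (\<forall>j\<in>C. lin Z h v j \<in> N)" for v by auto
  then show ?thesis by (simp add: exact_at_def)
qed

end

end

definition pivot_index :: "(nat \<Rightarrow> nat set) \<Rightarrow> nat \<Rightarrow> nat \<Rightarrow> nat \<Rightarrow> nat \<Rightarrow> nat set"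
  where "pivot_index B i r c = B(i := B i - {r}, Suc i := B (Suc i) - {c})"

definition pivot_maps ::
  "(nat \<Rightarrow> nat \<Rightarrow> nat \<Rightarrow> 'r::comm_ring_1) \<Rightarrow> nat \<Rightarrow> nat \<Rightarrow> nat \<Rightarrow> nat \<Rightarrow> nat \<Rightarrow> nat \<Rightarrow> 'r"
  where "pivot_maps \<phi> i r c = \<phi>(i := pivot (\<phi> i) r c)"

lemma finite_pivot_index: "(\<And>i. finite (B i)) \<Longrightarrow> finite (pivot_index B i r c m)"
  by (simp add: pivot_index_def)

lemma card_pivot_index:
  assumes "\<And>i. finite (B i)" "r \<in> B i" "c \<in> B (Suc i)" "i \<le> n"
  shows "(\<Sum>m\<le>Suc n. card (pivot_index B i r c m)) < (\<Sum>m\<le>Suc n. card (B m))"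
proof (rule sum_strict_mono_ex1)
  show "\<forall>m\<in>{..Suc n}. card (pivot_index B i r c m) \<le> card (B m)"
    using assms(1) by (auto simp: pivot_index_def intro!: card_mono)
  show "\<exists>m\<in>{..Suc n}. card (pivot_index B i r c m) < card (B m)"
    using assms(4) card_Diff1_less[OF assms(1,2)]
    by (intro bexI[of _ i]) (simp_all add: pivot_index_def)
qed simp

context localized_quotient
begin

lemma pivot_complex:
  assumes cx: "complex_upto N n B \<phi>" and fin: "\<And>i. finite (B i)"
    and rc: "r \<in> B i" "c \<in> B (Suc i)"
  shows "complex_upto N n (pivot_index B i r c) (pivot_maps \<phi> i r c)"
  unfolding complex_upto_def
proof (intro allI impI ballI)
  fix m j l
  assume m: "m < n" and j: "j \<in> pivot_index B i r c m"
    and l: "l \<in> pivot_index B i r c (Suc (Suc m))"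
  have jl: "j \<in> B m" "l \<in> B (Suc (Suc m))"
    using j l by (auto simp: pivot_index_def split: if_splits)
  have orig: "(\<Sum>k\<in>B (Suc m). \<phi> m j k * \<phi> (Suc m) k l) \<in> N" if "j \<in> B m" "l \<in> B (Suc (Suc m))" for j l
    using cx m that by (simp add: complex_upto_def)
  consider "m = i" | "Suc m = i" | "m \<noteq> i" "Suc m \<noteq> i" by blast
  then show "(\<Sum>k\<in>pivot_index B i r c (Suc m).
      pivot_maps \<phi> i r c m j k * pivot_maps \<phi> i r c (Suc m) k l) \<in> N"
  proof cases
    case 1
    have "(\<Sum>k\<in>pivot_index B i r c (Suc m). pivot_maps \<phi> i r c m j k * pivot_maps \<phi> i r c (Suc m) k l)
      = lin (B (Suc m) - {c}) (pivot (\<phi> m) r c) (\<lambda>k. \<phi> (Suc m) k l) j"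
      by (simp add: 1 pivot_index_def pivot_maps_def lin_def)
    also have "\<dots> = \<phi> m r c * (\<Sum>k\<in>B (Suc m). \<phi> m j k * \<phi> (Suc m) k l)
        - \<phi> m j c * (\<Sum>k\<in>B (Suc m). \<phi> m r k * \<phi> (Suc m) k l)"
      unfolding lin_pivot[OF fin] by (simp add: lin_def)
    also have "\<dots> \<in> N" using orig jl rc 1 by (auto intro!: diff_N mult_N)
    finally show ?thesis .
  next
    case 2
    have "(\<Sum>k\<in>pivot_index B i r c (Suc m). pivot_maps \<phi> i r c m j k * pivot_maps \<phi> i r c (Suc m) k l)
      = (\<Sum>k\<in>B (Suc m) - {r}. \<phi> m j k * pivot (\<phi> (Suc m)) r c k l)"
      using 2 by (simp add: pivot_index_def pivot_maps_def)
    also have "\<dots> = (\<Sum>k\<in>B (Suc m). \<phi> m j k * pivot (\<phi> (Suc m)) r c k l)"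
      by (rule sum.mono_neutral_left) (use fin in \<open>auto simp: pivot_row\<close>)
    also have "\<dots> = \<phi> (Suc m) r c * (\<Sum>k\<in>B (Suc m). \<phi> m j k * \<phi> (Suc m) k l)
        - \<phi> (Suc m) r l * (\<Sum>k\<in>B (Suc m). \<phi> m j k * \<phi> (Suc m) k c)"
      by (simp add: pivot_def right_diff_distrib sum_subtractf sum_distrib_left algebra_simps)
    also have "\<dots> \<in> N" using orig jl rc 2 by (auto intro!: diff_N mult_N)
    finally show ?thesis .
  next
    case 3
    then have "pivot_index B i r c (Suc m) = B (Suc m)" "pivot_maps \<phi> i r c m = \<phi> m"
      "pivot_maps \<phi> i r c (Suc m) = \<phi> (Suc m)"
      by (simp_all add: pivot_index_def pivot_maps_def)
    then show ?thesis using orig jl by simp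
  qed
qed

lemma pivot_acyclic:
  assumes cx: "complex_upto N n B \<phi>" and fin: "\<And>i. finite (B i)"
    and rc: "r \<in> B i" "c \<in> B (Suc i)" and a: "\<phi> i r c \<in> S" and i: "i \<le> n"
  shows "acyclic_upto N S n (pivot_index B i r c) (pivot_maps \<phi> i r c) \<longleftrightarrow> acyclic_upto N S n B \<phi>"
proof -
  let ?B = "pivot_index B i r c" and ?f = "pivot_maps \<phi> i r c"
  have orig: "(\<Sum>k\<in>B (Suc m). \<phi> m j k * \<phi> (Suc m) k l) \<in> N"
    if "m < n" "j \<in> B m" "l \<in> B (Suc (Suc m))" for m j l
    using cx that by (simp add: complex_upto_def)
  have "exact_at N S (?B m) (?B (Suc m)) (?B (Suc (Suc m))) (?f m) (?f (Suc m)) \<longleftrightarrow>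
    exact_at N S (B m) (B (Suc m)) (B (Suc (Suc m))) (\<phi> m) (\<phi> (Suc m))" if m: "m < n" for m
  proof -
    consider "Suc (Suc m) = i" | "Suc m = i" | "m = i" | "m = Suc i" | "Suc (Suc m) < i" | "Suc i < m"
      by linarith
    then show ?thesis
    proof cases
      case 1
      have "exact_at N S (B m) (B (Suc m)) (B i - {r}) (\<phi> m) (\<phi> (Suc m)) \<longleftrightarrow>
        exact_at N S (B m) (B (Suc m)) (B i) (\<phi> m) (\<phi> (Suc m))"
        by (rule exact_pivot_target[where M = "\<phi> i", OF fin[of i] fin[of "Suc i"] rc a]) (use orig[of "Suc m"] 1 i rc in auto)
      then show ?thesis using 1 by (auto simp: pivot_index_def pivot_maps_def)
    next
      case 2
      have "exact_at N S (B m) (B i - {r}) (B (Suc i) - {c}) (\<phi> m) (pivot (\<phi> i) r c) \<longleftrightarrow>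
        exact_at N S (B m) (B i) (B (Suc i)) (\<phi> m) (\<phi> i)"
        by (rule exact_pivot_rows[where M = "\<phi> i", OF fin[of i] fin[of "Suc i"] rc a]) (use orig[of m] 2 m rc in auto)
      then show ?thesis using 2 by (auto simp: pivot_index_def pivot_maps_def)
    next
      case 3
      have "exact_at N S (B i - {r}) (B (Suc i) - {c}) (B (Suc (Suc i))) (pivot (\<phi> i) r c) (\<phi> (Suc i)) \<longleftrightarrow>
        exact_at N S (B i) (B (Suc i)) (B (Suc (Suc i))) (\<phi> i) (\<phi> (Suc i))"
        by (rule exact_pivot_cols[where M = "\<phi> i", OF fin[of i] fin[of "Suc i"] rc a]) (use orig[of m] 3 m rc in auto)
      then show ?thesis using 3 by (simp add: pivot_index_def pivot_maps_def)
    next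
      case 4
      have "exact_at N S (B (Suc i) - {c}) (B (Suc (Suc i))) (B (Suc (Suc (Suc i)))) (\<phi> (Suc i)) (\<phi> (Suc (Suc i))) \<longleftrightarrow>
        exact_at N S (B (Suc i)) (B (Suc (Suc i))) (B (Suc (Suc (Suc i)))) (\<phi> (Suc i)) (\<phi> (Suc (Suc i)))"
        by (rule exact_pivot_source[where M = "\<phi> i", OF fin[of i] fin[of "Suc i"] rc a]) (use orig[of i] 4 m rc in auto)
      then show ?thesis using 4 by (simp add: pivot_index_def pivot_maps_def)
    qed (simp_all add: pivot_index_def pivot_maps_def)
  qed
  then show ?thesis by (simp add: acyclic_upto_def)
qed

lemma acyclic_cong:
  assumes eq: "\<And>m j k. m \<le> n \<Longrightarrow> j \<in> B m \<Longrightarrow> k \<in> B (Suc m) \<Longrightarrow> \<phi> m j k - \<psi> m j k \<in> N"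
    and ac: "acyclic_upto N S n B \<phi>"
  shows "acyclic_upto N S n B \<psi>"
  unfolding acyclic_upto_def exact_at_def
proof (intro allI impI)
  have lin: "bdry B \<phi> m v j - bdry B \<psi> m v j \<in> N"
    if "m \<le> n" "j \<in> B m" for m v j
  proof -
    have "bdry B \<phi> m v j - bdry B \<psi> m v j
        = (\<Sum>k\<in>B (Suc m). (\<phi> m j k - \<psi> m j k) * v k)"
      by (simp add: lin_def left_diff_distrib sum_subtractf)
    also have "\<dots> \<in> N" by (intro sum_N mult_N_right eq that)
    finally show ?thesis .
  qed
  fix m v assume m: "m < n" and v: "\<forall>j\<in>B m. bdry B \<psi> m v j \<in> N"
  have "bdry B \<phi> m v j \<in> N" if "j \<in> B m" for j
    using N_cong[OF lin[of m j v]] v m that by simp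
  then obtain s w where s: "s \<in> S" and w: "\<forall>k\<in>B (Suc m). s * v k - bdry B \<phi> (Suc m) w k \<in> N"
    using ac m unfolding acyclic_upto_def exact_at_def by blast
  have "s * v k - bdry B \<psi> (Suc m) w k \<in> N" if "k \<in> B (Suc m)" for k
    using add_N[OF w[rule_format, OF that] lin[of "Suc m" k w]] m that by simp
  then show "\<exists>s\<in>S. \<exists>w. \<forall>k\<in>B (Suc m). s * v k - bdry B \<psi> (Suc m) w k \<in> N"
    using s by blast
qed

lemma pow_cong: "x - y \<in> N \<Longrightarrow> x ^ q - y ^ q \<in> N"
  using mult_N_right[of "x - y"] by (simp add: power_diff_sumr2)

end

section \<open>Frobenius powers of finite free complexes\<close>

locale localized_quotient_char = localized_quotient N S for N S :: "'r::comm_ring_1 set" +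
  fixes p :: nat
  assumes prime: "Factorial_Ring.prime p" and char: "of_nat p \<in> N"
begin

lemma p_pos: "p > 0"
  using prime prime_gt_0_nat by blast

lemma freshman_add: "(x + y) ^ p - (x ^ p + y ^ p) \<in> N"
proof -
  let ?t = "\<lambda>k. of_nat (p choose k) * x ^ k * y ^ (p - k)"
  have split: "{..p} = insert 0 (insert p {0<..<p})" using p_pos by auto
  have "(x + y) ^ p = (\<Sum>k\<le>p. ?t k)" by (rule binomial_ring)
  also have "\<dots> = x ^ p + y ^ p + (\<Sum>k\<in>{0<..<p}. ?t k)"
    unfolding split using p_pos by simp
  finally have eq: "(x + y) ^ p - (x ^ p + y ^ p) = (\<Sum>k\<in>{0<..<p}. ?t k)" by simp
  show ?thesis unfolding eq
  proof (rule sum_N)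
    fix k assume "k \<in> {0<..<p}"
    then have "p dvd (p choose k)" using prime by (intro dvd_choose_prime) auto
    then obtain q where "p choose k = p * q" by (auto elim: dvdE)
    then have "?t k = of_nat p * (of_nat q * x ^ k * y ^ (p - k))" by (simp add: mult.assoc)
    then show "?t k \<in> N" using mult_N_right[OF char] by simp
  qed
qed

lemma freshman_sum: "(\<Sum>k\<in>K. f k) ^ p - (\<Sum>k\<in>K. f k ^ p) \<in> N"
proof (induction K rule: infinite_finite_induct)
  case (insert a K)
  have eq: "(\<Sum>k\<in>insert a K. f k) ^ p - (\<Sum>k\<in>insert a K. f k ^ p)
    = ((f a + (\<Sum>k\<in>K. f k)) ^ p - (f a ^ p + (\<Sum>k\<in>K. f k) ^ p))
      + ((\<Sum>k\<in>K. f k) ^ p - (\<Sum>k\<in>K. f k ^ p))"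
    using insert.hyps by simp
  show ?case unfolding eq by (rule add_N[OF freshman_add insert.IH])
qed (use p_pos zero_N in \<open>simp_all add: zero_power\<close>)

lemma freshman_diff: "(x - y) ^ p - (x ^ p - y ^ p) \<in> N"
  using uminus_N[OF freshman_add[of "x - y" y]] by (simp add: algebra_simps)

lemma pow_N: "x \<in> N \<Longrightarrow> x ^ p \<in> N"
  using pow_cong[of x 0 p] p_pos by (simp add: zero_power)

lemma frobenius_complex:
  assumes "complex_upto N n B \<phi>"
  shows "complex_upto N n B (\<lambda>m j k. \<phi> m j k ^ p)"
  unfolding complex_upto_def
proof (intro allI impI ballI)
  fix m j l assume "m < n" "j \<in> B m" "l \<in> B (Suc (Suc m))"
  then have "(\<Sum>k\<in>B (Suc m). \<phi> m j k * \<phi> (Suc m) k l) ^ p \<in> N"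
    using assms by (intro pow_N) (simp add: complex_upto_def)
  then show "(\<Sum>k\<in>B (Suc m). \<phi> m j k ^ p * \<phi> (Suc m) k l ^ p) \<in> N"
    using N_cong[OF freshman_sum[of "\<lambda>k. \<phi> m j k * \<phi> (Suc m) k l" "B (Suc m)"]]
    by (simp add: power_mult_distrib)
qed

lemma localized_quotient_char_invert:
  "localized_quotient_char (invert_null N x) (invert_units S x) p"
  using localized_quotient_invert[of x] prime char N_subset_invert
  by (auto simp: localized_quotient_char_def localized_quotient_char_axioms_def)

text \<open>Pivots commute with entrywise \<open>p\<close>-th powers modulo \<open>N\<close>, because \<open>p\<close>-th powers respect differences.\<close>

lemma frobenius_unpivot:
  assumes cx: "complex_upto N n B \<phi>" and fin: "\<And>i. finite (B i)"
    and rc: "r \<in> B i" "c \<in> B (Suc i)" and a: "\<phi> i r c \<in> S" and i: "i \<le> n"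
    and ac: "acyclic_upto N S n (pivot_index B i r c) (\<lambda>m j k. pivot_maps \<phi> i r c m j k ^ p)"
  shows "acyclic_upto N S n B (\<lambda>m j k. \<phi> m j k ^ p)"
proof -
  have "\<phi> i r c ^ q \<in> S" for q by (induction q) (auto intro: one_S mult_S a)
  then have "acyclic_upto N S n (pivot_index B i r c) (pivot_maps (\<lambda>m j k. \<phi> m j k ^ p) i r c)
      \<longleftrightarrow> acyclic_upto N S n B (\<lambda>m j k. \<phi> m j k ^ p)"
    using pivot_acyclic[OF frobenius_complex[OF cx] fin rc _ i] by simp
  moreover have "acyclic_upto N S n (pivot_index B i r c) (pivot_maps (\<lambda>m j k. \<phi> m j k ^ p) i r c)"
  proof (rule acyclic_cong[OF _ ac])
    fix m j k
    show "pivot_maps \<phi> i r c m j k ^ p - pivot_maps (\<lambda>m j k. \<phi> m j k ^ p) i r c m j k \<in> N"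
      using freshman_diff[of "\<phi> i r c * \<phi> i j k" "\<phi> i j c * \<phi> i r k"] zero_N
      by (simp add: pivot_maps_def pivot_def power_mult_distrib)
  qed
  ultimately show ?thesis by simp
qed

end

text \<open>The induction is on the length and the total rank of the complex. At every entry \<open>x\<close> of the last
map, invert \<open>x\<close> and pivot: the total rank drops, so the \<open>p\<close>-th power of the complex becomes acyclic
when \<open>x\<close> is inverted. Hence the homology of the \<open>p\<close>-th power is torsion with respect to these entries.
They have large grade, by \<open>koszul_exact_top_entries\<close> for the original complex, and
\<open>acyclic_of_torsion\<close> applies to its \<open>p\<close>-th power.\<close>

theorem frobenius_acyclic_free:
  assumes "localized_quotient_char N S p" "complex_upto N n B \<phi>" "\<And>i. finite (B i)"
    "B (Suc n) = {}" "acyclic_upto N S n B \<phi>"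
  shows "acyclic_upto N S n B (\<lambda>m j k. \<phi> m j k ^ p)"
  using assms
proof (induction "n + (\<Sum>m\<le>Suc n. card (B m))" arbitrary: N S n B \<phi> rule: less_induct)
  case less
  interpret localized_quotient_char N S p by fact
  note cx = less.prems(2) and fin = less.prems(3) and top = less.prems(4) and ac = less.prems(5)
  show ?case
  proof (cases n)
    case 0
    then show ?thesis by (simp add: acyclic_upto_def)
  next
    case (Suc n')
    show ?thesis
    proof (cases "B (Suc n') = {}")
      case True
      have "acyclic_upto N S n' B (\<lambda>m j k. \<phi> m j k ^ p)"
      proof (rule less.hyps)
        show "n' + (\<Sum>m\<le>Suc n'. card (B m)) < n + (\<Sum>m\<le>Suc n. card (B m))"
          by (simp add: Suc)
        show "complex_upto N n' B \<phi>" "acyclic_upto N S n' B \<phi>"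
          using cx ac by (auto simp: Suc complex_upto_def acyclic_upto_def)
      qed (use less.prems True in auto)
      then show ?thesis using True one_S by (auto simp: acyclic_upto_def Suc less_Suc_eq exact_at_def)
    next
      case False
      let ?E = "B n' \<times> B (Suc n')" and ?x = "\<lambda>(j, l). \<phi> n' j l"
      show ?thesis
      proof (rule acyclic_of_torsion[where E = ?E and x = ?x])
        show "complex_upto N n B (\<lambda>m j k. \<phi> m j k ^ p)" by (rule frobenius_complex[OF cx])
        show "koszul_exact N S ?E ?x j" if "j < n" for j
          using koszul_exact_top_entries[of n' B \<phi> j] cx ac fin top False that by (simp add: Suc)
        fix e i v
        assume e: "e \<in> ?E" and i: "i < n"
          and v: "\<forall>j\<in>B i. lin (B (Suc i)) (\<lambda>j k. \<phi> i j k ^ p) v j \<in> N"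
        obtain r c where rc: "e = (r, c)" "r \<in> B n'" "c \<in> B (Suc n')" using e by blast
        let ?a = "\<phi> n' r c"
        let ?N = "invert_null N ?a" and ?S = "invert_units S ?a"
        interpret inv: localized_quotient_char ?N ?S p by (rule localized_quotient_char_invert)
        have cx': "complex_upto ?N n B \<phi>"
          using cx subsetD[OF N_subset_invert] unfolding complex_upto_def by blast
        have a: "?a \<in> ?S" using pow_in_invert_units[of ?a 1] by simp
        have n': "n' \<le> n" by (simp add: Suc)
        have "acyclic_upto ?N ?S n (pivot_index B n' r c)
            (\<lambda>m j k. pivot_maps \<phi> n' r c m j k ^ p)"
        proof (rule less.hyps)
          show "n + (\<Sum>m\<le>Suc n. card (pivot_index B n' r c m)) < n + (\<Sum>m\<le>Suc n. card (B m))"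
            using card_pivot_index[of B r n' c n] fin rc n' by simp
          show "localized_quotient_char ?N ?S p" by (rule localized_quotient_char_invert)
          show "complex_upto ?N n (pivot_index B n' r c) (pivot_maps \<phi> n' r c)"
            by (rule inv.pivot_complex[OF cx' fin rc(2,3)])
          show "finite (pivot_index B n' r c i)" for i by (rule finite_pivot_index[OF fin])
          show "pivot_index B n' r c (Suc n) = {}" using top by (simp add: pivot_index_def Suc)
          show "acyclic_upto ?N ?S n (pivot_index B n' r c) (pivot_maps \<phi> n' r c)"
            using inv.pivot_acyclic[OF cx' fin rc(2,3) a n'] acyclic_invert[OF fin ac] by simp
        qed
        then have "acyclic_upto ?N ?S n B (\<lambda>m j k. \<phi> m j k ^ p)"
          by (rule inv.frobenius_unpivot[OF cx' fin rc(2,3) a n'])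
        from torsion_of_invert[OF fin this i v]
        show "\<exists>m. in_image (B (Suc i)) (B (Suc (Suc i))) (\<lambda>j k. \<phi> (Suc i) j k ^ p) (\<lambda>k. ?x e ^ m * v k)"
          by (simp add: rc(1))
      qed (use fin top in auto)
    qed
  qed
qed

section \<open>Complexes that end in a split map\<close>

context localized_quotient
begin

text \<open>The determinant trick: a vector with \<open>s * v = M v\<close> is killed by an element \<open>t\<close> that is congruent to
a power of \<open>s\<close> modulo the ideal of the entries of \<open>M\<close>. One coordinate is eliminated at a time. It
matters that \<open>t\<close> depends only on \<open>M\<close> and \<open>s\<close>.\<close>

lemma nakayama:
  assumes J0: "0 \<in> J" and J_add: "\<And>x y. x \<in> J \<Longrightarrow> y \<in> J \<Longrightarrow> x + y \<in> J"
    and J_mult: "\<And>r x. x \<in> J \<Longrightarrow> r * x \<in> J" and K: "finite K"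
  shows "(\<And>j k. j \<in> K \<Longrightarrow> k \<in> K \<Longrightarrow> M j k \<in> J) \<Longrightarrow>
    \<exists>t n. t - s ^ n \<in> J \<and> (\<forall>v. (\<forall>j\<in>K. s * v j - lin K M v j \<in> N) \<longrightarrow> (\<forall>j\<in>K. t * v j \<in> N))"
  using K
proof (induction K arbitrary: M s rule: finite_induct)
  case empty
  show ?case using J0 by (intro exI[of _ 1] exI[of _ 0]) simp
next
  case (insert r K)
  interpret J: localized_quotient J "{1}"
    by unfold_locales (use J0 J_add J_mult in auto)
  define t1 where "t1 = s - M r r"
  define M' where "M' j k = t1 * M j k + M j r * M r k" for j k
  have "M' j k \<in> J" if "j \<in> K" "k \<in> K" for j k
    using insert.prems that by (auto simp: M'_def intro!: J_add J_mult)
  then obtain t' n where t': "t' - (s * t1) ^ n \<in> J"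
    and null: "\<And>v j. \<forall>j\<in>K. s * t1 * v j - lin K M' v j \<in> N \<Longrightarrow> j \<in> K \<Longrightarrow> t' * v j \<in> N"
    using insert.IH[of M' "s * t1"] by blast
  have t1: "t1 - s \<in> J" using insert.prems[of r r] J.uminus_N by (simp add: t1_def)
  show ?case
  proof (intro exI conjI allI impI ballI)
    have "(s * t1) ^ n - (s * s) ^ n \<in> J"
      using J_mult[OF t1, of s] by (intro J.pow_cong) (simp add: algebra_simps)
    then have "t' - (s * s) ^ n \<in> J" using J_add[OF t'] by fastforce
    then have "t1 * (t' - (s * s) ^ n) + (s * s) ^ n * (t1 - s) \<in> J"
      using t1 by (intro J_add J_mult)
    then show "t' * t1 - s ^ (2 * n + 1) \<in> J"
      by (simp add: algebra_simps power_mult power2_eq_square)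
    fix v assume v: "\<forall>j\<in>insert r K. s * v j - lin (insert r K) M v j \<in> N"
    have lin: "lin (insert r K) M v j = M j r * v r + lin K M v j" for j
      using insert.hyps by (simp add: lin_def)
    have vr: "t1 * v r - lin K M v r \<in> N"
      using v[rule_format, of r] by (simp add: lin t1_def algebra_simps)
    have vK: "\<forall>j\<in>K. s * t1 * v j - lin K M' v j \<in> N"
    proof
      fix j assume "j \<in> K"
      then have "s * v j - M j r * v r - lin K M v j \<in> N"
        using v[rule_format, of j] by (simp add: lin algebra_simps)
      then have "t1 * (s * v j - M j r * v r - lin K M v j) + M j r * (t1 * v r - lin K M v r) \<in> N"
        using vr by (intro add_N mult_N)
      moreover have "lin K M' v j = t1 * lin K M v j + M j r * lin K M v r"
        by (simp add: lin_def M'_def distrib_right sum.distrib sum_distrib_left mult.assoc)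
      ultimately show "s * t1 * v j - lin K M' v j \<in> N"
        by (simp add: algebra_simps)
    qed
    have "lin K M (\<lambda>k. t' * v k) r \<in> N" by (rule lin_N) (use null[OF vK] in auto)
    then have "t' * lin K M v r \<in> N" by (simp add: lin_scale)
    from add_N[OF mult_N[OF vr, of t'] this] have r: "t' * t1 * v r \<in> N" by (simp add: algebra_simps)
    fix j assume "j \<in> insert r K"
    then show "t' * t1 * v j \<in> N"
    proof
      assume "j \<in> K"
      then have "t1 * (t' * v j) \<in> N" by (rule mult_N[OF null[OF vK]])
      then show ?thesis by (simp add: algebra_simps)
    qed (use r in simp)
  qed
qed

end

text \<open>Over the localization the matrix \<open>M\<close> satisfies \<open>M h M = M\<close> for a suitable \<open>h\<close>; equivalently, its
kernel and its image are direct summands.\<close>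

definition split_map :: "'r::comm_ring_1 set \<Rightarrow> 'r set \<Rightarrow> nat set \<Rightarrow> nat set \<Rightarrow> (nat \<Rightarrow> nat \<Rightarrow> 'r) \<Rightarrow> bool"
  where "split_map N S A C M \<longleftrightarrow>
    (\<exists>s\<in>S. \<exists>h. \<forall>j\<in>A. \<forall>l\<in>C. lin C M (lin A h (\<lambda>q. M q l)) j - s * M j l \<in> N)"

context localized_quotient
begin

text \<open>The pivot arises from \<open>M\<close> by operations on the rows and the same \<open>h\<close> serves for it, since its row
\<open>r\<close> and its column \<open>c\<close> vanish.\<close>

lemma split_map_pivot:
  assumes sp: "split_map N S A C M" and fin: "finite A" "finite C"
    and rc: "r \<in> A" "c \<in> C" and a: "M r c \<in> S"
  shows "split_map N S (A - {r}) (C - {c}) (pivot M r c)"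
proof -
  obtain s h where s: "s \<in> S" and h: "\<And>j l. j \<in> A \<Longrightarrow> l \<in> C \<Longrightarrow> lin C M (lin A h (\<lambda>q. M q l)) j - s * M j l \<in> N"
    using sp unfolding split_map_def by blast
  let ?a = "M r c"
  have "lin (C - {c}) (pivot M r c) (lin (A - {r}) h (\<lambda>q. pivot M r c q l)) j
      - (?a * s) * pivot M r c j l \<in> N" if j: "j \<in> A" and l: "l \<in> C" for j l
  proof -
    have "lin (A - {r}) h (\<lambda>q. pivot M r c q l) k = lin A h (\<lambda>q. pivot M r c q l) k" for k
      using fin rc by (simp add: lin_remove pivot_row)
    also have "lin A h (\<lambda>q. pivot M r c q l) k =
        ?a * lin A h (\<lambda>q. M q l) k - M r l * lin A h (\<lambda>q. M q c) k" for k
      unfolding lin_scale[symmetric] lin_diff[symmetric] by (simp add: pivot_def mult.commute)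
    finally have "lin (A - {r}) h (\<lambda>q. pivot M r c q l) =
        (\<lambda>k. ?a * lin A h (\<lambda>q. M q l) k - M r l * lin A h (\<lambda>q. M q c) k)" by (rule ext)
    then have "lin (C - {c}) (pivot M r c) (lin (A - {r}) h (\<lambda>q. pivot M r c q l)) j
      = ?a * (?a * lin C M (lin A h (\<lambda>q. M q l)) j - M r l * lin C M (lin A h (\<lambda>q. M q c)) j)
      - M j c * (?a * lin C M (lin A h (\<lambda>q. M q l)) r - M r l * lin C M (lin A h (\<lambda>q. M q c)) r)"
      by (simp only: lin_pivot[OF fin(2)] lin_scale lin_diff) (simp add: algebra_simps)
    then have "lin (C - {c}) (pivot M r c) (lin (A - {r}) h (\<lambda>q. pivot M r c q l)) j
      - (?a * s) * pivot M r c j l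
      = ?a * (?a * (lin C M (lin A h (\<lambda>q. M q l)) j - s * M j l)
          - M r l * (lin C M (lin A h (\<lambda>q. M q c)) j - s * M j c))
      - M j c * (?a * (lin C M (lin A h (\<lambda>q. M q l)) r - s * M r l)
          - M r l * (lin C M (lin A h (\<lambda>q. M q c)) r - s * M r c))"
      by (simp add: pivot_def algebra_simps)
    also have "\<dots> \<in> N" by (intro diff_N mult_N h j l rc)
    finally show ?thesis .
  qed
  then show ?thesis unfolding split_map_def
    using mult_S[OF a s] by (intro bexI[of _ "?a * s"] exI[of _ h]) auto
qed

lemma split_map_invert:
  "split_map N S A C M \<Longrightarrow> split_map (invert_null N x) (invert_units S x) A C M"
  using subsetD[OF N_subset_invert] subsetD[OF S_subset_invert]
  unfolding split_map_def by meson

end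

lemma radical_add:
  fixes a b :: "'r::comm_ring_1"
  assumes D0: "0 \<in> D" and add: "\<And>x y. x \<in> D \<Longrightarrow> y \<in> D \<Longrightarrow> x + y \<in> D"
    and mult: "\<And>r x. x \<in> D \<Longrightarrow> r * x \<in> D" and ab: "a ^ m \<in> D" "b ^ l \<in> D"
  shows "(a + b) ^ (m + l) \<in> D"
proof -
  interpret D: localized_quotient D "{1}" by unfold_locales (use D0 add mult in auto)
  have "of_nat (m + l choose k) * a ^ k * b ^ (m + l - k) \<in> D" for k
  proof (cases "m \<le> k")
    case True
    then show ?thesis
      using D.pow_N_mono[of a m 1 k] ab(1) by (auto intro: D.mult_N D.mult_N_right)
  next
    case False
    then show ?thesis
      using D.pow_N_mono[of b l 1 "m + l - k"] ab(2) by (auto intro: D.mult_N)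
  qed
  then show ?thesis unfolding binomial_ring by (intro D.sum_N)
qed

text \<open>The free resolution of a module of finite projective dimension need not stop, but far out its maps
are split, and a complex that ends in a split map is as good as a finite one. For a cycle \<open>v\<close> of the
\<open>p\<close>-th power, let \<open>J\<close> be the ideal of all \<open>y\<close> such that a power of \<open>y\<close> carries \<open>v\<close> into the image. It
contains the entries of the last map \<open>\<phi> n\<close>, by a pivot and induction on the total rank. It also
contains an element \<open>t\<close> with \<open>t * \<phi> n = 0\<close>: after inverting \<open>t\<close> the last map is zero and
\<open>frobenius_acyclic_free\<close> applies to the complex without its last module. Now \<open>\<phi> h \<phi> = s * \<phi>\<close> and
Nakayama's lemma provide such a \<open>t\<close> that is congruent to a power of \<open>s\<close> modulo \<open>J\<close>. So \<open>J\<close> contains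
a power of \<open>s\<close>, which is invertible.\<close>

theorem frobenius_acyclic_split:
  assumes "localized_quotient_char N S p" "complex_upto N n B \<phi>" "\<And>i. finite (B i)"
    "acyclic_upto N S n B \<phi>" "split_map N S (B n) (B (Suc n)) (\<phi> n)"
  shows "acyclic_upto N S n B (\<lambda>m j k. \<phi> m j k ^ p)"
  using assms
proof (induction "\<Sum>m\<le>Suc n. card (B m)" arbitrary: N S B \<phi> rule: less_induct)
  case less
  interpret localized_quotient_char N S p by fact
  note cx = less.prems(2) and fin = less.prems(3) and ac = less.prems(4) and sp = less.prems(5)
  let ?\<psi> = "\<lambda>m j k. \<phi> m j k ^ p" and ?E = "B n \<times> B (Suc n)"
  have cx': "complex_upto (invert_null N x) n B \<phi>" for x
    using cx subsetD[OF N_subset_invert] unfolding complex_upto_def by blast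
  have inv_entry: "acyclic_upto (invert_null N (\<phi> n r c)) (invert_units S (\<phi> n r c)) n B ?\<psi>"
    if rc: "r \<in> B n" "c \<in> B (Suc n)" for r c
  proof -
    let ?a = "\<phi> n r c"
    let ?N = "invert_null N ?a" and ?S = "invert_units S ?a"
    interpret inv: localized_quotient_char ?N ?S p by (rule localized_quotient_char_invert)
    have a: "?a \<in> ?S" using pow_in_invert_units[of ?a 1] by simp
    have "acyclic_upto ?N ?S n (pivot_index B n r c) (\<lambda>m j k. pivot_maps \<phi> n r c m j k ^ p)"
    proof (rule less.hyps)
      show "(\<Sum>m\<le>Suc n. card (pivot_index B n r c m)) < (\<Sum>m\<le>Suc n. card (B m))"
        using card_pivot_index[of B r n c n] fin rc by simp
      show "localized_quotient_char ?N ?S p" by (rule localized_quotient_char_invert)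
      show "complex_upto ?N n (pivot_index B n r c) (pivot_maps \<phi> n r c)"
        by (rule inv.pivot_complex[OF cx' fin rc])
      show "finite (pivot_index B n r c i)" for i by (rule finite_pivot_index[OF fin])
      show "acyclic_upto ?N ?S n (pivot_index B n r c) (pivot_maps \<phi> n r c)"
        using inv.pivot_acyclic[OF cx' fin rc a] acyclic_invert[OF fin ac] by simp
      show "split_map ?N ?S (pivot_index B n r c n) (pivot_index B n r c (Suc n)) (pivot_maps \<phi> n r c n)"
        using inv.split_map_pivot[OF split_map_invert[OF sp] fin fin rc a]
        by (simp add: pivot_index_def pivot_maps_def)
    qed
    then show ?thesis by (rule inv.frobenius_unpivot[OF cx' fin rc a order.refl])
  qed
  obtain s h where s: "s \<in> S" and h: "\<And>j l. j \<in> B n \<Longrightarrow> l \<in> B (Suc n) \<Longrightarrow>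
      bdry B \<phi> n (lin (B n) h (\<lambda>q. \<phi> n q l)) j - s * \<phi> n j l \<in> N"
    using sp unfolding split_map_def by blast
  define M where "M j q = (\<Sum>k\<in>B (Suc n). \<phi> n j k * h k q)" for j q
  have inv_t: "acyclic_upto (invert_null N t) (invert_units S t) n B ?\<psi>"
    if t_null: "\<And>j l. j \<in> B n \<Longrightarrow> l \<in> B (Suc n) \<Longrightarrow> t * \<phi> n j l \<in> N" for t
  proof -
    let ?N = "invert_null N t" and ?S = "invert_units S t" and ?B = "B(Suc n := {})"
    interpret inv: localized_quotient_char ?N ?S p by (rule localized_quotient_char_invert)
    have null: "\<phi> n j l \<in> ?N" if "j \<in> B n" "l \<in> B (Suc n)" for j l
      using t_null[OF that] unfolding invert_null_def by (intro CollectI exI[of _ 1]) simp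
    have "acyclic_upto ?N ?S n ?B ?\<psi>"
    proof (rule frobenius_acyclic_free)
      show "localized_quotient_char ?N ?S p" by (rule localized_quotient_char_invert)
      show "complex_upto ?N n ?B \<phi>" using cx'[of t] by (auto simp: complex_upto_def)
      show "finite (?B i)" for i using fin by simp
      show "acyclic_upto ?N ?S n ?B \<phi>"
        unfolding acyclic_upto_def
      proof (intro allI impI)
        fix m assume m: "m < n"
        have ex: "exact_at ?N ?S (B m) (B (Suc m)) (B (Suc (Suc m))) (\<phi> m) (\<phi> (Suc m))"
          using acyclic_invert[OF fin ac] m by (simp add: acyclic_upto_def)
        show "exact_at ?N ?S (?B m) (?B (Suc m)) (?B (Suc (Suc m))) (\<phi> m) (\<phi> (Suc m))"
        proof (cases "Suc m = n")
          case False
          then show ?thesis using ex m by simp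
        next
          case True
          have "s * v k \<in> ?N" if "s * v k - bdry B \<phi> n w k \<in> ?N" "k \<in> B n" for s v w k
          proof -
            have "bdry B \<phi> n w k \<in> ?N"
              unfolding lin_def using null that(2) by (auto intro!: inv.sum_N inv.mult_N_right)
            then show ?thesis using inv.add_N[OF that(1)] by fastforce
          qed
          then show ?thesis using ex m True unfolding exact_at_def
            by (simp add: lin_def) blast
        qed
      qed
    qed simp
    then have "exact_at ?N ?S (B m) (B (Suc m)) (B (Suc (Suc m))) (?\<psi> m) (?\<psi> (Suc m))" if m: "m < n" for m
    proof (cases "Suc m = n")
      case False
      then show ?thesis using \<open>acyclic_upto ?N ?S n ?B ?\<psi>\<close> m by (auto simp: acyclic_upto_def)
    next
      case True
      have "exact_at ?N ?S (B m) (B n) {} (?\<psi> m) (?\<psi> n)"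
        using \<open>acyclic_upto ?N ?S n ?B ?\<psi>\<close> m True by (auto simp: acyclic_upto_def)
      then show ?thesis unfolding exact_at_def True
        by (metis (mono_tags, lifting) lin_zero lin_def sum.empty)
    qed
    then show ?thesis by (simp add: acyclic_upto_def)
  qed
  show ?case unfolding acyclic_upto_def exact_at_iff
  proof (intro allI impI)
    fix i v assume i: "i < n" and v: "\<forall>j\<in>B i. bdry B ?\<psi> i v j \<in> N"
    let ?im = "in_image (B (Suc i)) (B (Suc (Suc i))) (?\<psi> (Suc i))"
    define D where "D = {y. ?im (\<lambda>k. y * v k)}"
    have D0: "0 \<in> D" unfolding D_def in_image_def
      using one_S zero_N by (auto intro!: bexI[of _ 1] exI[of _ "\<lambda>_. 0"] simp: lin_zero)
    have D_mult: "q * y \<in> D" if "y \<in> D" for q y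
      using in_image_scale[of _ _ _ "\<lambda>k. y * v k" q] that by (simp add: D_def mult.assoc)
    have D_add: "y + z \<in> D" if "y \<in> D" "z \<in> D" for y z
      using in_image_add[of _ _ _ "\<lambda>k. y * v k" "\<lambda>k. z * v k"] that by (simp add: D_def distrib_right)
    define J where "J = {y. \<exists>m. y ^ m \<in> D}"
    have J0: "0 \<in> J" unfolding J_def using D0 by (auto intro!: exI[of _ 1])
    have J_add: "y + z \<in> J" if yz: "y \<in> J" "z \<in> J" for y z
    proof -
      obtain m l where m: "y ^ m \<in> D" "z ^ l \<in> D" using yz unfolding J_def by blast
      have "(y + z) ^ (m + l) \<in> D" by (rule radical_add[OF D0 D_add D_mult m])
      then show ?thesis unfolding J_def by blast
    qed
    have J_mult: "q * y \<in> J" if y: "y \<in> J" for q y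
    proof -
      obtain m where "y ^ m \<in> D" using y unfolding J_def by blast
      then have "(q * y) ^ m \<in> D" unfolding power_mult_distrib by (rule D_mult)
      then show ?thesis unfolding J_def by blast
    qed
    interpret J: localized_quotient J "{1}"
      by unfold_locales (use J0 J_add J_mult in auto)
    have tors: "y \<in> J" if "acyclic_upto (invert_null N y) (invert_units S y) n B ?\<psi>" for y
      using torsion_of_invert[OF fin that i v] unfolding J_def D_def by blast
    have entry: "\<phi> n r c \<in> J" if "r \<in> B n" "c \<in> B (Suc n)" for r c
      by (rule tors[OF inv_entry[OF that]])
    have "\<exists>t k. t - s ^ k \<in> J \<and> (\<forall>v. (\<forall>j\<in>B n. s * v j - lin (B n) M v j \<in> N) \<longrightarrow> (\<forall>j\<in>B n. t * v j \<in> N))"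
      by (rule nakayama[OF J0 J_add J_mult fin])
        (use entry in \<open>auto simp: M_def intro!: J.sum_N J.mult_N_right\<close>)
    then obtain t k where t: "t - s ^ k \<in> J"
      and tN: "\<And>v j. \<forall>j\<in>B n. s * v j - lin (B n) M v j \<in> N \<Longrightarrow> j \<in> B n \<Longrightarrow> t * v j \<in> N"
      by blast
    have t_null: "t * \<phi> n j l \<in> N" if j: "j \<in> B n" and l: "l \<in> B (Suc n)" for j l
    proof (rule tN[of "\<lambda>j. \<phi> n j l"])
      show "\<forall>j\<in>B n. s * \<phi> n j l - lin (B n) M (\<lambda>j. \<phi> n j l) j \<in> N"
      proof
        fix i assume "i \<in> B n"
        have "lin (B n) M (\<lambda>j. \<phi> n j l) i = bdry B \<phi> n (lin (B n) h (\<lambda>q. \<phi> n q l)) i"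
          unfolding lin_lin by (simp add: M_def lin_def)
        then show "s * \<phi> n i l - lin (B n) M (\<lambda>j. \<phi> n j l) i \<in> N"
          using uminus_N[OF h[OF \<open>i \<in> B n\<close> l]] by simp
      qed
    qed fact
    have "t - (t - s ^ k) \<in> J" by (rule J.diff_N[OF tors[OF inv_t[OF t_null]] t])
    then obtain m where m: "(s ^ k) ^ m \<in> D" by (auto simp: J_def)
    have "s ^ q \<in> S" for q by (induction q) (auto intro: one_S mult_S s)
    then have "(s ^ k) ^ m \<in> S" by (simp add: power_mult[symmetric])
    then show "?im v" by (rule in_image_saturated) (use m in \<open>simp add: D_def\<close>)
  qed
qed

section \<open>Maps that are split by a homotopy\<close>

locale ideal_quotient = localized_quotient N "{1}" for N :: "'r::comm_ring_1 set"
begin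

text \<open>A map from a free module to a kernel lifts through a surjection onto it; the lift \<open>h\<close> is found
column by column.\<close>

lemma lift_matrix:
  assumes ex: "exact_at N {1} A Y Z f g"
    and T: "\<And>j q. j \<in> A \<Longrightarrow> q \<in> Q \<Longrightarrow> lin Y f (\<lambda>k. T k q) j \<in> N"
  shows "\<exists>h. \<forall>k\<in>Y. \<forall>x. lin Q T x k - lin Z g (lin Q h x) k \<in> N"
proof -
  have "\<forall>q\<in>Q. \<exists>w. \<forall>k\<in>Y. T k q - lin Z g w k \<in> N"
  proof
    fix q assume "q \<in> Q"
    then show "\<exists>w. \<forall>k\<in>Y. T k q - lin Z g w k \<in> N"
      using ex[unfolded exact_at_def, rule_format, of "\<lambda>k. T k q"] T by auto
  qed
  then have "\<exists>h. \<forall>q\<in>Q. \<forall>k\<in>Y. T k q - lin Z g (h q) k \<in> N" by (rule bchoice)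
  then obtain h where h: "\<And>q k. q \<in> Q \<Longrightarrow> k \<in> Y \<Longrightarrow> T k q - lin Z g (h q) k \<in> N" by blast
  have "lin Q T x k - lin Z g (lin Q (\<lambda>l q. h q l) x) k \<in> N" if "k \<in> Y" for k x
  proof -
    have "lin Q T x k - lin Z g (lin Q (\<lambda>l q. h q l) x) k = (\<Sum>q\<in>Q. (T k q - lin Z g (h q) k) * x q)"
      unfolding lin_lin by (simp add: lin_def left_diff_distrib sum_subtractf)
    also have "\<dots> \<in> N" using h that by (intro sum_N mult_N_right) auto
    finally show ?thesis .
  qed
  then show ?thesis by blast
qed

lemma lin_unit: "finite C \<Longrightarrow> l \<in> C \<Longrightarrow> lin C M (\<lambda>k. if k = l then 1 else 0) j = M j l"
  by (simp add: lin_def if_distrib cong: if_cong)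

text \<open>The matrices \<open>\<theta>\<close> form an endomorphism of the resolution over the identity, so there is a homotopy
\<open>h\<close> with \<open>id - \<theta> = \<phi> h + h \<phi>\<close>. Multiplied by \<open>\<phi>\<close> from the right this becomes \<open>\<phi> - \<theta> \<phi> = \<phi> h \<phi>\<close>, which
involves only one of the maps \<open>h\<close> and is the statement proved by induction. Where \<open>\<theta>\<close> vanishes, it
says that \<open>\<phi>\<close> is split.\<close>

lemma split_of_homotopy:
  assumes cx: "\<And>n. complex_upto N n B \<phi>" and ac: "\<And>n. acyclic_upto N {1} n B \<phi>"
    and fin: "\<And>i. finite (B i)"
    and \<theta>0: "\<And>j l. j \<in> B 0 \<Longrightarrow> l \<in> B 1 \<Longrightarrow> lin (B 1) (\<phi> 0) (\<lambda>k. \<theta> 0 k l) j - \<phi> 0 j l \<in> N"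
    and \<theta>: "\<And>i j l. j \<in> B (Suc i) \<Longrightarrow> l \<in> B (Suc (Suc i)) \<Longrightarrow>
      bdry B \<phi> (Suc i) (\<lambda>k. \<theta> (Suc i) k l) j
        - lin (B (Suc i)) (\<theta> i) (\<lambda>k. \<phi> (Suc i) k l) j \<in> N"
    and \<theta>n: "\<And>j l. j \<in> B (Suc n) \<Longrightarrow> l \<in> B (Suc n) \<Longrightarrow> \<theta> n j l \<in> N"
  shows "split_map N {1} (B (Suc n)) (B (Suc (Suc n))) (\<phi> (Suc n))"
proof -
  have \<phi>\<phi>: "bdry B \<phi> m (bdry B \<phi> (Suc m) u) j \<in> N" if "j \<in> B m" for m u j
    using cx[of "Suc m"] that by (auto intro!: lin_lin_N simp: complex_upto_def)
  have ex: "exact_at N {1} (B m) (B (Suc m)) (B (Suc (Suc m))) (\<phi> m) (\<phi> (Suc m))" for m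
    using ac[of "Suc m"] by (simp add: acyclic_upto_def)
  have "\<exists>h. \<forall>j\<in>B (Suc i). \<forall>u. bdry B \<phi> (Suc i) (lin (B (Suc i)) h
          (bdry B \<phi> (Suc i) u)) j
      - bdry B \<phi> (Suc i) u j
      + lin (B (Suc i)) (\<theta> i) (bdry B \<phi> (Suc i) u) j \<in> N" for i
  proof (induction i)
    case 0
    define T where "T k q = (if k = q then 1 else 0) - \<theta> 0 k q" for k q
    have linT: "lin (B 1) T x k = x k - lin (B 1) (\<theta> 0) x k" if "k \<in> B 1" for x k
      using that fin unfolding lin_def T_def
      by (simp add: left_diff_distrib sum_subtractf if_distrib[of "\<lambda>x. x * _"] cong: if_cong)
    have "lin (B 1) (\<phi> 0) (\<lambda>k. T k q) j \<in> N" if "j \<in> B 0" "q \<in> B 1" for j q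
      using uminus_N[OF \<theta>0[OF that]] that fin unfolding T_def lin_diff by (simp add: lin_unit)
    then obtain h where h: "\<forall>k\<in>B 1. \<forall>x. lin (B 1) T x k - lin (B 2) (\<phi> 1) (lin (B 1) h x) k \<in> N"
      using lift_matrix[OF ex[of 0], of "B 1" T] by (auto simp: numeral_2_eq_2)
    show ?case
    proof (intro exI[of _ h] ballI allI)
      fix j u assume j: "j \<in> B (Suc 0)"
      show "bdry B \<phi> (Suc 0) (lin (B (Suc 0)) h
          (bdry B \<phi> (Suc 0) u)) j
      - bdry B \<phi> (Suc 0) u j
      + lin (B (Suc 0)) (\<theta> 0) (bdry B \<phi> (Suc 0) u) j \<in> N"
        using uminus_N[OF h[rule_format, of j "bdry B \<phi> (Suc 0) u"]] j
        by (simp add: linT[simplified] numeral_2_eq_2 algebra_simps)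
    qed
  next
    case (Suc i)
    let ?B1 = "B (Suc i)" and ?B2 = "B (Suc (Suc i))" and ?B3 = "B (Suc (Suc (Suc i)))"
    let ?f1 = "\<phi> (Suc i)" and ?f2 = "\<phi> (Suc (Suc i))"
    obtain h where h: "\<And>j u. j \<in> ?B1 \<Longrightarrow> lin ?B2 ?f1 (lin ?B1 h (lin ?B2 ?f1 u)) j
      - lin ?B2 ?f1 u j + lin ?B1 (\<theta> i) (lin ?B2 ?f1 u) j \<in> N" using Suc by blast
    \<comment> \<open>\<open>T = id - \<theta> - h \<phi>\<close> maps into the kernel of the next matrix\<close>
    define T where "T k q = (if k = q then 1 else 0) - \<theta> (Suc i) k q - lin ?B1 h (\<lambda>l. ?f1 l q) k" for k q
    have linT: "lin ?B2 T x k = x k - lin ?B2 (\<theta> (Suc i)) x k - lin ?B1 h (lin ?B2 ?f1 x) k"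
      if "k \<in> ?B2" for x k
      using that fin unfolding lin_lin unfolding lin_def T_def
      by (simp add: left_diff_distrib sum_subtractf if_distrib[of "\<lambda>x. x * _"] cong: if_cong)
    have "lin ?B2 ?f1 (\<lambda>k. T k q) j \<in> N" if j: "j \<in> ?B1" and q: "q \<in> ?B2" for j q
    proof -
      let ?e = "\<lambda>k. if k = q then 1 else 0 :: 'r"
      have e: "lin ?B2 ?f1 ?e = (\<lambda>l. ?f1 l q)" using q fin by (auto simp: lin_unit)
      have "lin ?B2 ?f1 (\<lambda>k. T k q) j = - (lin ?B2 ?f1 (\<lambda>k. \<theta> (Suc i) k q) j - lin ?B1 (\<theta> i) (\<lambda>k. ?f1 k q) j)
        - (lin ?B2 ?f1 (lin ?B1 h (lin ?B2 ?f1 ?e)) j - lin ?B2 ?f1 ?e j + lin ?B1 (\<theta> i) (lin ?B2 ?f1 ?e) j)"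
        unfolding T_def lin_diff e using q fin by (simp add: lin_unit)
      also have "\<dots> \<in> N" by (intro diff_N uminus_N h \<theta> j q)
      finally show ?thesis .
    qed
    then obtain h' where h': "\<And>k x. k \<in> ?B2 \<Longrightarrow> lin ?B2 T x k - lin ?B3 ?f2 (lin ?B2 h' x) k \<in> N"
      using lift_matrix[OF ex[of "Suc i"], of ?B2 T] by blast
    show ?case
    proof (intro exI[of _ h'] ballI allI)
      fix j u assume j: "j \<in> ?B2"
      have "lin ?B1 h (lin ?B2 ?f1 (lin ?B3 ?f2 u)) j \<in> N"
        by (rule lin_N) (rule \<phi>\<phi>)
      from diff_N[OF uminus_N[OF h'[OF j, of "lin ?B3 ?f2 u"]] this]
      show "lin ?B3 ?f2 (lin ?B2 h' (lin ?B3 ?f2 u)) j - lin ?B3 ?f2 u j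
          + lin ?B2 (\<theta> (Suc i)) (lin ?B3 ?f2 u) j \<in> N"
        using j by (simp add: linT algebra_simps)
    qed
  qed
  then obtain h where h: "\<And>j u. j \<in> B (Suc n) \<Longrightarrow> bdry B \<phi> (Suc n) (lin (B (Suc n)) h
          (bdry B \<phi> (Suc n) u)) j
      - bdry B \<phi> (Suc n) u j
      + lin (B (Suc n)) (\<theta> n) (bdry B \<phi> (Suc n) u) j \<in> N" by blast
  have "bdry B \<phi> (Suc n) (lin (B (Suc n)) h (\<lambda>q. \<phi> (Suc n) q l)) j
      - 1 * \<phi> (Suc n) j l \<in> N" if j: "j \<in> B (Suc n)" and l: "l \<in> B (Suc (Suc n))" for j l
  proof -
    let ?e = "\<lambda>k. if k = l then 1 else 0 :: 'r"
    have e: "bdry B \<phi> (Suc n) ?e = (\<lambda>q. \<phi> (Suc n) q l)"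
      using l fin by (auto simp: lin_unit)
    have "lin (B (Suc n)) (\<theta> n) (\<lambda>q. \<phi> (Suc n) q l) j \<in> N"
      unfolding lin_def using \<theta>n j by (intro sum_N mult_N_right)
    from diff_N[OF h[OF j, of ?e, unfolded e] this] show ?thesis by simp
  qed
  then show ?thesis unfolding split_map_def by blast
qed

end

section \<open>Relations between the columns of a matrix\<close>

lemma lin_lin_columns: "lin B f (lin Y g w) j = (\<Sum>l\<in>Y. lin B f (\<lambda>k. g k l) j * w l)"
  unfolding lin_lin by (simp add: lin_def)

context ideal_quotient
begin

text \<open>The columns of \<open>K\<close> generate the module of relations between the columns of \<open>M\<close>, over the ring
\<open>R/N\<close>.\<close>

definition syz :: "'i set \<Rightarrow> nat set \<Rightarrow> nat set \<Rightarrow> ('i \<Rightarrow> nat \<Rightarrow> 'r) \<Rightarrow> (nat \<Rightarrow> nat \<Rightarrow> 'r) \<Rightarrow> bool"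
  where "syz Y C D M K \<longleftrightarrow> (\<forall>i\<in>Y. \<forall>l\<in>D. lin C M (\<lambda>k. K k l) i \<in> N) \<and>
    (\<forall>z. (\<forall>i\<in>Y. lin C M z i \<in> N) \<longrightarrow> (\<exists>w. \<forall>k\<in>C. z k - lin D K w k \<in> N))"

definition freshman :: "nat \<Rightarrow> bool"
  where "freshman q \<longleftrightarrow> (\<forall>(I :: nat set) f. (\<Sum>i\<in>I. f i) ^ q - (\<Sum>i\<in>I. f i ^ q) \<in> N)"

lemma freshman_lin:
  fixes C :: "nat set"
  assumes "freshman q"
  shows "lin C M v i ^ q - lin C (\<lambda>j k. M j k ^ q) (\<lambda>k. v k ^ q) i \<in> N"
  using assms[unfolded freshman_def, rule_format, of "\<lambda>k. M i k * v k" C]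
  by (simp add: lin_def power_mult_distrib)

lemma lin_cong_N:
  assumes "\<And>k. k \<in> C \<Longrightarrow> v k - w k \<in> N"
  shows "lin C M v i - lin C M w i \<in> N"
proof -
  have "lin C M (\<lambda>k. v k - w k) i \<in> N" by (rule lin_N) (use assms in auto)
  then show ?thesis by (simp add: lin_diff)
qed

text \<open>The rows are treated one after the other: if the columns of \<open>K\<close> generate the solutions for some
rows and \<open>L\<close> those for the next row times \<open>K\<close>, then \<open>K L\<close> generates the common solutions. A set \<open>Q\<close>
of exponents is carried along, so that one matrix serves for the \<open>q\<close>-th powers with all \<open>q \<in> Q\<close>.\<close>

lemma syz_rows:
  assumes one: "\<And>C a. finite C \<Longrightarrow> \<exists>D K. finite D \<and>
      (\<forall>q\<in>Q. syz {0::nat} C D (\<lambda>_ k. a k ^ q) (\<lambda>k l. K k l ^ q))"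
    and Q: "\<And>q. q \<in> Q \<Longrightarrow> freshman q" and Y: "finite Y" and C: "finite C"
  shows "\<exists>D K. finite D \<and> (\<forall>q\<in>Q. syz Y C D (\<lambda>i k. M i k ^ q) (\<lambda>k l. K k l ^ q))"
  using Y
proof (induction Y rule: finite_induct)
  case empty
  let ?K = "\<lambda>k l. if k = l then 1 else 0 :: 'r"
  show ?case
  proof (intro exI conjI ballI)
    show "finite C" by fact
    fix q assume "q \<in> Q"
    show "syz {} C C (\<lambda>i k. M i k ^ q) (\<lambda>k l. ?K k l ^ q)"
    proof (cases "q = 0")
      case True
      have "1 \<in> N"
        using Q[OF \<open>q \<in> Q\<close>, unfolded freshman_def True, rule_format, of "\<lambda>_. 0" "{}"] by simp
      then have "x \<in> N" for x using mult_N[of 1 x] by simp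
      then show ?thesis by (simp add: syz_def)
    next
      case False
      then have "z k - lin C (\<lambda>k l. ?K k l ^ q) z k \<in> N" if "k \<in> C" for z k
        using C that zero_N by (simp add: lin_def if_distrib[of "\<lambda>x. x ^ q"] zero_power if_distrib[of "\<lambda>x. x * _"] cong: if_cong)
      then show ?thesis unfolding syz_def by blast
    qed
  qed
next
  case (insert y Y)
  obtain D K where D: "finite D" and K: "\<And>q. q \<in> Q \<Longrightarrow> syz Y C D (\<lambda>i k. M i k ^ q) (\<lambda>k l. K k l ^ q)"
    using insert.IH by blast
  obtain E L where E: "finite E" and L: "\<And>q. q \<in> Q \<Longrightarrow>
      syz {0::nat} D E (\<lambda>_ k. lin C M (\<lambda>j. K j k) y ^ q) (\<lambda>k l. L k l ^ q)"
    using one[OF D, of "\<lambda>k. lin C M (\<lambda>j. K j k) y"] by blast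
  define K' where "K' k l = lin D K (\<lambda>d. L d l) k" for k l
  have "syz (insert y Y) C E (\<lambda>i k. M i k ^ q) (\<lambda>k l. K' k l ^ q)" if q: "q \<in> Q" for q
  proof -
    let ?M = "\<lambda>i k. M i k ^ q" and ?K = "\<lambda>i k. K i k ^ q" and ?L = "\<lambda>i k. L i k ^ q"
    let ?row = "\<lambda>(_::nat) k. lin C M (\<lambda>j. K j k) y ^ q"
    have K'q: "K' k l ^ q - lin D ?K (\<lambda>d. ?L d l) k \<in> N" for k l
      unfolding K'_def by (rule freshman_lin[OF Q[OF q]])
    have row: "lin C ?M (lin D ?K v) y - lin D ?row v 0 \<in> N" for v
    proof -
      have "lin D ?row v 0 - lin C ?M (lin D ?K v) y
          = (\<Sum>l\<in>D. (lin C M (\<lambda>j. K j l) y ^ q - lin C ?M (\<lambda>j. ?K j l) y) * v l)"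
        unfolding lin_lin by (simp add: lin_def left_diff_distrib sum_subtractf)
      also have "\<dots> \<in> N" by (intro sum_N mult_N_right freshman_lin Q q)
      finally show ?thesis using uminus_N by fastforce
    qed
    have prod: "lin E (\<lambda>k l. K' k l ^ q) w k - lin D ?K (lin E ?L w) k \<in> N" for w k
    proof -
      have "lin E (\<lambda>k l. K' k l ^ q) w k - lin D ?K (lin E ?L w) k
          = (\<Sum>l\<in>E. (K' k l ^ q - lin D ?K (\<lambda>d. ?L d l) k) * w l)"
        unfolding lin_lin by (simp add: lin_def left_diff_distrib sum_subtractf)
      also have "\<dots> \<in> N" by (intro sum_N mult_N_right K'q)
      finally show ?thesis .
    qed
    show ?thesis unfolding syz_def
    proof (intro conjI ballI allI impI)
      fix i l assume i: "i \<in> insert y Y" and l: "l \<in> E"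
      have "lin C ?M (\<lambda>k. K' k l ^ q) i - lin C ?M (lin D ?K (\<lambda>d. ?L d l)) i \<in> N"
        by (rule lin_cong_N) (rule K'q)
      moreover have "lin C ?M (lin D ?K (\<lambda>d. ?L d l)) i \<in> N"
      proof (cases "i = y")
        case True
        have "lin D ?row (\<lambda>d. ?L d l) 0 \<in> N" using L[OF q] l by (simp add: syz_def)
        then show ?thesis unfolding True using N_cong[OF row[of "\<lambda>d. ?L d l"]] by simp
      next
        case False
        then have "i \<in> Y" using i by simp
        then show ?thesis using K[OF q] by (intro lin_lin_N) (simp add: syz_def lin_def)
      qed
      ultimately show "lin C ?M (\<lambda>k. K' k l ^ q) i \<in> N" using N_cong by blast
    next
      fix z assume z: "\<forall>i\<in>insert y Y. lin C ?M z i \<in> N"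
      then obtain w where w: "\<forall>k\<in>C. z k - lin D ?K w k \<in> N"
        using K[OF q] unfolding syz_def by blast
      have "lin C ?M z y - lin C ?M (lin D ?K w) y \<in> N" by (rule lin_cong_N) (use w in blast)
      then have "lin C ?M (lin D ?K w) y \<in> N" using z N_cong by blast
      then have "lin D ?row w 0 \<in> N" using N_cong[OF row[of w]] by simp
      then obtain u where u: "\<forall>k\<in>D. w k - lin E ?L u k \<in> N"
        using L[OF q] unfolding syz_def by blast
      have "z k - lin E (\<lambda>k l. K' k l ^ q) u k \<in> N" if k: "k \<in> C" for k
      proof -
        have "lin D ?K w k - lin D ?K (lin E ?L u) k \<in> N" by (rule lin_cong_N) (use u in blast)
        from diff_N[OF add_N[OF w[rule_format, OF k] this] prod[of u k]] show ?thesis by simp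
      qed
      then show "\<exists>w. \<forall>k\<in>C. z k - lin E (\<lambda>k l. K' k l ^ q) w k \<in> N" by blast
    qed
  qed
  then show ?case using E by blast
qed

lemma freshman_1: "freshman 1"
  by (simp add: freshman_def zero_N)

end

section \<open>Presentations of a ring\<close>

text \<open>A surjection from a ring that is a type. Matrices over \<open>A\<close> are replaced by matrices over this type,
which need no carrier conditions, and equations in \<open>A\<close> by congruences modulo the kernel.\<close>

locale ring_presentation = A?: cring A
  for A :: "('a, 'k) ring_scheme" (structure) +
  fixes \<pi> :: "'r::comm_ring_1 \<Rightarrow> 'a"
  assumes \<pi>_closed [simp, intro]: "\<pi> x \<in> carrier A"
    and \<pi>_add: "\<pi> (x + y) = \<pi> x \<oplus> \<pi> y"
    and \<pi>_mult: "\<pi> (x * y) = \<pi> x \<otimes> \<pi> y"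
    and \<pi>_one: "\<pi> 1 = \<one>"
    and \<pi>_surj: "a \<in> carrier A \<Longrightarrow> \<exists>x. \<pi> x = a"
begin

lemma \<pi>_zero [simp]: "\<pi> 0 = \<zero>"
proof -
  have "\<pi> 0 \<oplus> \<pi> 0 = \<pi> 0" using \<pi>_add[of 0 0] by simp
  then show ?thesis using A.add.r_cancel_one'[of "\<pi> 0" "\<pi> 0"] by simp
qed

lemma \<pi>_uminus: "\<pi> (- x) = \<ominus> \<pi> x"
  using \<pi>_add[of "- x" x] by (simp add: A.minus_equality)

lemma \<pi>_diff: "\<pi> (x - y) = \<pi> x \<ominus> \<pi> y"
  using \<pi>_add[of x "- y"] by (simp add: \<pi>_uminus A.minus_eq)

lemma \<pi>_power: "\<pi> (x ^ n) = \<pi> x [^] n"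
  by (induction n) (simp_all add: \<pi>_one \<pi>_mult A.m_comm)

definition null :: "'r set" where "null = {x. \<pi> x = \<zero>}"

text \<open>Zero is lifted to zero, so that lifting a function of finite support does not enlarge its
support.\<close>

definition lift :: "'a \<Rightarrow> 'r" where "lift a = (if a = \<zero> then 0 else SOME x. \<pi> x = a)"

lemma \<pi>_lift [simp]: "a \<in> carrier A \<Longrightarrow> \<pi> (lift a) = a"
  unfolding lift_def using someI_ex[OF \<pi>_surj] by auto

lemma lift_zero [simp]: "lift \<zero> = 0"
  by (simp add: lift_def)

lemma diff_in_null_iff: "x - y \<in> null \<longleftrightarrow> \<pi> x = \<pi> y"
  by (simp add: null_def \<pi>_diff)

sublocale Q: ideal_quotient null
  by unfold_locales (auto simp: null_def \<pi>_add \<pi>_mult)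

definition lc :: "('a, 'b, 'm) module_scheme \<Rightarrow> ('i \<Rightarrow> 'b) \<Rightarrow> 'i set \<Rightarrow> ('i \<Rightarrow> 'r) \<Rightarrow> 'b"
  where "lc M f D v = finsum M (\<lambda>j. \<pi> (v j) \<odot>\<^bsub>M\<^esub> f j) D"

context
  fixes M :: "('a, 'b, 'm) module_scheme" (structure)
  assumes M: "module A M"
begin

interpretation M: module A M by (rule M)

lemma lc_empty [simp]: "lc M f {} v = \<zero>\<^bsub>M\<^esub>"
  by (simp add: lc_def)

lemma lc_insert:
  "finite D \<Longrightarrow> i \<notin> D \<Longrightarrow> f ` insert i D \<subseteq> carrier M \<Longrightarrow>
    lc M f (insert i D) v = \<pi> (v i) \<odot>\<^bsub>M\<^esub> f i \<oplus>\<^bsub>M\<^esub> lc M f D v"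
  unfolding lc_def by (subst M.finsum_insert) auto

lemma lc_closed: "f ` D \<subseteq> carrier M \<Longrightarrow> lc M f D v \<in> carrier M"
  unfolding lc_def by (rule M.finsum_closed) auto

lemma lc_cong: "f ` D \<subseteq> carrier M \<Longrightarrow> (\<And>j. j \<in> D \<Longrightarrow> v j - w j \<in> null) \<Longrightarrow> lc M f D v = lc M f D w"
  unfolding lc_def by (rule M.finsum_cong') (auto simp: diff_in_null_iff)

lemma lc_add:
  assumes "f ` D \<subseteq> carrier M"
  shows "lc M f D (\<lambda>j. v j + w j) = lc M f D v \<oplus>\<^bsub>M\<^esub> lc M f D w"
proof -
  have "lc M f D (\<lambda>j. v j + w j) = finsum M (\<lambda>j. \<pi> (v j) \<odot>\<^bsub>M\<^esub> f j \<oplus>\<^bsub>M\<^esub> \<pi> (w j) \<odot>\<^bsub>M\<^esub> f j) D"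
    unfolding lc_def by (rule M.finsum_cong') (use assms in \<open>auto simp: \<pi>_add M.smult_l_distr\<close>)
  also have "\<dots> = lc M f D v \<oplus>\<^bsub>M\<^esub> lc M f D w"
    unfolding lc_def by (rule M.finsum_addf) (use assms in auto)
  finally show ?thesis .
qed

lemma lc_scale:
  assumes "f ` D \<subseteq> carrier M" "finite D"
  shows "lc M f D (\<lambda>j. r * v j) = \<pi> r \<odot>\<^bsub>M\<^esub> lc M f D v"
  using assms(2,1)
proof (induction D rule: finite_induct)
  case (insert i D)
  then show ?case
    by (simp add: lc_insert lc_closed \<pi>_mult M.smult_assoc1 M.smult_r_distr)
qed simp

lemma lc_null: "f ` D \<subseteq> carrier M \<Longrightarrow> (\<And>j. j \<in> D \<Longrightarrow> v j \<in> null) \<Longrightarrow> lc M f D v = \<zero>\<^bsub>M\<^esub>"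
  unfolding lc_def by (rule M.add.finprod_one_eqI) (auto simp: null_def)

lemma lc_lin:
  assumes "f ` D \<subseteq> carrier M" "finite D" "finite E"
  shows "lc M (\<lambda>k. lc M f D (\<lambda>j. K j k)) E w = lc M f D (lin E K w)"
  using assms(3)
proof (induction E rule: finite_induct)
  case empty
  show ?case using assms by (simp add: lin_def lc_null[of f D "\<lambda>_. 0"] Q.zero_N)
next
  case (insert e E)
  have eq: "lin (insert e E) K w = (\<lambda>j. w e * K j e + lin E K w j)"
    using insert.hyps by (intro ext) (simp add: lin_def mult.commute)
  show ?case unfolding eq using insert assms
    by (subst lc_insert) (auto intro: lc_closed simp: lc_add lc_scale)
qed

lemma lc_single:
  assumes "finite D" "i \<in> D" "f ` D \<subseteq> carrier M"
  shows "lc M f D (\<lambda>j. if j = i then 1 else 0) = f i"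
proof -
  have D: "D = insert i (D - {i})" using assms by auto
  have "lc M f (D - {i}) (\<lambda>j. if j = i then 1 else 0) = \<zero>\<^bsub>M\<^esub>"
    by (rule lc_null) (use assms in \<open>auto simp: null_def\<close>)
  then show ?thesis using assms by (subst D, subst lc_insert) (auto simp: \<pi>_one)
qed

end

lemma mod_hom_zero:
  assumes M: "module A M" "module A M'" and h: "h \<in> mod_hom A M M'"
  shows "h \<zero>\<^bsub>M\<^esub> = \<zero>\<^bsub>M'\<^esub>"
proof -
  interpret M: module A M by fact
  interpret M': module A M' by fact
  have "h (\<zero> \<odot>\<^bsub>M\<^esub> \<zero>\<^bsub>M\<^esub>) = \<zero> \<odot>\<^bsub>M'\<^esub> h \<zero>\<^bsub>M\<^esub>"
    using h A.zero_closed M.zero_closed unfolding mod_hom_def by blast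
  moreover have "h \<zero>\<^bsub>M\<^esub> \<in> carrier M'" using h by (auto simp: mod_hom_def)
  ultimately show ?thesis by simp
qed

lemma mod_hom_lc:
  assumes M: "module A M" "module A M'" and h: "h \<in> mod_hom A M M'"
    and f: "f ` D \<subseteq> carrier M" and D: "finite D"
  shows "h (lc M f D v) = lc M' (\<lambda>j. h (f j)) D v"
  using D f
proof (induction D rule: finite_induct)
  case empty
  then show ?case using mod_hom_zero[OF M h] by (simp add: lc_empty[OF M(1)] lc_empty[OF M(2)])
next
  case (insert i D)
  interpret M: module A M by fact
  have fi: "f i \<in> carrier M" "f ` D \<subseteq> carrier M" using insert.prems by auto
  have hf: "(\<lambda>j. h (f j)) ` insert i D \<subseteq> carrier M'"
    using insert.prems h by (auto simp: mod_hom_def)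
  have "h (\<pi> (v i) \<odot>\<^bsub>M\<^esub> f i \<oplus>\<^bsub>M\<^esub> lc M f D v) = \<pi> (v i) \<odot>\<^bsub>M'\<^esub> h (f i) \<oplus>\<^bsub>M'\<^esub> h (lc M f D v)"
    using h fi lc_closed[OF M(1), of f D v] by (simp add: mod_hom_def)
  then show ?case
    using insert fi by (simp add: lc_insert[OF M(1)] lc_insert[OF M(2) _ _ hf])
qed

lemma lc_ring: 
  assumes I: "module A (ideal_module A I)" and fI: "f ` D \<subseteq> I" and D: "finite D"
    and b: "\<And>j. j \<in> D \<Longrightarrow> \<pi> (b j) = f j"
  shows "lc (ideal_module A I) f D v = \<pi> (\<Sum>j\<in>D. b j * v j)"
  using D fI b
proof (induction D rule: finite_induct)
  case empty
  then show ?case by (simp add: lc_empty[OF I]) (simp add: ideal_module_def)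
next
  case (insert i D)
  have "lc (ideal_module A I) f (insert i D) v
      = \<pi> (v i) \<odot>\<^bsub>ideal_module A I\<^esub> f i \<oplus>\<^bsub>ideal_module A I\<^esub> lc (ideal_module A I) f D v"
    by (rule lc_insert[OF I]) (use insert in \<open>auto simp: ideal_module_def\<close>)
  also have "\<dots> = \<pi> (v i) \<otimes> f i \<oplus> lc (ideal_module A I) f D v"
    by (simp add: ideal_module_def)
  also have "lc (ideal_module A I) f D v = \<pi> (\<Sum>j\<in>D. b j * v j)"
    using insert by auto
  also have "f i = \<pi> (b i)" using insert by simp
  finally show ?case using insert.hyps by (simp add: \<pi>_add \<pi>_mult A.m_comm)
qed

lemma Idl_eq:
  assumes C: "finite C"
  shows "Idl ((\<lambda>k. \<pi> (a k)) ` C) = {\<pi> (\<Sum>k\<in>C. a k * v k) |v. True}"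
proof
  let ?J = "{\<pi> (\<Sum>k\<in>C. a k * v k) |v. True}"
  have "ideal ?J A"
  proof (rule idealI)
    show "ring A" by (rule A.ring_axioms)
    show "subgroup ?J (add_monoid A)"
    proof (rule A.add.subgroupI)
      show "?J \<subseteq> carrier A" by auto
      show "?J \<noteq> {}" by auto
      show "\<ominus> x \<in> ?J" if xJ: "x \<in> ?J" for x
      proof -
        obtain v where "x = \<pi> (\<Sum>k\<in>C. a k * v k)" using xJ by auto
        then have "\<ominus> x = \<pi> (\<Sum>k\<in>C. a k * (- v k))"
          by (simp add: \<pi>_uminus[symmetric] sum_negf)
        then show ?thesis by (intro CollectI exI[of _ "\<lambda>k. - v k"]) simp
      qed
      show "x \<oplus> y \<in> ?J" if xy: "x \<in> ?J" "y \<in> ?J" for x y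
      proof -
        obtain v w where "x = \<pi> (\<Sum>k\<in>C. a k * v k)" "y = \<pi> (\<Sum>k\<in>C. a k * w k)" using xy by auto
        then have "x \<oplus> y = \<pi> (\<Sum>k\<in>C. a k * (v k + w k))"
          by (simp add: \<pi>_add[symmetric] sum.distrib distrib_left)
        then show ?thesis by (intro CollectI exI[of _ "\<lambda>k. v k + w k"]) simp
      qed
    qed
    show l: "x \<otimes> y \<in> ?J" if xy: "y \<in> ?J" "x \<in> carrier A" for x y
    proof -
      obtain v where "y = \<pi> (\<Sum>k\<in>C. a k * v k)" using xy by auto
      moreover obtain r where "x = \<pi> r" using \<pi>_surj[OF xy(2)] by auto
      ultimately have "x \<otimes> y = \<pi> (\<Sum>k\<in>C. a k * (r * v k))"
        by (simp add: \<pi>_mult[symmetric] sum_distrib_left mult.left_commute)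
      then show ?thesis by (intro CollectI exI[of _ "\<lambda>k. r * v k"]) simp
    qed
    show "y \<otimes> x \<in> ?J" if yx: "y \<in> ?J" "x \<in> carrier A" for x y
    proof -
      have "y \<in> carrier A" using yx(1) by auto
      then show ?thesis using l[OF yx] by (simp only: A.m_comm[of y x] yx(2))
    qed
  qed
  moreover have "(\<lambda>k. \<pi> (a k)) ` C \<subseteq> ?J"
  proof
    fix x assume "x \<in> (\<lambda>k. \<pi> (a k)) ` C"
    then obtain k where k: "k \<in> C" "x = \<pi> (a k)" by auto
    then have "x = \<pi> (\<Sum>j\<in>C. a j * (if j = k then 1 else 0))"
      using C by (simp add: if_distrib cong: if_cong)
    then show "x \<in> ?J" by (intro CollectI exI[of _ "\<lambda>j. if j = k then 1 else 0"]) simp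
  qed
  ultimately show "Idl ((\<lambda>k. \<pi> (a k)) ` C) \<subseteq> ?J" by (rule A.genideal_minimal)
next
  let ?I = "Idl ((\<lambda>k. \<pi> (a k)) ` C)"
  have sub: "(\<lambda>k. \<pi> (a k)) ` C \<subseteq> carrier A" by auto
  interpret I: ideal ?I A by (rule A.genideal_ideal[OF sub])
  have gen: "\<pi> (a k) \<in> ?I" if "k \<in> C" for k using A.genideal_self[OF sub] that by auto
  have "\<pi> (\<Sum>k\<in>D. a k * v k) \<in> ?I" if "finite D" "D \<subseteq> C" for D v
    using that
  proof (induction D rule: finite_induct)
    case empty
    show ?case using I.zero_closed by simp
  next
    case (insert d D)
    then show ?case using gen by (simp add: \<pi>_add \<pi>_mult I.a_closed I.I_r_closed)
  qed
  then show "{\<pi> (\<Sum>k\<in>C. a k * v k) |v. True} \<subseteq> ?I" using C by auto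
qed

section \<open>Free resolutions over a coherent ring\<close>

lemma module_free: "module A (free_module A n)"
proof (rule moduleI)
  show "cring A" by (rule A.cring_axioms)
  show "abelian_group (free_module A n)"
  proof (rule abelian_groupI)
    fix x assume x: "x \<in> carrier (free_module A n)"
    show "\<exists>y\<in>carrier (free_module A n). y \<oplus>\<^bsub>free_module A n\<^esub> x = \<zero>\<^bsub>free_module A n\<^esub>"
      using x by (intro bexI[of _ "\<lambda>i\<in>{..<n}. \<ominus> x i"])
        (auto simp: free_module_def A.l_neg PiE_iff extensional_def fun_eq_iff)
  qed (auto simp: free_module_def PiE_iff extensional_def fun_eq_iff A.a_assoc A.a_comm A.a_lcomm)
qed (auto simp: free_module_def PiE_iff extensional_def fun_eq_iff A.l_distr A.r_distr A.m_assoc)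

definition basis_vector :: "nat \<Rightarrow> nat \<Rightarrow> nat \<Rightarrow> 'a"
  where "basis_vector n i = (\<lambda>j\<in>{..<n}. if j = i then \<one> else \<zero>)"

lemma basis_vector_closed: "basis_vector n i \<in> carrier (free_module A n)"
  by (auto simp: basis_vector_def free_module_def)

lemma basis_vector_image: "basis_vector n ` D \<subseteq> carrier (free_module A n)"
  using basis_vector_closed by blast

lemma lc_basis: "lc (free_module A n) (basis_vector n) {..<n} v = (\<lambda>i\<in>{..<n}. \<pi> (v i))"
proof -
  have "D \<subseteq> {..<n} \<Longrightarrow> lc (free_module A n) (basis_vector n) D v
      = (\<lambda>i\<in>{..<n}. if i \<in> D then \<pi> (v i) else \<zero>)" if "finite D" for D
    using that
  proof (induction D rule: finite_induct)
    case empty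
    show ?case by (simp add: lc_empty[OF module_free]) (simp add: free_module_def)
  next
    case (insert d D)
    have IH: "lc (free_module A n) (basis_vector n) D v = (\<lambda>i\<in>{..<n}. if i \<in> D then \<pi> (v i) else \<zero>)"
      by (rule insert.IH) (use insert.prems in simp)
    have "lc (free_module A n) (basis_vector n) (insert d D) v
       = \<pi> (v d) \<odot>\<^bsub>free_module A n\<^esub> basis_vector n d \<oplus>\<^bsub>free_module A n\<^esub>
          (\<lambda>i\<in>{..<n}. if i \<in> D then \<pi> (v i) else \<zero>)"
    proof (subst lc_insert[OF module_free])
      show "basis_vector n ` insert d D \<subseteq> carrier (free_module A n)"
        by (rule basis_vector_image)
    qed (use insert.hyps in \<open>auto simp only: IH\<close>)
    also have "\<dots> = (\<lambda>i\<in>{..<n}. if i \<in> insert d D then \<pi> (v i) else \<zero>)"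
      using insert.hyps insert.prems by (auto simp: free_module_def basis_vector_def fun_eq_iff)
    finally show ?case .
  qed
  from this[of "{..<n}"] show ?thesis by (auto simp: fun_eq_iff)
qed

lemma free_module_lift:
  assumes "x \<in> carrier (free_module A n)"
  shows "x = (\<lambda>i\<in>{..<n}. \<pi> (lift (x i)))"
  using assms by (auto simp: free_module_def PiE_iff extensional_def fun_eq_iff)

lemma mod_hom_free:
  assumes "module A M" "h \<in> mod_hom A (free_module A n) M"
  shows "h (\<lambda>i\<in>{..<n}. \<pi> (v i)) = lc M (\<lambda>j. h (basis_vector n j)) {..<n} v"
  using mod_hom_lc[OF module_free assms basis_vector_image, of "{..<n}" v] by (simp only: lc_basis) simp

text \<open>Coherence provides some presentation of the ideal generated by \<open>a\<close>, with generators \<open>b\<close> and relation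
matrix \<open>p\<close>, and relations have to be carried over to the generators \<open>a\<close>. Write \<open>b = a d\<close> and \<open>a = b c\<close>.
If \<open>a z = 0\<close> then \<open>c z\<close> is a combination of the columns of \<open>p\<close>, so \<open>z = (z - d c z) + d c z\<close> is a
combination of the columns of \<open>1 - d c\<close> and of \<open>d p\<close>.\<close>

lemma coherent_row:
  assumes coh: "coherent_ring A" and C: "finite C"
  shows "\<exists>D K. finite D \<and> Q.syz {0::nat} C D (row a) K"
proof -
  define I where "I = Idl ((\<lambda>k. \<pi> (a k)) ` C)"
  have I: "I = {\<pi> (lin C (row a) v 0) |v. True}" unfolding I_def Idl_eq[OF C] lin_def ..
  have "fg_ideal A I" unfolding fg_ideal_def I_def
    using C by (intro exI[of _ "(\<lambda>k. \<pi> (a k)) ` C"]) auto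
  then have fp: "finitely_presented A (ideal_module A I)" using coh by (simp add: coherent_ring_def)
  then have mI: "module A (ideal_module A I)" by (simp add: finitely_presented_def)
  obtain m n \<psi> \<phi> where \<psi>: "\<psi> \<in> mod_hom A (free_module A m) (free_module A n)"
    and \<phi>: "\<phi> \<in> mod_hom A (free_module A n) (ideal_module A I)"
    and ker: "\<psi> ` carrier (free_module A m) = a_kernel (free_module A n) (ideal_module A I) \<phi>"
    and surj: "\<phi> ` carrier (free_module A n) = carrier (ideal_module A I)"
    using fp unfolding finitely_presented_def by blast
  have cI: "carrier (ideal_module A I) = I" "\<zero>\<^bsub>ideal_module A I\<^esub> = \<zero>"
    by (simp_all add: ideal_module_def)
  have vec: "(\<lambda>i\<in>{..<n}. \<pi> (v i)) \<in> carrier (free_module A n)" for v n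
    by (auto simp: free_module_def)
  have \<phi>I: "\<phi> (basis_vector n j) \<in> I" for j
    using \<phi> basis_vector_closed[of n j] cI by (auto simp: mod_hom_def)
  then have "\<forall>j. \<exists>v. \<phi> (basis_vector n j) = \<pi> (lin C (row a) v 0)" unfolding I by blast
  then obtain d' where d': "\<And>j. \<phi> (basis_vector n j) = \<pi> (lin C (row a) (d' j) 0)" by metis
  define d where "d k j = d' j k" for k j
  have d: "\<phi> (basis_vector n j) = \<pi> (lin C (row a) (\<lambda>k. d k j) 0)" for j
    using d'[of j] by (simp add: d_def)
  define b where "b j = lin C (row a) (\<lambda>k. d k j) 0" for j
  have \<phi>_eq: "\<phi> (\<lambda>i\<in>{..<n}. \<pi> (v i)) = \<pi> (lin C (row a) (lin {..<n} d v) 0)" for v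
  proof -
    have "\<phi> (\<lambda>i\<in>{..<n}. \<pi> (v i)) = \<pi> (\<Sum>j\<in>{..<n}. b j * v j)"
      unfolding mod_hom_free[OF mI \<phi>] by (rule lc_ring[OF mI]) (use \<phi>I d in \<open>auto simp: b_def\<close>)
    also have "(\<Sum>j\<in>{..<n}. b j * v j) = lin C (row a) (lin {..<n} d v) 0"
      unfolding lin_lin b_def by (simp add: lin_def)
    finally show ?thesis .
  qed
  have "\<forall>k\<in>C. \<exists>c. a k - lin C (row a) (lin {..<n} d c) 0 \<in> null"
  proof
    fix k assume k: "k \<in> C"
    have "\<pi> (a k) \<in> I" unfolding I_def using A.genideal_self[of "(\<lambda>k. \<pi> (a k)) ` C"] k by auto
    then obtain x where x: "x \<in> carrier (free_module A n)" "\<phi> x = \<pi> (a k)"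
      using surj cI by (metis imageE)
    have "\<phi> x = \<pi> (lin C (row a) (lin {..<n} d (\<lambda>i. lift (x i))) 0)"
      using \<phi>_eq[of "\<lambda>i. lift (x i)"] free_module_lift[OF x(1)] by simp
    then show "\<exists>c. a k - lin C (row a) (lin {..<n} d c) 0 \<in> null"
      unfolding diff_in_null_iff using x(2) by metis
  qed
  then obtain c' where c': "\<And>k. k \<in> C \<Longrightarrow> a k - lin C (row a) (lin {..<n} d (c' k)) 0 \<in> null"
    by metis
  define c where "c j k = c' k j" for j k
  have c: "a k - lin C (row a) (lin {..<n} d (\<lambda>j. c j k)) 0 \<in> null" if "k \<in> C" for k
    using c'[OF that] by (simp add: c_def)
  define p where "p j l = lift (\<psi> (basis_vector m l) j)" for j l
  have \<psi>_basis: "\<psi> (basis_vector m l) = (\<lambda>i\<in>{..<n}. \<pi> (p i l))" for l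
    unfolding p_def using \<psi> basis_vector_closed[of m l]
    by (intro free_module_lift) (auto simp: mod_hom_def)
  have \<psi>_eq: "\<psi> (\<lambda>i\<in>{..<m}. \<pi> (v i)) = (\<lambda>i\<in>{..<n}. \<pi> (lin {..<m} p v i))" for v
  proof -
    have 1: "\<psi> (basis_vector m l) = lc (free_module A n) (basis_vector n) {..<n} (\<lambda>i. p i l)" for l
      unfolding lc_basis by (rule \<psi>_basis)
    show ?thesis
      unfolding mod_hom_free[OF module_free \<psi>] 1
      by (subst lc_lin[OF module_free basis_vector_image]) (simp_all add: lc_basis)
  qed
  have \<phi>\<psi>: "lin C (row a) (lin {..<n} d (\<lambda>j. p j l)) 0 \<in> null" for l
  proof -
    have "\<psi> (basis_vector m l) \<in> a_kernel (free_module A n) (ideal_module A I) \<phi>"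
      using ker basis_vector_closed by blast
    then show ?thesis using \<phi>_eq[of "\<lambda>j. p j l"]
      by (simp add: \<psi>_basis a_kernel_def' cI null_def)
  qed
  have kernel: "\<exists>x. \<forall>j<n. y j - lin {..<m} p x j \<in> null" if y: "lin C (row a) (lin {..<n} d y) 0 \<in> null" for y
  proof -
    have "(\<lambda>i\<in>{..<n}. \<pi> (y i)) \<in> a_kernel (free_module A n) (ideal_module A I) \<phi>"
      using y vec by (simp add: a_kernel_def' \<phi>_eq cI null_def)
    then have "(\<lambda>i\<in>{..<n}. \<pi> (y i)) \<in> \<psi> ` carrier (free_module A m)" by (simp only: ker)
    then obtain x where x: "(\<lambda>i\<in>{..<n}. \<pi> (y i)) = \<psi> x" "x \<in> carrier (free_module A m)"
      by (rule imageE)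
    have eq: "(\<lambda>i\<in>{..<n}. \<pi> (y i)) = (\<lambda>i\<in>{..<n}. \<pi> (lin {..<m} p (\<lambda>i. lift (x i)) i))"
      using \<psi>_eq[of "\<lambda>i. lift (x i)"] free_module_lift[OF x(2)] x(1) by simp
    have "\<forall>j<n. y j - lin {..<m} p (\<lambda>i. lift (x i)) j \<in> null"
    proof (intro allI impI)
      fix j assume "j < n"
      then show "y j - lin {..<m} p (\<lambda>i. lift (x i)) j \<in> null"
        using fun_cong[OF eq, of j] by (simp add: diff_in_null_iff)
    qed
    then show ?thesis by blast
  qed
  \<comment> \<open>the columns of \<open>d p\<close>, followed by those of \<open>1 - d c\<close>, whose indices are shifted by \<open>m\<close>\<close>
  define D where "D = {..<m} \<union> (\<lambda>i. m + i) ` C"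
  define K where "K k l = (if l < m then lin {..<n} d (\<lambda>j. p j l) k
      else (if k = l - m then 1 else 0) - lin {..<n} d (\<lambda>j. c j (l - m)) k)" for k l
  have sumD: "lin D K w k = lin {..<n} d (lin {..<m} p w) k
      + (\<Sum>i\<in>C. ((if k = i then 1 else 0) - lin {..<n} d (\<lambda>j. c j i) k) * w (m + i))" for w k
  proof -
    have "lin D K w k = (\<Sum>l\<in>{..<m}. K k l * w l) + (\<Sum>l\<in>(\<lambda>i. m + i) ` C. K k l * w l)"
      unfolding lin_def D_def by (rule sum.union_disjoint) (use C in auto)
    also have "(\<Sum>l\<in>(\<lambda>i. m + i) ` C. K k l * w l)
        = (\<Sum>i\<in>C. ((if k = i then 1 else 0) - lin {..<n} d (\<lambda>j. c j i) k) * w (m + i))"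
      by (subst sum.reindex) (auto simp: K_def)
    also have "(\<Sum>l\<in>{..<m}. K k l * w l) = lin {..<n} d (lin {..<m} p w) k"
      unfolding lin_lin by (simp add: K_def lin_def)
    finally show ?thesis .
  qed
  have "Q.syz {0::nat} C D (row a) K"
    unfolding Q.syz_def
  proof (intro conjI ballI allI impI)
    fix i l assume l: "l \<in> D"
    show "lin C (row a) (\<lambda>k. K k l) i \<in> null"
    proof (cases "l < m")
      case True
      then show ?thesis using \<phi>\<psi>[of l] by (simp add: K_def lin_def)
    next
      case False
      then have lC: "l - m \<in> C" using l by (auto simp: D_def)
      have "lin C (row a) (\<lambda>k. K k l) i
          = a (l - m) - lin C (row a) (lin {..<n} d (\<lambda>j. c j (l - m))) i"
        using False lC C by (simp add: K_def lin_diff Q.lin_unit)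
      then show ?thesis using c[OF lC] by (simp add: lin_def)
    qed
  next
    fix z assume "\<forall>i\<in>{0}. lin C (row a) z i \<in> null"
    then have z: "lin C (row a) z 0 \<in> null" by simp
    define y where "y = lin C c z"
    have "lin C (row a) (lin {..<n} d y) 0 - lin C (row a) z 0
        = - (\<Sum>k\<in>C. (a k - lin C (row a) (lin {..<n} d (\<lambda>j. c j k)) 0) * z k)"
    proof -
      have eq: "lin {..<n} d y = lin C (\<lambda>k i. lin {..<n} d (\<lambda>j. c j i) k) z"
        unfolding y_def by (intro ext) (subst lin_lin, simp add: lin_def)
      have "lin C (row a) (lin {..<n} d y) 0 = (\<Sum>k\<in>C. lin C (row a) (lin {..<n} d (\<lambda>j. c j k)) 0 * z k)"
        unfolding eq by (rule lin_lin_columns)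
      then show ?thesis by (simp add: lin_def left_diff_distrib sum_subtractf)
    qed
    also have "\<dots> \<in> null" by (intro Q.uminus_N Q.sum_N Q.mult_N_right c)
    finally have "lin C (row a) (lin {..<n} d y) 0 \<in> null" using z Q.N_cong by blast
    then obtain x where x: "\<forall>j<n. y j - lin {..<m} p x j \<in> null" using kernel by blast
    define w where "w l = (if l < m then x l else z (l - m))" for l
    have "z k - lin D K w k \<in> null" if k: "k \<in> C" for k
    proof -
      have px: "lin {..<m} p w = lin {..<m} p x" by (intro ext) (simp add: lin_def w_def)
      have "(\<Sum>i\<in>C. ((if k = i then 1 else 0) - lin {..<n} d (\<lambda>j. c j i) k) * w (m + i))
          = z k - lin {..<n} d y k"
        unfolding y_def lin_lin using k C
        by (simp add: w_def lin_def left_diff_distrib sum_subtractf if_distrib[of "\<lambda>x. x * _"] cong: if_cong)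
      then have "z k - lin D K w k = lin {..<n} d y k - lin {..<n} d (lin {..<m} p x) k"
        by (simp add: sumD px)
      also have "\<dots> \<in> null" by (rule Q.lin_cong_N) (use x in simp)
      finally show ?thesis .
    qed
    then show "\<exists>w. \<forall>k\<in>C. z k - lin D K w k \<in> null" by blast
  qed
  moreover have "finite D" using C by (simp add: D_def)
  ultimately show ?thesis by blast
qed

lemma coherent_kernel:
  assumes coh: "coherent_ring A" and Y: "finite Y" and C: "finite C"
  shows "\<exists>D K. finite D \<and> Q.syz Y C D M K"
proof -
  have "\<exists>D K. finite D \<and> (\<forall>q\<in>{1}. Q.syz {0::nat} C D (\<lambda>_ k. a k ^ q) (\<lambda>k l. K k l ^ q))"
    if "finite C" for C a
    using coherent_row[OF coh that, of a] by simp
  from Q.syz_rows[OF this _ Y C, of M] show ?thesis using Q.freshman_1 by auto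
qed

text \<open>A resolution of the ring modulo the ideal generated by \<open>a\<close>: the module on \<open>B 0 = {0}\<close> is the ring
itself.\<close>

lemma free_resolution:
  assumes coh: "coherent_ring A" and C: "finite C"
  obtains B \<phi> where "\<And>i. finite (B i)" "B 0 = {0}" "B 1 = C" "\<phi> 0 = (row a)"
    "\<And>i. Q.syz (B i) (B (Suc i)) (B (Suc (Suc i))) (\<phi> i) (\<phi> (Suc i))"
proof -
  define P where "P n x \<longleftrightarrow> (case x of (Y, D, M) \<Rightarrow> finite Y \<and> finite D \<and>
      (n = 0 \<longrightarrow> Y = {0} \<and> D = C \<and> M = (row a)))"
    for n :: nat and x :: "nat set \<times> nat set \<times> (nat \<Rightarrow> nat \<Rightarrow> 'r)"
  define R where "R n x y \<longleftrightarrow> (case x of (Y, D, M) \<Rightarrow> case y of (D', E, K) \<Rightarrow>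
      D' = D \<and> Q.syz Y D E M K)"
    for n :: nat and x y :: "nat set \<times> nat set \<times> (nat \<Rightarrow> nat \<Rightarrow> 'r)"
  have "\<exists>x. \<forall>n. P n (x n) \<and> R n (x n) (x (Suc n))"
  proof (rule dependent_nat_choice)
    show "\<exists>x. P 0 x" using C by (intro exI[of _ "({0}, C, \<lambda>_::nat. a)"]) (simp add: P_def)
    show "\<exists>y. P (Suc n) y \<and> R n x y" if x: "P n x" for n x
    proof -
      obtain Y D M where xe: "x = (Y, D, M)" by (cases x)
      then have YD: "finite Y" "finite D" using x by (auto simp: P_def)
      obtain E K where "finite E" "Q.syz Y D E M K"
        using coherent_kernel[OF coh YD, of M] by blast
      then show ?thesis using YD xe by (intro exI[of _ "(D, E, K)"]) (simp add: P_def R_def)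
    qed
  qed
  then obtain x where x: "\<And>n. P n (x n)" "\<And>n. R n (x n) (x (Suc n))" by blast
  define B where "B i = fst (x i)" for i
  define \<phi> where "\<phi> i = snd (snd (x i))" for i
  have B_Suc: "B (Suc i) = fst (snd (x i))" for i
    using x(2)[of i] by (auto simp: R_def B_def split: prod.splits)
  show ?thesis
  proof (rule that[of B \<phi>])
    show "finite (B i)" for i using x(1)[of i] by (auto simp: P_def B_def split: prod.splits)
    show "B 0 = {0}" "\<phi> 0 = (row a)" using x(1)[of 0] by (auto simp: P_def B_def \<phi>_def split: prod.splits)
    show "B 1 = C" using x(1)[of 0] B_Suc[of 0] by (auto simp: P_def split: prod.splits)
    show "Q.syz (B i) (B (Suc i)) (B (Suc (Suc i))) (\<phi> i) (\<phi> (Suc i))" for i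
      using x(2)[of i] B_Suc[of i] B_Suc[of "Suc i"]
      by (auto simp: R_def B_def \<phi>_def split: prod.splits)
  qed
qed

end

section \<open>Projective modules and comparison of resolutions\<close>

context ring_presentation
begin

lemma lc_fcong:
  assumes M: "module A M" and "\<And>j. j \<in> D \<Longrightarrow> f j = g j" "g ` D \<subseteq> carrier M"
  shows "lc M f D v = lc M g D v"
proof -
  interpret M: module A M by fact
  show ?thesis unfolding lc_def by (rule M.finsum_cong') (use assms in auto)
qed

lemma lc_superset:
  assumes M: "module A M" and T: "finite T" "D \<subseteq> T" "f ` T \<subseteq> carrier M"
    and v: "\<And>j. j \<in> T - D \<Longrightarrow> v j \<in> null"
  shows "lc M f T v = lc M f D v"
proof -
  interpret M: module A M by fact
  have "lc M f (D \<union> E) v = lc M f D v" if "finite E" "E \<subseteq> T - D" for E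
    using that
  proof (induction E rule: finite_induct)
    case (insert e E)
    have D: "finite D" using T finite_subset by blast
    have "lc M f (insert e (D \<union> E)) v = \<pi> (v e) \<odot>\<^bsub>M\<^esub> f e \<oplus>\<^bsub>M\<^esub> lc M f (D \<union> E) v"
      by (rule lc_insert[OF M]) (use insert D T in auto)
    moreover have "\<pi> (v e) = \<zero>" using v[of e] insert.prems by (auto simp: null_def)
    moreover have "f e \<in> carrier M" using insert.prems T by auto
    moreover have "lc M f D v \<in> carrier M" by (rule lc_closed[OF M]) (use T in auto)
    ultimately show ?case using insert by simp
  qed simp
  from this[of "T - D"] T show ?thesis by (simp add: Un_absorb1)
qed

text \<open>The lifting property in the definition of projective modules is tested on modules of functions
\<open>'u \<Rightarrow> 'a\<close>. Two such modules are used: the free module on the set \<open>carrier P\<close>, and the copy of \<open>P\<close>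
that consists of the indicator functions of its points.\<close>

definition free_on :: "('a, 'u) module \<Rightarrow> ('a, 'u \<Rightarrow> 'a) module"
  where "free_on P =
    \<lparr>carrier = {f. (\<forall>u. f u \<in> carrier A) \<and> finite {u. f u \<noteq> \<zero>} \<and> {u. f u \<noteq> \<zero>} \<subseteq> carrier P},
     monoid.mult = (\<lambda>f g. f), one = (\<lambda>u. \<zero>), ring.zero = (\<lambda>u. \<zero>),
     ring.add = (\<lambda>f g u. f u \<oplus> g u), smult = (\<lambda>a f u. a \<otimes> f u)\<rparr>"

definition point :: "'u \<Rightarrow> 'u \<Rightarrow> 'a"
  where "point x = (\<lambda>u. if u = x then \<one> else \<zero>)"

definition unpoint :: "('u \<Rightarrow> 'a) \<Rightarrow> 'u" where "unpoint = inv_into UNIV point"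

definition point_copy :: "('a, 'u) module \<Rightarrow> ('a, 'u \<Rightarrow> 'a) module"
  where "point_copy P =
    \<lparr>carrier = point ` carrier P,
     monoid.mult = (\<lambda>f g. f), one = point \<zero>\<^bsub>P\<^esub>, ring.zero = point \<zero>\<^bsub>P\<^esub>,
     ring.add = (\<lambda>f g. point (unpoint f \<oplus>\<^bsub>P\<^esub> unpoint g)), smult = (\<lambda>a f. point (a \<odot>\<^bsub>P\<^esub> unpoint f))\<rparr>"

definition lc_total :: "('a, 'u) module \<Rightarrow> ('u \<Rightarrow> 'a) \<Rightarrow> 'u"
  where "lc_total P f = lc P (\<lambda>u. u) {u. f u \<noteq> \<zero>} (\<lambda>u. lift (f u))"

lemma module_free_on: "module A (free_on P)"
proof (rule moduleI)
  show "cring A" by (rule A.cring_axioms)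
  have sub: "{u. f u \<oplus> g u \<noteq> \<zero>} \<subseteq> {u. f u \<noteq> \<zero>} \<union> {u. g u \<noteq> \<zero>}" for f g :: "'d \<Rightarrow> 'a"
    by auto
  show "abelian_group (free_on P)"
  proof (rule abelian_groupI)
    fix f g assume fg: "f \<in> carrier (free_on P)" "g \<in> carrier (free_on P)"
    have "finite {u. f u \<oplus> g u \<noteq> \<zero>}"
      by (rule finite_subset[OF sub]) (use fg in \<open>simp add: free_on_def\<close>)
    moreover have "{u. f u \<oplus> g u \<noteq> \<zero>} \<subseteq> carrier P"
      using sub[of f g] fg by (auto simp: free_on_def)
    ultimately show "f \<oplus>\<^bsub>free_on P\<^esub> g \<in> carrier (free_on P)"
      using fg by (simp add: free_on_def)
  next
    fix f assume f: "f \<in> carrier (free_on P)"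
    have eq: "{u. \<ominus> f u \<noteq> \<zero>} = {u. f u \<noteq> \<zero>}"
      using f by (auto simp: free_on_def)
    show "\<exists>g\<in>carrier (free_on P). g \<oplus>\<^bsub>free_on P\<^esub> f = \<zero>\<^bsub>free_on P\<^esub>"
      using f eq by (intro bexI[of _ "\<lambda>u. \<ominus> f u"]) (auto simp: free_on_def A.l_neg)
  qed (auto simp: free_on_def A.a_assoc A.a_comm A.a_lcomm)
  fix a f assume a: "a \<in> carrier A" and f: "f \<in> carrier (free_on P)"
  have sub: "{u. a \<otimes> f u \<noteq> \<zero>} \<subseteq> {u. f u \<noteq> \<zero>}" using a by auto
  have "finite {u. a \<otimes> f u \<noteq> \<zero>}"
    by (rule finite_subset[OF sub]) (use f in \<open>simp add: free_on_def\<close>)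
  then show "a \<odot>\<^bsub>free_on P\<^esub> f \<in> carrier (free_on P)"
    using a f sub by (auto simp: free_on_def)
qed (auto simp: free_on_def A.l_distr A.r_distr A.m_assoc)

lemma inj_point:
  assumes "\<one> \<noteq> \<zero>"
  shows "inj (point :: 'u \<Rightarrow> 'u \<Rightarrow> 'a)"
  using assms by (intro injI) (metis point_def)

lemma unpoint_point [simp]: "\<one> \<noteq> \<zero> \<Longrightarrow> unpoint (point x) = x"
  unfolding unpoint_def by (rule inv_f_f[OF inj_point])

lemma module_point_copy:
  assumes ne: "\<one> \<noteq> \<zero>" and P: "module A P"
  shows "module A (point_copy P)"
proof -
  interpret P: module A P by fact
  show ?thesis
  proof (rule moduleI)
    show "cring A" by (rule A.cring_axioms)
    show "abelian_group (point_copy P)"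
    proof (rule abelian_groupI)
      fix f assume "f \<in> carrier (point_copy P)"
      then obtain x where x: "x \<in> carrier P" "f = point x" by (auto simp: point_copy_def)
      then show "\<exists>g\<in>carrier (point_copy P). g \<oplus>\<^bsub>point_copy P\<^esub> f = \<zero>\<^bsub>point_copy P\<^esub>"
        using ne by (intro bexI[of _ "point (\<ominus>\<^bsub>P\<^esub> x)"]) (auto simp: point_copy_def P.M.l_neg)
    qed (use ne in \<open>auto simp: point_copy_def P.M.a_assoc P.M.a_comm P.M.a_lcomm\<close>)
  qed (use ne in \<open>auto simp: point_copy_def P.smult_l_distr P.smult_r_distr P.smult_assoc1\<close>)
qed

lemma total_eq:
  assumes P: "module A P" and f: "f \<in> carrier (free_on P)"
    and T: "finite T" "{u. f u \<noteq> \<zero>} \<subseteq> T" "T \<subseteq> carrier P"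
  shows "lc_total P f = lc P (\<lambda>u. u) T (\<lambda>u. lift (f u))"
  unfolding lc_total_def
  by (rule lc_superset[OF P T(1,2), symmetric]) (use T Q.zero_N in auto)

lemma total_hom:
  assumes ne: "\<one> \<noteq> \<zero>" and P: "module A P"
  shows "(\<lambda>f. point (lc_total P f)) \<in> mod_hom A (free_on P) (point_copy P)"
proof -
  interpret P: module A P by fact
  have supp: "finite {u. f u \<noteq> \<zero>}" "{u. f u \<noteq> \<zero>} \<subseteq> carrier P" "\<And>u. f u \<in> carrier A"
    if "f \<in> carrier (free_on P)" for f
    using that by (auto simp: free_on_def)
  have closed: "lc_total P f \<in> carrier P" if "f \<in> carrier (free_on P)" for f
    unfolding lc_total_def by (rule lc_closed[OF P]) (use supp[OF that] in auto)
  have add: "lc_total P (f \<oplus>\<^bsub>free_on P\<^esub> g) = lc_total P f \<oplus>\<^bsub>P\<^esub> lc_total P g"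
    if f: "f \<in> carrier (free_on P)" and g: "g \<in> carrier (free_on P)" for f g
  proof -
    interpret F: module A "free_on P" by (rule module_free_on)
    let ?T = "{u. f u \<noteq> \<zero>} \<union> {u. g u \<noteq> \<zero>}"
    have T: "finite ?T" "?T \<subseteq> carrier P" "(\<lambda>u. u) ` ?T \<subseteq> carrier P" using supp f g by auto
    have fg: "f \<oplus>\<^bsub>free_on P\<^esub> g = (\<lambda>u. f u \<oplus> g u)" by (simp add: free_on_def)
    have "lc_total P (f \<oplus>\<^bsub>free_on P\<^esub> g) = lc P (\<lambda>u. u) ?T (\<lambda>u. lift (f u \<oplus> g u))"
    proof -
      have "{u. f u \<oplus> g u \<noteq> \<zero>} \<subseteq> ?T" by auto
      then show ?thesis using total_eq[OF P F.M.a_closed[OF f g] T(1) _ T(2)] unfolding fg by blast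
    qed
    also have "\<dots> = lc P (\<lambda>u. u) ?T (\<lambda>u. lift (f u) + lift (g u))"
      by (rule lc_cong[OF P T(3)]) (use supp f g in \<open>auto simp: diff_in_null_iff \<pi>_add\<close>)
    also have "\<dots> = lc P (\<lambda>u. u) ?T (\<lambda>u. lift (f u)) \<oplus>\<^bsub>P\<^esub> lc P (\<lambda>u. u) ?T (\<lambda>u. lift (g u))"
      by (rule lc_add[OF P T(3)])
    finally show ?thesis
      using total_eq[OF P f T(1) _ T(2)] total_eq[OF P g T(1) _ T(2)] by simp
  qed
  have scale: "lc_total P (a \<odot>\<^bsub>free_on P\<^esub> f) = a \<odot>\<^bsub>P\<^esub> lc_total P f"
    if a: "a \<in> carrier A" and f: "f \<in> carrier (free_on P)" for a f
  proof -
    interpret F: module A "free_on P" by (rule module_free_on)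
    let ?T = "{u. f u \<noteq> \<zero>}"
    have T: "finite ?T" "?T \<subseteq> carrier P" "(\<lambda>u. u) ` ?T \<subseteq> carrier P" using supp f by auto
    have af: "a \<odot>\<^bsub>free_on P\<^esub> f = (\<lambda>u. a \<otimes> f u)" by (simp add: free_on_def)
    have "{u. a \<otimes> f u \<noteq> \<zero>} \<subseteq> ?T" using a by auto
    then have "lc_total P (a \<odot>\<^bsub>free_on P\<^esub> f) = lc P (\<lambda>u. u) ?T (\<lambda>u. lift (a \<otimes> f u))"
      using total_eq[OF P F.smult_closed[OF a f] T(1) _ T(2)] unfolding af by blast
    also have "\<dots> = lc P (\<lambda>u. u) ?T (\<lambda>u. lift a * lift (f u))"
      by (rule lc_cong[OF P T(3)]) (use supp f a in \<open>auto simp: diff_in_null_iff \<pi>_mult\<close>)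
    also have "\<dots> = a \<odot>\<^bsub>P\<^esub> lc_total P f"
      using a by (simp add: lc_scale[OF P T(3,1)] lc_total_def)
    finally show ?thesis .
  qed
  show ?thesis unfolding mod_hom_def
    using closed add scale ne by (auto simp: point_copy_def)
qed

text \<open>Lift the identity of \<open>P\<close> along the canonical surjection \<open>lc_total\<close> of the free module onto \<open>P\<close>. The
values \<open>\<sigma> x u\<close> are coordinate functions of \<open>P\<close> with \<open>x = \<Sum> \<sigma> x u * u\<close>, and only finitely many of them
are nonzero at \<open>x\<close>.\<close>

lemma dual_basis:
  fixes P :: "('a, 'u) module"
  assumes ne: "\<one> \<noteq> \<zero>" and proj: "projective_module A P"
  obtains \<sigma> where "\<sigma> \<in> mod_hom A P (free_on P)" "\<And>x. x \<in> carrier P \<Longrightarrow> lc_total P (\<sigma> x) = x"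
proof -
  have P: "module A P" using proj by (simp add: projective_module_def)
  interpret P: module A P by fact
  have h: "point \<in> mod_hom A P (point_copy P)"
    using ne by (auto simp: mod_hom_def point_copy_def)
  have "(\<lambda>f. point (lc_total P f)) ` carrier (free_on P) = carrier (point_copy P)"
  proof
    show "(\<lambda>f. point (lc_total P f)) ` carrier (free_on P) \<subseteq> carrier (point_copy P)"
      using total_hom[OF ne P] by (auto simp: mod_hom_def)
    have "point x \<in> (\<lambda>f. point (lc_total P f)) ` carrier (free_on P)" if x: "x \<in> carrier P" for x
    proof
      have px: "{u. point x u \<noteq> \<zero>} = {x}" using ne by (auto simp: point_def)
      show "point x \<in> carrier (free_on P)"
        using x by (simp add: free_on_def px) (simp add: point_def)
      have "lc_total P (point x) = lc P (\<lambda>u. u) {x} (\<lambda>u. lift (point x u))"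
        unfolding lc_total_def px ..
      also have "\<dots> = \<pi> (lift (point x x)) \<odot>\<^bsub>P\<^esub> x \<oplus>\<^bsub>P\<^esub> \<zero>\<^bsub>P\<^esub>"
        using x by (subst lc_insert[OF P]) (auto simp: lc_empty[OF P])
      also have "\<dots> = x" using x by (simp add: point_def)
      finally show "point x = point (lc_total P (point x))" by simp
    qed
    then show "carrier (point_copy P) \<subseteq> (\<lambda>f. point (lc_total P f)) ` carrier (free_on P)"
      by (auto simp: point_copy_def)
  qed
  then obtain \<sigma> where \<sigma>: "\<sigma> \<in> mod_hom A P (free_on P)"
    and "\<forall>x\<in>carrier P. point (lc_total P (\<sigma> x)) = point x"
    using proj module_free_on[of P] module_point_copy[OF ne P] total_hom[OF ne P] h
    unfolding projective_module_def by blast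
  then have "lc_total P (\<sigma> x) = x" if "x \<in> carrier P" for x
    using that inj_point[OF ne] by (meson injD)
  then show ?thesis using that[OF \<sigma>] by blast
qed

definition linear_mod :: "('a, 'u) module \<Rightarrow> ('u \<Rightarrow> nat \<Rightarrow> 'r) \<Rightarrow> bool"
  where "linear_mod P g \<longleftrightarrow>
    (\<forall>x\<in>carrier P. \<forall>y\<in>carrier P. \<forall>k. g (x \<oplus>\<^bsub>P\<^esub> y) k - (g x k + g y k) \<in> null) \<and>
    (\<forall>x\<in>carrier P. \<forall>r k. g (\<pi> r \<odot>\<^bsub>P\<^esub> x) k - r * g x k \<in> null)"

text \<open>The lifting property in a form without a second module: a linear relation that is defined on all
of \<open>P\<close> contains a linear map. If \<open>G u\<close> is related to \<open>u\<close> for every \<open>u\<close>, then \<open>\<Sum> \<sigma> x u * G u\<close> is related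
to \<open>x\<close> and depends linearly on \<open>x\<close>, where \<open>\<sigma>\<close> is a dual basis.\<close>

lemma projective_selection:
  fixes P :: "('a, 'u) module" and R :: "'u \<Rightarrow> (nat \<Rightarrow> 'r) \<Rightarrow> bool"
  assumes ne: "\<one> \<noteq> \<zero>" and proj: "projective_module A P"
    and tot: "\<And>x. x \<in> carrier P \<Longrightarrow> \<exists>v. R x v"
    and add: "\<And>x y v w. x \<in> carrier P \<Longrightarrow> y \<in> carrier P \<Longrightarrow> R x v \<Longrightarrow> R y w \<Longrightarrow>
      R (x \<oplus>\<^bsub>P\<^esub> y) (\<lambda>k. v k + w k)"
    and scale: "\<And>r x v. x \<in> carrier P \<Longrightarrow> R x v \<Longrightarrow> R (\<pi> r \<odot>\<^bsub>P\<^esub> x) (\<lambda>k. r * v k)"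
  obtains g where "linear_mod P g" "\<And>x. x \<in> carrier P \<Longrightarrow> R x (g x)"
proof -
  have P: "module A P" using proj by (simp add: projective_module_def)
  interpret P: module A P by fact
  obtain \<sigma> where \<sigma>: "\<sigma> \<in> mod_hom A P (free_on P)" and total_\<sigma>: "\<And>x. x \<in> carrier P \<Longrightarrow> lc_total P (\<sigma> x) = x"
    using dual_basis[OF ne proj] by blast
  have \<sigma>_closed: "\<sigma> x \<in> carrier (free_on P)" if "x \<in> carrier P" for x
    using \<sigma> that by (auto simp: mod_hom_def)
  have \<sigma>_add: "\<sigma> (x \<oplus>\<^bsub>P\<^esub> y) u = \<sigma> x u \<oplus> \<sigma> y u" if "x \<in> carrier P" "y \<in> carrier P" for x y u
    using \<sigma> that by (simp add: mod_hom_def) (simp add: free_on_def)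
  have \<sigma>_scale: "\<sigma> (\<pi> r \<odot>\<^bsub>P\<^esub> x) u = \<pi> r \<otimes> \<sigma> x u" if "x \<in> carrier P" for x r u
    using \<sigma> that by (simp add: mod_hom_def) (simp add: free_on_def)
  define supp where "supp x = {u. \<sigma> x u \<noteq> \<zero>}" for x
  have supp: "finite (supp x)" "supp x \<subseteq> carrier P" "\<And>u. \<sigma> x u \<in> carrier A" if "x \<in> carrier P" for x
    using \<sigma>_closed[OF that] by (auto simp: free_on_def supp_def)
  obtain G where G: "\<And>x. x \<in> carrier P \<Longrightarrow> R x (G x)" using tot by metis
  define g where "g x k = (\<Sum>u\<in>supp x. lift (\<sigma> x u) * G u k)" for x k
  have g_eq: "g x k = (\<Sum>u\<in>T. lift (\<sigma> x u) * G u k)" if "finite T" "supp x \<subseteq> T" for x k T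
    unfolding g_def by (rule sum.mono_neutral_left) (use that in \<open>auto simp: supp_def\<close>)
  have "R (lc P (\<lambda>u. u) T c) (\<lambda>k. \<Sum>u\<in>T. c u * G u k)" if "finite T" "T \<subseteq> carrier P" for T c
    using that
  proof (induction T rule: finite_induct)
    case empty
    have "R (\<pi> 0 \<odot>\<^bsub>P\<^esub> \<zero>\<^bsub>P\<^esub>) (\<lambda>k. 0 * G \<zero>\<^bsub>P\<^esub> k)" by (rule scale) (auto intro: G)
    then show ?case by (simp add: lc_empty[OF P])
  next
    case (insert t T)
    have "R (\<pi> (c t) \<odot>\<^bsub>P\<^esub> t \<oplus>\<^bsub>P\<^esub> lc P (\<lambda>u. u) T c) (\<lambda>k. c t * G t k + (\<Sum>u\<in>T. c u * G u k))"
      by (rule add) (use insert in \<open>auto intro!: scale G lc_closed[OF P]\<close>)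
    then show ?case using insert by (subst lc_insert[OF P]) auto
  qed
  then have "R (lc_total P (\<sigma> x)) (g x)" if "x \<in> carrier P" for x
    using supp[OF that] unfolding lc_total_def g_def supp_def by blast
  then have R: "R x (g x)" if "x \<in> carrier P" for x using that by (simp add: total_\<sigma>)
  have "linear_mod P g"
    unfolding linear_mod_def
  proof (intro conjI ballI allI)
    fix x y k assume x: "x \<in> carrier P" and y: "y \<in> carrier P"
    let ?T = "supp x \<union> supp y \<union> supp (x \<oplus>\<^bsub>P\<^esub> y)"
    have T: "finite ?T" using supp x y by auto
    have "g (x \<oplus>\<^bsub>P\<^esub> y) k - (g x k + g y k)
        = (\<Sum>u\<in>?T. (lift (\<sigma> (x \<oplus>\<^bsub>P\<^esub> y) u) - (lift (\<sigma> x u) + lift (\<sigma> y u))) * G u k)"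
      by (subst (1 2 3) g_eq[OF T]) (auto simp: sum.distrib sum_subtractf left_diff_distrib distrib_right)
    also have "\<dots> \<in> null"
      by (intro Q.sum_N Q.mult_N_right) (use supp x y in \<open>simp add: diff_in_null_iff \<pi>_add \<sigma>_add\<close>)
    finally show "g (x \<oplus>\<^bsub>P\<^esub> y) k - (g x k + g y k) \<in> null" .
  next
    fix x r k assume x: "x \<in> carrier P"
    let ?T = "supp x \<union> supp (\<pi> r \<odot>\<^bsub>P\<^esub> x)"
    have T: "finite ?T" using supp x by auto
    have "g (\<pi> r \<odot>\<^bsub>P\<^esub> x) k - r * g x k
        = (\<Sum>u\<in>?T. (lift (\<sigma> (\<pi> r \<odot>\<^bsub>P\<^esub> x) u) - r * lift (\<sigma> x u)) * G u k)"
      by (subst (1 2) g_eq[OF T]) (auto simp: sum_subtractf left_diff_distrib sum_distrib_left mult.assoc)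
    also have "\<dots> \<in> null"
      by (intro Q.sum_N Q.mult_N_right) (use supp x in \<open>simp add: diff_in_null_iff \<pi>_mult \<sigma>_scale\<close>)
    finally show "g (\<pi> r \<odot>\<^bsub>P\<^esub> x) k - r * g x k \<in> null" .
  qed
  then show ?thesis using that R by blast
qed

lemma linear_mod_zero:
  assumes "module A P" "linear_mod P g"
  shows "g \<zero>\<^bsub>P\<^esub> k \<in> null"
proof -
  interpret P: module A P by fact
  have "g (\<pi> 0 \<odot>\<^bsub>P\<^esub> \<zero>\<^bsub>P\<^esub>) k - 0 * g \<zero>\<^bsub>P\<^esub> k \<in> null"
    using assms(2) unfolding linear_mod_def by blast
  then show ?thesis by simp
qed

lemma linear_mod_lc:
  assumes P: "module A P" and g: "linear_mod P g" and f: "f ` D \<subseteq> carrier P" and D: "finite D"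
  shows "g (lc P f D v) k - lin D (\<lambda>k j. g (f j) k) v k \<in> null"
  using D f
proof (induction D rule: finite_induct)
  case empty
  show ?case using linear_mod_zero[OF P g] by (simp add: lc_empty[OF P] lin_def)
next
  case (insert d D)
  interpret P: module A P by fact
  let ?x = "\<pi> (v d) \<odot>\<^bsub>P\<^esub> f d" and ?y = "lc P f D v"
  have xy: "f d \<in> carrier P" "?x \<in> carrier P" "?y \<in> carrier P"
    using insert.prems lc_closed[OF P, of f D v] by auto
  have "g (?x \<oplus>\<^bsub>P\<^esub> ?y) k - (g ?x k + g ?y k) \<in> null" "g ?x k - v d * g (f d) k \<in> null"
    using g xy unfolding linear_mod_def by blast+
  moreover have "g ?y k - lin D (\<lambda>k j. g (f j) k) v k \<in> null" using insert by auto
  ultimately have "(g (?x \<oplus>\<^bsub>P\<^esub> ?y) k - (g ?x k + g ?y k)) + ((g ?x k - v d * g (f d) k)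
      + (g ?y k - lin D (\<lambda>k j. g (f j) k) v k)) \<in> null" by (intro Q.add_N)
  then show ?case using insert.hyps insert.prems
    by (subst lc_insert[OF P]) (auto simp: lin_def algebra_simps)
qed

text \<open>Comparison of the free resolution with a projective resolution \<open>P\<close> of finite length: there are
chain maps \<open>f\<close> to \<open>P\<close> and \<open>g\<close> back over the identity of the ideal. The composition \<open>\<theta> = g f\<close> vanishes
where \<open>P\<close> does, and \<open>split_of_homotopy\<close> applies. Since \<open>P\<close> resolves the ideal, \<open>P i\<close> belongs to the
free module on \<open>B (i + 1)\<close>.\<close>

lemma comparison_split:
  fixes P :: "nat \<Rightarrow> ('a, 'u) module"
  assumes ne: "\<one> \<noteq> \<zero>" and fin: "\<And>i. finite (B i)" and B0: "B 0 = {0}" and B1: "B 1 = C"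
    and \<phi>0: "\<phi> 0 = (row a)"
    and syz: "\<And>i. Q.syz (B i) (B (Suc i)) (B (Suc (Suc i))) (\<phi> i) (\<phi> (Suc i))"
    and res: "projective_resolution A (ideal_module A (Idl ((\<lambda>k. \<pi> (a k)) ` C))) P d \<epsilon>"
    and zero: "\<And>i. i > n \<Longrightarrow> carrier (P i) = {\<zero>\<^bsub>P i\<^esub>}"
  shows "split_map null {1} (B (Suc (Suc n))) (B (Suc (Suc (Suc n)))) (\<phi> (Suc (Suc n)))"
proof -
  let ?I = "ideal_module A (Idl ((\<lambda>k. \<pi> (a k)) ` C))"
  have C: "finite C" using fin[of 1] B1 by simp
  have proj: "projective_module A (P i)" and d: "d i \<in> mod_hom A (P (Suc i)) (P i)"
    and d_im: "d (Suc i) ` carrier (P (Suc (Suc i))) = a_kernel (P (Suc i)) (P i) (d i)" for i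
    using res unfolding projective_resolution_def by blast+
  have mI: "module A ?I" and \<epsilon>: "\<epsilon> \<in> mod_hom A (P 0) ?I" and \<epsilon>_im: "\<epsilon> ` carrier (P 0) = carrier ?I"
    and d0_im: "d 0 ` carrier (P (Suc 0)) = a_kernel (P 0) ?I \<epsilon>"
    using res unfolding projective_resolution_def by blast+
  have mP: "module A (P i)" for i using proj by (simp add: projective_module_def)
  have cI: "carrier ?I = {\<pi> (lin C (row a) v 0) |v. True}" "\<zero>\<^bsub>?I\<^esub> = \<zero>"
    unfolding lin_def Idl_eq[OF C, symmetric] by (simp_all add: ideal_module_def)
  \<comment> \<open>the cycles of \<open>P\<close>; those in degree \<open>0\<close> form the kernel of the augmentation\<close>
  define cyc where "cyc i x \<longleftrightarrow> (case i of 0 \<Rightarrow> \<epsilon> x = \<zero> | Suc m \<Rightarrow> d m x = \<zero>\<^bsub>P m\<^esub>)" for i x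
  have im: "d i ` carrier (P (Suc i)) = {x \<in> carrier (P i). cyc i x}" for i
    using d0_im d_im cI by (cases i) (auto simp: cyc_def a_kernel_def')
  have cyc: "\<exists>y\<in>carrier (P (Suc i)). d i y = x" if "x \<in> carrier (P i)" "cyc i x" for i x
    using that im[of i] by (metis (mono_tags, lifting) image_iff mem_Collect_eq)
  have cyc_d: "d i y \<in> carrier (P i) \<and> cyc i (d i y)" if "y \<in> carrier (P (Suc i))" for i y
    using that im[of i] by blast
  have \<phi>\<phi>: "bdry B \<phi> i (\<lambda>k. \<phi> (Suc i) k l) j \<in> null" if "j \<in> B i" "l \<in> B (Suc (Suc i))" for i j l
    using syz[of i] that by (simp add: Q.syz_def)
  \<comment> \<open>the chain map \<open>f\<close>, given by the images \<open>f i k\<close> of the basis vectors\<close>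
  define Pf where "Pf i f \<longleftrightarrow> f ` B (Suc i) \<subseteq> carrier (P i) \<and>
      (\<forall>l\<in>B (Suc (Suc i)). cyc i (lc (P i) f (B (Suc i)) (\<lambda>k. \<phi> (Suc i) k l))) \<and>
      (i = 0 \<longrightarrow> (\<forall>k\<in>C. \<epsilon> (f k) = \<pi> (a k)))" for i f
  define Qf where "Qf i f f' \<longleftrightarrow> (\<forall>l\<in>B (Suc (Suc i)). d i (f' l) = lc (P i) f (B (Suc i)) (\<lambda>k. \<phi> (Suc i) k l))"
    for i f f'
  have "\<exists>f. \<forall>i. Pf i (f i) \<and> Qf i (f i) (f (Suc i))"
  proof (rule dependent_nat_choice)
    have "\<forall>k\<in>C. \<exists>x\<in>carrier (P 0). \<epsilon> x = \<pi> (a k)"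
    proof
      fix k assume "k \<in> C"
      then have "\<pi> (a k) = \<pi> (lin C (row a) (\<lambda>j. if j = k then 1 else 0) 0)"
        using C by (simp add: Q.lin_unit)
      then have "\<pi> (a k) \<in> carrier ?I" unfolding cI(1) by blast
      then show "\<exists>x\<in>carrier (P 0). \<epsilon> x = \<pi> (a k)" using \<epsilon>_im by (metis imageE)
    qed
    then obtain f where f: "\<And>k. k \<in> C \<Longrightarrow> f k \<in> carrier (P 0) \<and> \<epsilon> (f k) = \<pi> (a k)" by metis
    have fC: "f ` C \<subseteq> carrier (P 0)" using f by auto
    have "\<epsilon> (lc (P 0) f C v) = \<pi> (lin C (row a) v 0)" for v
    proof -
      have "\<epsilon> (lc (P 0) f C v) = lc ?I (\<lambda>j. \<epsilon> (f j)) C v"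
        by (rule mod_hom_lc[OF mP mI \<epsilon> fC C])
      also have "\<dots> = \<pi> (\<Sum>j\<in>C. a j * v j)"
      proof (rule lc_ring[OF mI _ C])
        show "(\<lambda>j. \<epsilon> (f j)) ` C \<subseteq> Idl ((\<lambda>k. \<pi> (a k)) ` C)"
          using f A.genideal_self[of "(\<lambda>k. \<pi> (a k)) ` C"] by auto
      qed (use f in auto)
      finally show ?thesis by (simp add: lin_def)
    qed
    moreover have "\<pi> (lin C (row a) (\<lambda>k. \<phi> (Suc 0) k l) 0) = \<zero>" if "l \<in> B (Suc (Suc 0))" for l
      using \<phi>\<phi>[of 0 0 l] that B0 B1 \<phi>0 by (simp add: null_def)
    ultimately have "Pf 0 f"
      using f fC B1 by (auto simp: Pf_def cyc_def)
    then show "\<exists>f. Pf 0 f" by blast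
  next
    fix f i assume f: "Pf i f"
    then have fi: "f ` B (Suc i) \<subseteq> carrier (P i)" by (simp add: Pf_def)
    let ?x = "\<lambda>l. lc (P i) f (B (Suc i)) (\<lambda>k. \<phi> (Suc i) k l)"
    have "\<forall>l\<in>B (Suc (Suc i)). \<exists>y\<in>carrier (P (Suc i)). d i y = ?x l"
      using f by (auto simp: Pf_def intro!: cyc lc_closed[OF mP])
    then obtain f' where f': "\<And>l. l \<in> B (Suc (Suc i)) \<Longrightarrow> f' l \<in> carrier (P (Suc i)) \<and> d i (f' l) = ?x l"
      by metis
    have f'B: "f' ` B (Suc (Suc i)) \<subseteq> carrier (P (Suc i))" using f' by auto
    have "d i (lc (P (Suc i)) f' (B (Suc (Suc i))) (\<lambda>k. \<phi> (Suc (Suc i)) k l)) = \<zero>\<^bsub>P i\<^esub>"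
      if l: "l \<in> B (Suc (Suc (Suc i)))" for l
    proof -
      have "d i (lc (P (Suc i)) f' (B (Suc (Suc i))) (\<lambda>k. \<phi> (Suc (Suc i)) k l))
        = lc (P i) (\<lambda>q. d i (f' q)) (B (Suc (Suc i))) (\<lambda>k. \<phi> (Suc (Suc i)) k l)"
        by (rule mod_hom_lc[OF mP mP d f'B fin])
      also have "\<dots> = lc (P i) ?x (B (Suc (Suc i))) (\<lambda>k. \<phi> (Suc (Suc i)) k l)"
        by (rule lc_fcong[OF mP]) (use f' fi in \<open>auto intro: lc_closed[OF mP]\<close>)
      also have "\<dots> = lc (P i) f (B (Suc i)) (bdry B \<phi> (Suc i) (\<lambda>k. \<phi> (Suc (Suc i)) k l))"
        by (rule lc_lin[OF mP fi fin fin])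
      also have "\<dots> = \<zero>\<^bsub>P i\<^esub>"
        by (rule lc_null[OF mP fi]) (use \<phi>\<phi> l in auto)
      finally show ?thesis .
    qed
    then have "Pf (Suc i) f'" using f'B by (simp add: Pf_def cyc_def)
    then show "\<exists>f'. Pf (Suc i) f' \<and> Qf i f f'" using f' by (auto simp: Qf_def)
  qed
  then obtain f where Pf: "\<And>i. Pf i (f i)" and Qf: "\<And>i. Qf i (f i) (f (Suc i))" by blast
  have fB: "f i ` B (Suc i) \<subseteq> carrier (P i)" for i using Pf[of i] by (simp add: Pf_def)
  \<comment> \<open>the chain map \<open>g\<close>; the second clause of \<open>Pg\<close> allows the next step\<close>
  define Pg where "Pg i g \<longleftrightarrow> linear_mod (P i) g \<and>
      (\<forall>x\<in>carrier (P (Suc i)). \<forall>j\<in>B i. bdry B \<phi> i (g (d i x)) j \<in> null) \<and>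
      (i = 0 \<longrightarrow> (\<forall>x\<in>carrier (P 0). \<pi> (lin C (row a) (g x) 0) = \<epsilon> x))" for i g
  define Qg where "Qg i g g' \<longleftrightarrow> (\<forall>x\<in>carrier (P (Suc i)). \<forall>j\<in>B (Suc i).
      bdry B \<phi> (Suc i) (g' x) j - g (d i x) j \<in> null)" for i g g'
  have "\<exists>g. \<forall>i. Pg i (g i) \<and> Qg i (g i) (g (Suc i))"
  proof (rule dependent_nat_choice)
    obtain g where g: "linear_mod (P 0) g" "\<And>x. x \<in> carrier (P 0) \<Longrightarrow> \<pi> (lin C (row a) (g x) 0) = \<epsilon> x"
    proof (rule projective_selection[OF ne proj, of 0 "\<lambda>x v. \<pi> (lin C (row a) v 0) = \<epsilon> x"])
      fix x assume "x \<in> carrier (P 0)"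
      then have "\<epsilon> x \<in> carrier ?I" using \<epsilon> by (auto simp: mod_hom_def)
      then show "\<exists>v. \<pi> (lin C (row a) v 0) = \<epsilon> x" unfolding cI(1) by force
    next
      fix x y v w assume "x \<in> carrier (P 0)" "y \<in> carrier (P 0)"
        "\<pi> (lin C (row a) v 0) = \<epsilon> x" "\<pi> (lin C (row a) w 0) = \<epsilon> y"
      then show "\<pi> (lin C (row a) (\<lambda>k. v k + w k) 0) = \<epsilon> (x \<oplus>\<^bsub>P 0\<^esub> y)"
        using \<epsilon> by (simp add: lin_add \<pi>_add mod_hom_def) (simp add: ideal_module_def)
    next
      fix r x v assume "x \<in> carrier (P 0)" "\<pi> (lin C (row a) v 0) = \<epsilon> x"
      then show "\<pi> (lin C (row a) (\<lambda>k. r * v k) 0) = \<epsilon> (\<pi> r \<odot>\<^bsub>P 0\<^esub> x)"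
        using \<epsilon> by (simp add: lin_scale \<pi>_mult mod_hom_def) (simp add: ideal_module_def)
    qed blast
    have "bdry B \<phi> 0 (g (d 0 x)) j \<in> null" if "x \<in> carrier (P (Suc 0))" "j \<in> B 0" for x j
      using g(2)[of "d 0 x"] cyc_d[of x 0] that B0 B1 \<phi>0 by (simp add: null_def cyc_def)
    then have "Pg 0 g" using g by (simp add: Pg_def)
    then show "\<exists>g. Pg 0 g" by blast
  next
    fix g i assume "Pg i g"
    then have g: "linear_mod (P i) g"
      and gd: "\<And>x j. x \<in> carrier (P (Suc i)) \<Longrightarrow> j \<in> B i \<Longrightarrow> bdry B \<phi> i (g (d i x)) j \<in> null"
      by (auto simp: Pg_def)
    let ?R = "\<lambda>x v. \<forall>j\<in>B (Suc i). bdry B \<phi> (Suc i) v j - g (d i x) j \<in> null"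
    obtain g' where g': "linear_mod (P (Suc i)) g'" "\<And>x. x \<in> carrier (P (Suc i)) \<Longrightarrow> ?R x (g' x)"
    proof (rule projective_selection[OF ne proj, of "Suc i" ?R])
      fix x assume "x \<in> carrier (P (Suc i))"
      then obtain w where w: "\<forall>k\<in>B (Suc i). g (d i x) k - bdry B \<phi> (Suc i) w k \<in> null"
        using syz[of i] gd[of x] unfolding Q.syz_def by blast
      show "\<exists>v. ?R x v" using Q.uminus_N[OF w[rule_format]] by (intro exI[of _ w]) simp
    next
      fix x y v w assume x: "x \<in> carrier (P (Suc i))" and y: "y \<in> carrier (P (Suc i))"
        and v: "?R x v" and w: "?R y w"
      have dxy: "d i (x \<oplus>\<^bsub>P (Suc i)\<^esub> y) = d i x \<oplus>\<^bsub>P i\<^esub> d i y" using d[of i] x y by (simp add: mod_hom_def)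
      show "?R (x \<oplus>\<^bsub>P (Suc i)\<^esub> y) (\<lambda>k. v k + w k)"
      proof
        fix j assume j: "j \<in> B (Suc i)"
        have "g (d i x \<oplus>\<^bsub>P i\<^esub> d i y) j - (g (d i x) j + g (d i y) j) \<in> null"
          using g cyc_d[OF x] cyc_d[OF y] by (auto simp: linear_mod_def)
        from Q.diff_N[OF Q.add_N[OF v[rule_format, OF j] w[rule_format, OF j]] this]
        show "bdry B \<phi> (Suc i) (\<lambda>k. v k + w k) j - g (d i (x \<oplus>\<^bsub>P (Suc i)\<^esub> y)) j \<in> null"
          by (simp add: lin_add dxy algebra_simps)
      qed
    next
      fix r x v assume x: "x \<in> carrier (P (Suc i))" and v: "?R x v"
      have dx: "d i (\<pi> r \<odot>\<^bsub>P (Suc i)\<^esub> x) = \<pi> r \<odot>\<^bsub>P i\<^esub> d i x" using d[of i] x by (simp add: mod_hom_def)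
      show "?R (\<pi> r \<odot>\<^bsub>P (Suc i)\<^esub> x) (\<lambda>k. r * v k)"
      proof
        fix j assume j: "j \<in> B (Suc i)"
        have "g (\<pi> r \<odot>\<^bsub>P i\<^esub> d i x) j - r * g (d i x) j \<in> null"
          using g cyc_d[OF x] by (auto simp: linear_mod_def)
        from Q.diff_N[OF Q.mult_N[OF v[rule_format, OF j], of r] this]
        show "bdry B \<phi> (Suc i) (\<lambda>k. r * v k) j - g (d i (\<pi> r \<odot>\<^bsub>P (Suc i)\<^esub> x)) j \<in> null"
          unfolding lin_scale dx by (simp add: algebra_simps)
      qed
    qed blast
    have "bdry B \<phi> (Suc i) (g' (d (Suc i) x)) j \<in> null"
      if x: "x \<in> carrier (P (Suc (Suc i)))" and j: "j \<in> B (Suc i)" for x j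
    proof -
      have dx: "d (Suc i) x \<in> carrier (P (Suc i))" "d i (d (Suc i) x) = \<zero>\<^bsub>P i\<^esub>"
        using cyc_d[OF x] by (auto simp: cyc_def)
      show ?thesis
        using g'(2)[OF dx(1)] j linear_mod_zero[OF mP g, of j] Q.N_cong unfolding dx(2) by blast
    qed
    then have "Pg (Suc i) g'" using g' by (simp add: Pg_def)
    then show "\<exists>g'. Pg (Suc i) g' \<and> Qg i g g'" using g' by (auto simp: Qg_def)
  qed
  then obtain g where Pg: "\<And>i. Pg i (g i)" and Qg: "\<And>i. Qg i (g i) (g (Suc i))" by blast
  have g: "linear_mod (P i) (g i)" for i using Pg[of i] by (simp add: Pg_def)
  show ?thesis
  proof (rule Q.split_of_homotopy[of B \<phi> "\<lambda>i k l. g i (f i l) k" "Suc n"])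
    show "complex_upto null n B \<phi>" for n
      using \<phi>\<phi> by (simp add: complex_upto_def lin_def)
    show "acyclic_upto null {1} n B \<phi>" for n
      using syz by (simp add: acyclic_upto_def exact_at_def Q.syz_def)
    show "finite (B i)" for i by (rule fin)
    fix j l assume "j \<in> B 0" "l \<in> B 1"
    then have l: "l \<in> C" and j: "j = 0" using B0 B1 by simp_all
    then have "f 0 l \<in> carrier (P 0)" "\<epsilon> (f 0 l) = \<pi> (a l)"
      using Pf[of 0] fB[of 0] B1 unfolding Pf_def by auto
    then have "\<pi> (lin C (row a) (g 0 (f 0 l)) 0) = \<pi> (a l)"
      using Pg[of 0] unfolding Pg_def by metis
    with j show "lin (B 1) (\<phi> 0) (\<lambda>k. g 0 (f 0 l) k) j - \<phi> 0 j l \<in> null"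
      by (simp add: diff_in_null_iff B1[simplified] \<phi>0)
  next
    fix i j l assume j: "j \<in> B (Suc i)" and l: "l \<in> B (Suc (Suc i))"
    have fl: "f (Suc i) l \<in> carrier (P (Suc i))" using fB[of "Suc i"] l by auto
    have "bdry B \<phi> (Suc i) (g (Suc i) (f (Suc i) l)) j - g i (d i (f (Suc i) l)) j \<in> null"
      using Qg[of i] fl j by (simp add: Qg_def)
    moreover have "g i (d i (f (Suc i) l)) j
        - lin (B (Suc i)) (\<lambda>k l. g i (f i l) k) (\<lambda>k. \<phi> (Suc i) k l) j \<in> null"
      using linear_mod_lc[OF mP g fB fin] Qf[of i] l by (simp add: Qf_def)
    ultimately show "bdry B \<phi> (Suc i) (\<lambda>k. g (Suc i) (f (Suc i) l) k) j
        - lin (B (Suc i)) (\<lambda>k l. g i (f i l) k) (\<lambda>k. \<phi> (Suc i) k l) j \<in> null"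
      using Q.add_N by fastforce
  next
    fix j l assume "l \<in> B (Suc (Suc n))"
    then have "f (Suc n) l = \<zero>\<^bsub>P (Suc n)\<^esub>" using fB[of "Suc n"] zero[of "Suc n"] by auto
    then show "g (Suc n) (f (Suc n) l) j \<in> null" using linear_mod_zero[OF mP g] by simp
  qed
qed

section \<open>Relations between Frobenius powers\<close>

text \<open>The matrix \<open>K\<close> is the second map of a free resolution that starts with the row \<open>a\<close>. Far out this
resolution has a split map, so its \<open>p\<close>-th power is acyclic by \<open>frobenius_acyclic_split\<close>, in
particular at the first place.\<close>

lemma frobenius_row:
  assumes coh: "coherent_ring A" and reg: "regular_ring TYPE('u) A"
    and ne: "\<one> \<noteq> \<zero>" and p: "Factorial_Ring.prime p" "of_nat p \<in> null" and C: "finite C"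
  shows "\<exists>D K. finite D \<and> Q.syz {0::nat} C D (row a) K \<and> Q.syz {0::nat} C D (\<lambda>_ k. a k ^ p) (\<lambda>k l. K k l ^ p)"
proof -
  interpret localized_quotient_char null "{1}" p by unfold_locales (use p in auto)
  obtain B \<phi> where fin: "\<And>i. finite (B i)" and B: "B 0 = {0}" "B 1 = C" and \<phi>0: "\<phi> 0 = (row a)"
    and syz: "\<And>i. Q.syz (B i) (B (Suc i)) (B (Suc (Suc i))) (\<phi> i) (\<phi> (Suc i))"
    using free_resolution[OF coh C, of a] by metis
  have "fg_ideal A (Idl ((\<lambda>k. \<pi> (a k)) ` C))"
    unfolding fg_ideal_def using C by (intro exI[of _ "(\<lambda>k. \<pi> (a k)) ` C"]) auto
  then have "finite_projective_dimension TYPE('u) A (ideal_module A (Idl ((\<lambda>k. \<pi> (a k)) ` C)))"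
    using reg by (simp add: regular_ring_def)
  then obtain P :: "nat \<Rightarrow> ('a, 'u) module" and d \<epsilon> n where
    res: "projective_resolution A (ideal_module A (Idl ((\<lambda>k. \<pi> (a k)) ` C))) P d \<epsilon>"
    and zero: "\<And>i. i > n \<Longrightarrow> carrier (P i) = {\<zero>\<^bsub>P i\<^esub>}"
    unfolding finite_projective_dimension_def by blast
  have sp: "split_map null {1} (B (Suc (Suc n))) (B (Suc (Suc (Suc n)))) (\<phi> (Suc (Suc n)))"
    by (rule comparison_split[of B C \<phi> a P d \<epsilon> n]) (fact ne fin B \<phi>0 syz res zero)+
  have cx: "complex_upto null m B \<phi>" for m
    using syz by (simp add: complex_upto_def lin_def Q.syz_def)
  have ac: "acyclic_upto null {1} m B \<phi>" for m
    using syz by (simp add: acyclic_upto_def exact_at_def Q.syz_def)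
  have "acyclic_upto null {1} (Suc (Suc n)) B (\<lambda>m j k. \<phi> m j k ^ p)"
    by (rule frobenius_acyclic_split[OF localized_quotient_char_axioms cx fin ac sp])
  then have ex: "exact_at null {1} (B 0) (B 1) (B 2) (\<lambda>j k. \<phi> 0 j k ^ p) (\<lambda>j k. \<phi> 1 j k ^ p)"
    unfolding acyclic_upto_def by (metis One_nat_def numeral_2_eq_2 zero_less_Suc)
  have "complex_upto null 1 B (\<lambda>m j k. \<phi> m j k ^ p)" by (rule frobenius_complex[OF cx])
  then have "Q.syz {0::nat} C (B 2) (\<lambda>_ k. a k ^ p) (\<lambda>k l. \<phi> 1 k l ^ p)"
    using ex unfolding Q.syz_def exact_at_def complex_upto_def B \<phi>0
    by (simp add: B[simplified] \<phi>0 lin_def numeral_2_eq_2)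
  moreover have "Q.syz {0::nat} C (B 2) (row a) (\<phi> 1)"
    using syz[of 0] B \<phi>0 by (simp add: numeral_2_eq_2)
  ultimately show ?thesis using fin by blast
qed

end

context ideal_quotient
begin

text \<open>Any two generating systems of relations are combinations of each other. So if for one of them the
\<open>p\<close>-th powers generate all relations between the \<open>p\<close>-th powers, then this holds for every other.\<close>

lemma syz_power_transfer:
  assumes K: "syz Y C D M K" and L: "syz Y C E M L"
    and Lp: "syz Y C E (\<lambda>i k. M i k ^ p) (\<lambda>k l. L k l ^ p)" and p: "freshman p" "p > 0"
  shows "syz Y C D (\<lambda>i k. M i k ^ p) (\<lambda>k l. K k l ^ p)"
  unfolding syz_def
proof (intro conjI ballI allI impI)
  fix i l assume i: "i \<in> Y" and l: "l \<in> D"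
  have "lin C M (\<lambda>k. K k l) i ^ p \<in> N"
    using K i l pow_cong[of "lin C M (\<lambda>k. K k l) i" 0 p] p(2) by (simp add: syz_def zero_power)
  then show "lin C (\<lambda>i k. M i k ^ p) (\<lambda>k. K k l ^ p) i \<in> N"
    using N_cong[OF freshman_lin[OF p(1), of C M "\<lambda>k. K k l" i]] by simp
next
  fix z assume "\<forall>i\<in>Y. lin C (\<lambda>i k. M i k ^ p) z i \<in> N"
  then obtain w where w: "\<forall>k\<in>C. z k - lin E (\<lambda>k l. L k l ^ p) w k \<in> N"
    using Lp unfolding syz_def by blast
  have "\<forall>l\<in>E. \<exists>u. \<forall>k\<in>C. L k l - lin D K u k \<in> N"
  proof
    fix l assume "l \<in> E"
    then have "\<forall>i\<in>Y. lin C M (\<lambda>k. L k l) i \<in> N" using L by (simp add: syz_def)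
    then show "\<exists>u. \<forall>k\<in>C. L k l - lin D K u k \<in> N" using K unfolding syz_def by blast
  qed
  then obtain U where U: "\<And>l k. l \<in> E \<Longrightarrow> k \<in> C \<Longrightarrow> L k l - lin D K (U l) k \<in> N" by metis
  have "z k - lin D (\<lambda>k l. K k l ^ p) (lin E (\<lambda>m l. U l m ^ p) w) k \<in> N" if k: "k \<in> C" for k
  proof -
    have "lin E (\<lambda>k l. L k l ^ p) w k - lin D (\<lambda>k l. K k l ^ p) (lin E (\<lambda>m l. U l m ^ p) w) k
        = (\<Sum>l\<in>E. (L k l ^ p - lin D (\<lambda>k l. K k l ^ p) (\<lambda>m. U l m ^ p) k) * w l)"
      unfolding lin_lin_columns by (simp add: lin_def left_diff_distrib sum_subtractf)
    also have "\<dots> \<in> N"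
    proof (intro sum_N mult_N_right)
      fix l assume l: "l \<in> E"
      from add_N[OF pow_cong[OF U[OF l k], of p] freshman_lin[OF p(1), of D K "U l" k]]
      show "L k l ^ p - lin D (\<lambda>k l. K k l ^ p) (\<lambda>m. U l m ^ p) k \<in> N" by simp
    qed
    finally show ?thesis using add_N[OF w[rule_format, OF k]] by fastforce
  qed
  then show "\<exists>w. \<forall>k\<in>C. z k - lin D (\<lambda>k l. K k l ^ p) w k \<in> N" by blast
qed

end

context ring_presentation
begin

lemma freshman_power:
  assumes p: "Factorial_Ring.prime p" "of_nat p \<in> null"
  shows "Q.freshman (p ^ e)"
proof (induction e)
  case 0
  show ?case using Q.freshman_1 by simp
next
  case (Suc e)
  interpret localized_quotient_char null "{1}" p by unfold_locales (use p in auto)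
  show ?case unfolding Q.freshman_def
  proof (intro allI)
    fix I :: "nat set" and f :: "nat \<Rightarrow> 'r"
    have "((\<Sum>i\<in>I. f i) ^ p ^ e) ^ p - (\<Sum>i\<in>I. f i ^ p ^ e) ^ p \<in> null"
      using Suc unfolding Q.freshman_def by (intro Q.pow_cong) blast
    from Q.add_N[OF this freshman_sum[of "\<lambda>i. f i ^ p ^ e" I]]
    show "(\<Sum>i\<in>I. f i) ^ p ^ Suc e - (\<Sum>i\<in>I. f i ^ p ^ Suc e) \<in> null"
      by (simp add: power_mult[symmetric] mult.commute)
  qed
qed

text \<open>The equational form of flatness of all powers of the Frobenius map. A fixed matrix \<open>K\<close> serves for
all \<open>e\<close>: its \<open>p\<^sup>e\<close>-th power generates the relations between the \<open>p\<^sup>e\<close>-th powers of a row, so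
\<open>frobenius_row\<close> for that row and \<open>syz_power_transfer\<close> lead from \<open>e\<close> to \<open>e + 1\<close>.\<close>

theorem frobenius_syzygies:
  assumes coh: "coherent_ring A" and reg: "regular_ring TYPE('u) A"
    and ne: "\<one> \<noteq> \<zero>" and p: "Factorial_Ring.prime p" "of_nat p \<in> null"
    and Y: "finite Y" and C: "finite C"
  shows "\<exists>D K. finite D \<and> (\<forall>e. Q.syz Y C D (\<lambda>i k. M i k ^ p ^ e) (\<lambda>k l. K k l ^ p ^ e))"
proof -
  have one: "\<exists>D K. finite D \<and>
      (\<forall>q\<in>range ((^) p). Q.syz {0::nat} C D (\<lambda>_ k. a k ^ q) (\<lambda>k l. K k l ^ q))"
    if C: "finite C" for C a
  proof -
    obtain D K where D: "finite D" and K: "Q.syz {0::nat} C D (row a) K"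
      using coherent_row[OF coh C] by blast
    have "Q.syz {0::nat} C D (\<lambda>_ k. a k ^ p ^ e) (\<lambda>k l. K k l ^ p ^ e)" for e
    proof (induction e)
      case 0
      show ?case using K by simp
    next
      case (Suc e)
      obtain E L where L: "Q.syz {0::nat} C E (\<lambda>_ k. a k ^ p ^ e) L"
        "Q.syz {0::nat} C E (\<lambda>_ k. (a k ^ p ^ e) ^ p) (\<lambda>k l. L k l ^ p)"
        using frobenius_row[OF coh reg ne p C, of "\<lambda>k. a k ^ p ^ e"] by blast
      have "p > 0" using p(1) prime_gt_0_nat by blast
      then have "Q.syz {0::nat} C D (\<lambda>_ k. (a k ^ p ^ e) ^ p) (\<lambda>k l. (K k l ^ p ^ e) ^ p)"
        using Q.syz_power_transfer[OF Suc L] freshman_power[OF p, of 1] by simp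
      then show ?case by (simp add: power_mult[symmetric] mult.commute)
    qed
    then show ?thesis using D by (intro exI[of _ D] exI[of _ K]) auto
  qed
  have "\<exists>D K. finite D \<and> (\<forall>q\<in>range ((^) p). Q.syz Y C D (\<lambda>i k. M i k ^ q) (\<lambda>k l. K k l ^ q))"
    by (rule Q.syz_rows[OF one _ Y C]) (use freshman_power[OF p] in auto)
  then show ?thesis by auto
qed

end

section \<open>Existence of presentations\<close>

text \<open>Elements outside the carrier are skipped. This makes the function commute with itself on the whole
type, as the fold over a multiset requires.\<close>

definition fold_mult :: "('a, 'k) ring_scheme \<Rightarrow> 'a \<Rightarrow> 'a \<Rightarrow> 'a"
  where "fold_mult A x y = (if x \<in> carrier A \<and> y \<in> carrier A then x \<otimes>\<^bsub>A\<^esub> y else y)"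

definition monomial :: "('a, 'k) ring_scheme \<Rightarrow> 'a multiset \<Rightarrow> 'a"
  where "monomial A = fold_mset (fold_mult A) \<one>\<^bsub>A\<^esub>"

context cring
begin

lemma monomial_closed [simp]: "monomial R M \<in> carrier R"
  and monomial_add_mset: "monomial R (add_mset x M) = (if x \<in> carrier R then x \<otimes> monomial R M else monomial R M)"
  and monomial_empty [simp]: "monomial R {#} = \<one>"
proof -
  interpret comp_fun_commute "fold_mult R"
    by unfold_locales (auto simp: fold_mult_def fun_eq_iff m_lcomm)
  have rec: "monomial R (add_mset x M) = fold_mult R x (monomial R M)" for x M
    by (simp add: monomial_def)
  show "monomial R {#} = \<one>" by (simp add: monomial_def)
  then have closed: "monomial R M \<in> carrier R" for M
    by (induction M) (auto simp: rec fold_mult_def)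
  then show "monomial R M \<in> carrier R" .
  show "monomial R (add_mset x M) = (if x \<in> carrier R then x \<otimes> monomial R M else monomial R M)"
    by (simp add: rec fold_mult_def closed)
qed

lemma monomial_union: "monomial R (M + M') = monomial R M \<otimes> monomial R M'"
  by (induction M) (auto simp: monomial_add_mset m_assoc)

end

text \<open>The ring is a quotient of the polynomial ring over the integers in which every element of \<open>A\<close> is a
variable. A monomial is a multiset of variables, and a polynomial is an element of the free abelian
group on the monomials.\<close>

lemma exists_presentation:
  fixes A :: "('a, 'k) ring_scheme"
  assumes "cring A"
  obtains \<pi> :: "('a multiset \<Rightarrow>\<^sub>0 int) \<Rightarrow> 'a" where "ring_presentation A \<pi>"
proof -
  interpret A: cring A by fact
  obtain h where h: "h \<in> hom (free_Abelian_group UNIV) (add_monoid A)"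
    and h_of: "\<And>m. m \<in> UNIV \<Longrightarrow> h (frag_of m) = monomial A m"
    by (rule A.add.free_Abelian_group_universal[of "monomial A" UNIV]) auto
  have closed: "h c \<in> carrier A" for c
    using h by (auto simp: hom_def)
  have add: "h (c + d) = h c \<oplus>\<^bsub>A\<^esub> h d" for c d
    using h by (auto simp: hom_def)
  have zero: "h 0 = \<zero>\<^bsub>A\<^esub>"
    using add[of 0 0] closed[of 0] A.add.r_cancel_one'[of "h 0" "h 0"] by simp
  have uminus: "h (- c) = \<ominus>\<^bsub>A\<^esub> h c" for c
    using add[of "- c" c] closed zero by (simp add: A.minus_equality)
  have diff: "h (c - d) = h c \<ominus>\<^bsub>A\<^esub> h d" for c d
    using add[of c "- d"] by (simp add: uminus A.minus_eq)
  have mult: "h (c * d) = h c \<otimes>\<^bsub>A\<^esub> h d" for c d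
  proof (rule frag_induction[of c UNIV "\<lambda>c. h (c * d) = h c \<otimes>\<^bsub>A\<^esub> h d"])
    fix m :: "'a multiset"
    show "h (frag_of m * d) = h (frag_of m) \<otimes>\<^bsub>A\<^esub> h d"
    proof (rule frag_induction[of d UNIV "\<lambda>d. h (frag_of m * d) = h (frag_of m) \<otimes>\<^bsub>A\<^esub> h d"])
      show "h (frag_of m * frag_of m') = h (frag_of m) \<otimes>\<^bsub>A\<^esub> h (frag_of m')" for m'
        using h_of[of "m + m'"] by (simp add: mult_single h_of A.monomial_union)
    qed (auto simp: zero closed right_diff_distrib diff A.r_minus A.r_distr A.minus_eq)
  qed (auto simp: zero closed left_diff_distrib diff A.l_minus A.l_distr A.minus_eq)
  have "ring_presentation A h"
  proof
    show "h 1 = \<one>\<^bsub>A\<^esub>" using h_of[of "{#}"] by (simp add: zero_multiset_def[symmetric])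
    show "\<exists>x. h x = a" if "a \<in> carrier A" for a
      using h_of[of "{#a#}"] that by (intro exI[of _ "frag_of {#a#}"]) (simp add: A.monomial_add_mset)
  qed (auto simp: closed add mult)
  then show ?thesis by (rule that)
qed

lemma (in ring_presentation) \<pi>_of_nat: "\<pi> (of_nat n) = \<one>\<^bsub>A\<^esub> [^]\<^bsub>add_monoid A\<^esub> n"
proof (induction n)
  case (Suc n)
  have "\<pi> (of_nat (Suc n)) = \<pi> (of_nat n + 1)" by (simp add: add.commute)
  then show ?case by (simp add: \<pi>_add \<pi>_one Suc del: of_nat_Suc)
qed simp

section \<open>The tensor product with the Frobenius module\<close>

locale frobenius_ring = ring_presentation A \<pi>
  for A :: "('a, 'k) ring_scheme" (structure) and \<pi> :: "'r::comm_ring_1 \<Rightarrow> 'a" +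
  fixes p :: nat
  assumes p_prime: "Factorial_Ring.prime p" and p_null: "of_nat p \<in> null"
begin

sublocale P: localized_quotient_char null "{1}" p
  by unfold_locales (use p_prime p_null in auto)

abbreviation F :: "'a \<Rightarrow> 'a" where "F \<equiv> frobenius A p"

lemma F_\<pi>: "F (\<pi> x) = \<pi> (x ^ p)"
  by (simp add: frobenius_def \<pi>_power)

lemma F_hom: "F \<in> ring_hom A A"
proof (rule ring_hom_memI)
  show "F x \<in> carrier A" if "x \<in> carrier A" for x using that by (simp add: frobenius_def)
  show "F (x \<otimes> y) = F x \<otimes> F y" if "x \<in> carrier A" "y \<in> carrier A" for x y
    using that by (simp add: frobenius_def A.nat_pow_distrib)
  show "F (x \<oplus> y) = F x \<oplus> F y" if xy: "x \<in> carrier A" "y \<in> carrier A" for x y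
  proof -
    obtain x' y' where "x = \<pi> x'" "y = \<pi> y'" using \<pi>_surj xy by metis
    moreover have "\<pi> ((x' + y') ^ p) = \<pi> (x' ^ p + y' ^ p)"
      using P.freshman_add diff_in_null_iff by blast
    ultimately show ?thesis by (simp add: F_\<pi> \<pi>_add[symmetric])
  qed
  show "F \<one> = \<one>" by (simp add: frobenius_def)
qed

abbreviation FA :: "('a, 'a) module" where "FA \<equiv> restrict_scalars F A"

lemma module_FA: "module A FA"
proof (rule moduleI)
  show "abelian_group FA"
    by (rule abelian_groupI)
      (auto simp: restrict_scalars_def A.a_assoc A.a_comm A.a_lcomm intro!: bexI[of _ "\<ominus> _"] A.l_neg)
qed (use F_hom in \<open>auto simp: restrict_scalars_def ring_hom_def A.cring_axioms A.l_distr A.r_distr A.m_assoc Pi_def\<close>)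

end

text \<open>The tensor product of \<open>N\<close> with the ring, seen as a module over itself by the Frobenius map, is the
free abelian group \<open>G\<close> modulo \<open>T\<close>.\<close>

locale frobenius_tensor = frobenius_ring A \<pi> p + N?: module A N
  for A :: "('a, 'k) ring_scheme" (structure) and \<pi> :: "'r::comm_ring_1 \<Rightarrow> 'a" and p
    and N :: "('a, 'n) module"
begin

abbreviation T where "T \<equiv> tensor_kernel A FA N"
abbreviation G where "G \<equiv> free_Abelian_group (carrier A \<times> carrier N)"

lemma FA_simps [simp]: "carrier FA = carrier A" "x \<oplus>\<^bsub>FA\<^esub> y = x \<oplus> y" "a \<odot>\<^bsub>FA\<^esub> x = F a \<otimes> x"
  by (simp_all add: restrict_scalars_def)

lemma F_closed [simp]: "a \<in> carrier A \<Longrightarrow> F a \<in> carrier A"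
  using F_hom by (auto simp: ring_hom_def)

lemma relations_carrier: "tensor_relations A FA N \<subseteq> carrier G"
  unfolding tensor_relations_def carrier_free_Abelian_group_iff
  by (auto dest!: subsetD[OF keys_diff])

lemma T_subgroup: "subgroup T G"
proof -
  interpret G: comm_group G by (rule abelian_free_Abelian_group)
  show ?thesis unfolding tensor_kernel_def FA_simps
    by (rule G.generate_is_subgroup[OF relations_carrier])
qed

lemma T_carrier: "x \<in> T \<Longrightarrow> Poly_Mapping.keys x \<subseteq> carrier A \<times> carrier N"
  using subgroup.subset[OF T_subgroup] by (auto simp: free_Abelian_group_def)

lemma T_zero: "0 \<in> T" using subgroup.one_closed[OF T_subgroup] by simp

lemma T_add: "x \<in> T \<Longrightarrow> y \<in> T \<Longrightarrow> x + y \<in> T"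
  using subgroup.m_closed[OF T_subgroup] by simp

lemma T_uminus: "x \<in> T \<Longrightarrow> - x \<in> T"
  using subgroup.m_inv_closed[OF T_subgroup, of x] T_carrier[of x] by simp

lemma T_diff: "x \<in> T \<Longrightarrow> y \<in> T \<Longrightarrow> x - y \<in> T"
  using T_add[of x "- y"] T_uminus[of y] by simp

lemma T_sum: "(\<And>i. i \<in> I \<Longrightarrow> f i \<in> T) \<Longrightarrow> sum f I \<in> T"
  by (induction I rule: infinite_finite_induct) (auto intro: T_zero T_add)

lemma T_rel: "z \<in> tensor_relations A FA N \<Longrightarrow> z \<in> T"
  unfolding tensor_kernel_def by (rule generate.incl)

lemma T_left: "x \<in> carrier A \<Longrightarrow> x' \<in> carrier A \<Longrightarrow> y \<in> carrier N \<Longrightarrow>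
    frag_of (x \<oplus> x', y) - frag_of (x, y) - frag_of (x', y) \<in> T"
  by (rule T_rel) (fastforce simp: tensor_relations_def)

lemma T_right: "x \<in> carrier A \<Longrightarrow> y \<in> carrier N \<Longrightarrow> y' \<in> carrier N \<Longrightarrow>
    frag_of (x, y \<oplus>\<^bsub>N\<^esub> y') - frag_of (x, y) - frag_of (x, y') \<in> T"
  by (rule T_rel) (fastforce simp: tensor_relations_def)

lemma T_middle: "a \<in> carrier A \<Longrightarrow> x \<in> carrier A \<Longrightarrow> y \<in> carrier N \<Longrightarrow>
    frag_of (F a \<otimes> x, y) - frag_of (x, a \<odot>\<^bsub>N\<^esub> y) \<in> T"
  by (rule T_rel) (fastforce simp: tensor_relations_def)

lemma T_zero_left: "y \<in> carrier N \<Longrightarrow> frag_of (\<zero>, y) \<in> T"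
  using T_uminus[OF T_left[of "\<zero>" "\<zero>" y]] by simp

lemma T_zero_right: "x \<in> carrier A \<Longrightarrow> frag_of (x, \<zero>\<^bsub>N\<^esub>) \<in> T"
  using T_uminus[OF T_right[of x "\<zero>\<^bsub>N\<^esub>" "\<zero>\<^bsub>N\<^esub>"]] by simp

lemma T_diff_left: "y \<in> carrier N \<Longrightarrow> frag_of (\<pi> (u - v), y) - frag_of (\<pi> u, y) + frag_of (\<pi> v, y) \<in> T"
  using T_uminus[OF T_left[of "\<pi> (u - v)" "\<pi> v" y]]
  by (simp add: \<pi>_add[symmetric]) (simp add: algebra_simps)

lemma T_sum_left:
  "finite D \<Longrightarrow> y \<in> carrier N \<Longrightarrow> frag_of (\<pi> (\<Sum>d\<in>D. v d), y) - (\<Sum>d\<in>D. frag_of (\<pi> (v d), y)) \<in> T"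
proof (induction D rule: finite_induct)
  case (insert d D)
  from T_add[OF T_left[of "\<pi> (v d)" "\<pi> (\<Sum>d\<in>D. v d)" y] insert.IH] insert
  show ?case by (simp add: \<pi>_add algebra_simps)
qed (simp add: T_zero_left)

lemma T_lc_right:
  assumes "finite D" "D \<subseteq> carrier N" "x \<in> carrier A"
  shows "frag_of (x, lc N (\<lambda>u. u) D v) - (\<Sum>m\<in>D. frag_of (x, \<pi> (v m) \<odot>\<^bsub>N\<^esub> m)) \<in> T"
  using assms(1,2)
proof (induction D rule: finite_induct)
  case empty
  show ?case using assms T_zero_right by (simp add: lc_empty[OF N.module_axioms])
next
  case (insert d D)
  have 1: "\<pi> (v d) \<odot>\<^bsub>N\<^esub> d \<in> carrier N" "lc N (\<lambda>u. u) D v \<in> carrier N"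
    using insert lc_closed[OF N.module_axioms, of "\<lambda>u. u" D] by auto
  have eq: "lc N (\<lambda>u. u) (insert d D) v = \<pi> (v d) \<odot>\<^bsub>N\<^esub> d \<oplus>\<^bsub>N\<^esub> lc N (\<lambda>u. u) D v"
    by (rule lc_insert[OF N.module_axioms]) (use insert in auto)
  have IH: "frag_of (x, lc N (\<lambda>u. u) D v) - (\<Sum>m\<in>D. frag_of (x, \<pi> (v m) \<odot>\<^bsub>N\<^esub> m)) \<in> T"
    by (rule insert.IH) (use insert.prems in simp)
  from T_add[OF T_right[OF assms(3) 1] IH]
  show ?case unfolding eq using insert.hyps by (simp add: algebra_simps)
qed

text \<open>The coordinate at \<open>n\<close> of the image of \<open>z\<close> in the direct sum of copies of the ring indexed by the
elements of \<open>N\<close>, where \<open>(b, m)\<close> is sent to \<open>b\<close> at the place \<open>m\<close>.\<close>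

definition coord :: "('a \<times> 'n \<Rightarrow>\<^sub>0 int) \<Rightarrow> 'n \<Rightarrow> 'r"
  where "coord z n = (\<Sum>\<kappa>\<in>Poly_Mapping.keys z. of_int (Poly_Mapping.lookup z \<kappa>) * (if snd \<kappa> = n then lift (fst \<kappa>) else 0))"

lemma coord_superset:
  "finite D \<Longrightarrow> Poly_Mapping.keys z \<subseteq> D \<Longrightarrow>
    coord z n = (\<Sum>\<kappa>\<in>D. of_int (Poly_Mapping.lookup z \<kappa>) * (if snd \<kappa> = n then lift (fst \<kappa>) else 0))"
  unfolding coord_def by (rule sum.mono_neutral_left) (auto simp: in_keys_iff)

lemma coord_diff: "coord (z - w) n = coord z n - coord w n"
proof -
  let ?D = "Poly_Mapping.keys z \<union> Poly_Mapping.keys w"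
  have "finite ?D" "Poly_Mapping.keys (z - w) \<subseteq> ?D" by (auto dest: subsetD[OF keys_diff])
  then show ?thesis
    by (subst (1 2 3) coord_superset[of ?D]) (auto simp: lookup_minus sum_subtractf left_diff_distrib)
qed

lemma coord_zero: "coord 0 n = 0"
  by (simp add: coord_def)

lemma coord_of: "coord (frag_of (b, m)) n = (if m = n then lift b else 0)"
  by (simp add: coord_def)

text \<open>Modulo \<open>T\<close> an element is determined by its coordinates, since \<open>T\<close> makes pairs additive in the first
argument.\<close>

lemma coord_normal_form:
  assumes D: "finite D" "D \<subseteq> carrier N" and z: "Poly_Mapping.keys z \<subseteq> carrier A \<times> D"
  shows "z - (\<Sum>n\<in>D. frag_of (\<pi> (coord z n), n)) \<in> T"
  using z
proof (induction z rule: frag_induction)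
  case zero
  then show ?case using D by (auto simp: coord_zero intro!: T_uminus T_sum T_zero_left)
next
  case (one \<kappa>)
  then obtain b m where bm: "\<kappa> = (b, m)" "b \<in> carrier A" "m \<in> D" by auto
  have "(\<Sum>n\<in>D. frag_of (\<pi> (coord (frag_of \<kappa>) n), n)) =
      frag_of (b, m) + (\<Sum>n\<in>D - {m}. frag_of (\<pi> (coord (frag_of \<kappa>) n), n))"
    using D bm by (subst sum.remove[of D m]) (simp_all add: coord_of)
  also have "(\<Sum>n\<in>D - {m}. frag_of (\<pi> (coord (frag_of \<kappa>) n), n)) = (\<Sum>n\<in>D - {m}. frag_of (\<zero>, n))"
    by (rule sum.cong) (auto simp: coord_of bm)
  finally have "(\<Sum>n\<in>D. frag_of (\<pi> (coord (frag_of \<kappa>) n), n)) =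
      frag_of (b, m) + (\<Sum>n\<in>D - {m}. frag_of (\<zero>, n))" .
  moreover have "(\<Sum>n\<in>D - {m}. frag_of (\<zero>, n)) \<in> T"
    using D by (intro T_sum T_zero_left) auto
  ultimately show ?case using T_uminus by (simp add: bm(1))
next
  case (diff y z)
  have "(\<Sum>n\<in>D. frag_of (\<pi> (coord y n - coord z n), n) - frag_of (\<pi> (coord y n), n) + frag_of (\<pi> (coord z n), n)) \<in> T"
    using D by (intro T_sum T_diff_left) auto
  from T_diff[OF T_diff[OF diff] this] show ?case
    by (simp add: coord_diff sum.distrib sum_subtractf algebra_simps)
qed

lemma lc_uminus: "D \<subseteq> carrier N \<Longrightarrow> finite D \<Longrightarrow> lc N (\<lambda>u. u) D (\<lambda>u. - v u) = \<ominus>\<^bsub>N\<^esub> lc N (\<lambda>u. u) D v"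
  using lc_scale[OF N.module_axioms, of "\<lambda>u. u" D "-1" v] lc_closed[OF N.module_axioms, of "\<lambda>u. u" D v]
  by (simp add: \<pi>_uminus \<pi>_one N.smult_l_minus)

definition is_relation :: "'n set \<Rightarrow> ('n \<Rightarrow> 'r) \<Rightarrow> bool"
  where "is_relation D \<alpha> \<longleftrightarrow> (\<forall>y. y \<notin> D \<longrightarrow> \<alpha> y = 0) \<and> lc N (\<lambda>u. u) D \<alpha> = \<zero>\<^bsub>N\<^esub>"

lemma is_relation_mono:
  assumes "is_relation D \<alpha>" "D \<subseteq> E" "finite E" "E \<subseteq> carrier N"
  shows "is_relation E \<alpha>"
proof -
  have "lc N (\<lambda>u. u) E \<alpha> = lc N (\<lambda>u. u) D \<alpha>"
    by (rule lc_superset[OF N.module_axioms]) (use assms Q.zero_N in \<open>auto simp: is_relation_def\<close>)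
  then show ?thesis using assms by (auto simp: is_relation_def)
qed

text \<open>The tensor product is the direct sum of copies of the ring indexed by \<open>N\<close>, modulo the vectors
\<open>y \<mapsto> \<alpha> y ^ p * c\<close> for the linear relations \<open>\<alpha>\<close> between elements of \<open>N\<close>. The condition says that the
coordinates of \<open>z\<close> form a combination of such vectors.\<close>

definition relation_form :: "('a \<times> 'n \<Rightarrow>\<^sub>0 int) \<Rightarrow> bool"
  where "relation_form z \<longleftrightarrow> (\<exists>D (k :: nat) c \<alpha>. finite D \<and> D \<subseteq> carrier N \<and> (\<forall>l<k. is_relation D (\<alpha> l)) \<and>
    (\<forall>y. coord z y - (\<Sum>l<k. \<alpha> l y ^ p * c l) \<in> null))"

lemma relation_form_uminus:
  assumes "relation_form z"
  shows "relation_form (- z)"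
proof -
  obtain D and k :: nat and c \<alpha> where D: "finite D" "D \<subseteq> carrier N" and \<alpha>: "\<forall>l<k. is_relation D (\<alpha> l)"
    and eq: "\<And>y. coord z y - (\<Sum>l<k. \<alpha> l y ^ p * c l) \<in> null"
    using assms unfolding relation_form_def by blast
  have "coord (- z) y - (\<Sum>l<k. \<alpha> l y ^ p * - c l) \<in> null" for y
    using Q.uminus_N[OF eq[of y]] coord_diff[of 0 z y] by (simp add: coord_zero sum_negf)
  then show ?thesis unfolding relation_form_def using D \<alpha>
    by (intro exI[of _ D] exI[of _ k] exI[of _ "\<lambda>l. - c l"] exI[of _ \<alpha>]) auto
qed

lemma relation_form_add:
  assumes "relation_form z" "relation_form w"
  shows "relation_form (z + w)"
proof -
  obtain D and k :: nat and c \<alpha> where D: "finite D" "D \<subseteq> carrier N" and \<alpha>: "\<And>l. l < k \<Longrightarrow> is_relation D (\<alpha> l)"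
    and eq: "\<And>y. coord z y - (\<Sum>l<k. \<alpha> l y ^ p * c l) \<in> null"
    using assms(1) unfolding relation_form_def by blast
  obtain E and m :: nat and e \<beta> where E: "finite E" "E \<subseteq> carrier N" and \<beta>: "\<And>l. l < m \<Longrightarrow> is_relation E (\<beta> l)"
    and eq': "\<And>y. coord w y - (\<Sum>l<m. \<beta> l y ^ p * e l) \<in> null"
    using assms(2) unfolding relation_form_def by blast
  define \<gamma> where "\<gamma> l = (if l < k then \<alpha> l else \<beta> (l - k))" for l
  define g where "g l = (if l < k then c l else e (l - k))" for l
  have sum: "(\<Sum>l<k + m. \<gamma> l y ^ p * g l) = (\<Sum>l<k. \<alpha> l y ^ p * c l) + (\<Sum>l<m. \<beta> l y ^ p * e l)" for y
  proof -
    have "{..<k + m} = {..<k} \<union> (\<lambda>l. k + l) ` {..<m}"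
    proof -
      have "x \<in> (\<lambda>l. k + l) ` {..<m}" if "\<not> x < k" "x < k + m" for x
        using that by (intro image_eqI[of _ _ "x - k"]) auto
      then show ?thesis by auto
    qed
    then have "(\<Sum>l<k + m. \<gamma> l y ^ p * g l)
        = (\<Sum>l<k. \<gamma> l y ^ p * g l) + (\<Sum>l\<in>(\<lambda>l. k + l) ` {..<m}. \<gamma> l y ^ p * g l)"
      by (simp only:) (rule sum.union_disjoint, auto)
    then show ?thesis by (subst (asm) sum.reindex) (auto simp: \<gamma>_def g_def)
  qed
  have "coord (z + w) y - (\<Sum>l<k + m. \<gamma> l y ^ p * g l) \<in> null" for y
  proof -
    have c: "coord (z + w) y = coord z y + coord w y"
      using coord_diff[of z "- w" y] coord_diff[of 0 w y] by (simp add: coord_zero)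
    have "coord (z + w) y - (\<Sum>l<k + m. \<gamma> l y ^ p * g l)
        = (coord z y - (\<Sum>l<k. \<alpha> l y ^ p * c l)) + (coord w y - (\<Sum>l<m. \<beta> l y ^ p * e l))"
      unfolding c sum by simp
    then show ?thesis using Q.add_N[OF eq[of y] eq'[of y]] by (simp only:)
  qed
  moreover have "is_relation (D \<union> E) (\<gamma> l)" if "l < k + m" for l
    using is_relation_mono[OF \<alpha>[of l], of "D \<union> E"] is_relation_mono[OF \<beta>[of "l - k"], of "D \<union> E"] that D E
    by (auto simp: \<gamma>_def)
  ultimately show ?thesis unfolding relation_form_def using D E
    by (intro exI[of _ "D \<union> E"] exI[of _ "k + m"] exI[of _ g] exI[of _ \<gamma>]) auto
qed

lemma relation_form_trivial:
  assumes "\<And>y. coord z y \<in> null"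
  shows "relation_form z"
  unfolding relation_form_def using assms
  by (intro exI[of _ "{}"] exI[of _ 0]) auto

lemma relation_form_single:
  assumes D: "finite D" "D \<subseteq> carrier N" and "is_relation D \<alpha>"
    and "\<And>y. coord z y - \<alpha> y ^ p * c \<in> null"
  shows "relation_form z"
  unfolding relation_form_def using assms
  by (intro exI[of _ D] exI[of _ 1] exI[of _ "\<lambda>_. c"] exI[of _ "\<lambda>_. \<alpha>"]) auto

definition \<delta> :: "'n \<Rightarrow> 'n \<Rightarrow> 'r" where "\<delta> x y = (if y = x then 1 else 0)"

lemma \<delta>_pow: "\<delta> x y ^ p = \<delta> x y"
  using P.p_pos by (simp add: \<delta>_def zero_power)

lemma coord_of_\<delta>: "coord (frag_of (b, m)) n = \<delta> m n * lift b"
  by (auto simp: coord_of \<delta>_def)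

lemma lc_\<delta>: "finite D \<Longrightarrow> x \<in> D \<Longrightarrow> D \<subseteq> carrier N \<Longrightarrow> lc N (\<lambda>u. u) D (\<delta> x) = x"
  using lc_single[OF N.module_axioms, of D x "\<lambda>u. u"] by (simp add: \<delta>_def[abs_def])

lemma lc_diff: "D \<subseteq> carrier N \<Longrightarrow> finite D \<Longrightarrow>
    lc N (\<lambda>u. u) D (\<lambda>y. v y - w y) = lc N (\<lambda>u. u) D v \<ominus>\<^bsub>N\<^esub> lc N (\<lambda>u. u) D w"
  using lc_add[OF N.module_axioms, of "\<lambda>u. u" D v "\<lambda>u. - w u"] lc_uminus[of D w]
  by (simp add: N.M.minus_eq)

text \<open>Additivity in the first argument gives the zero vector. Additivity in the second argument comes
from the relation \<open>(y + y') - y - y' = 0\<close>, and the exchange of scalars from \<open>a * y - (a y) = 0\<close>.\<close>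

lemma relation_form_relations:
  assumes "z \<in> tensor_relations A FA N"
  shows "relation_form z"
proof -
  consider
    (left) x x' y where "z = frag_of (x \<oplus> x', y) - frag_of (x, y) - frag_of (x', y)"
      "x \<in> carrier A" "x' \<in> carrier A" "y \<in> carrier N"
  | (right) x y y' where "z = frag_of (x, y \<oplus>\<^bsub>N\<^esub> y') - frag_of (x, y) - frag_of (x, y')"
      "x \<in> carrier A" "y \<in> carrier N" "y' \<in> carrier N"
  | (middle) a x y where "z = frag_of (F a \<otimes> x, y) - frag_of (x, a \<odot>\<^bsub>N\<^esub> y)"
      "a \<in> carrier A" "x \<in> carrier A" "y \<in> carrier N"
    using assms unfolding tensor_relations_def by (auto simp: FA_simps)
  then show ?thesis
  proof cases
    case left
    have "lift (x \<oplus> x') - (lift x + lift x') \<in> null"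
      unfolding diff_in_null_iff using left by (simp add: \<pi>_add)
    then have "lift (x \<oplus> x') - lift x - lift x' \<in> null" by (simp only: diff_diff_eq)
    then show ?thesis
      using Q.zero_N by (intro relation_form_trivial) (auto simp: left(1) coord_diff coord_of)
  next
    case right
    let ?s = "y \<oplus>\<^bsub>N\<^esub> y'"
    let ?D = "{?s, y, y'}" and ?\<alpha> = "\<lambda>u. \<delta> ?s u - \<delta> y u - \<delta> y' u"
    have D: "finite ?D" "?D \<subseteq> carrier N" using right by auto
    show ?thesis
    proof (rule relation_form_single[OF D])
      have "lc N (\<lambda>u. u) ?D ?\<alpha> = ?s \<ominus>\<^bsub>N\<^esub> y \<ominus>\<^bsub>N\<^esub> y'"
        using D by (simp only: lc_diff lc_\<delta> insertI1 insertI2)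
      also have "\<dots> = \<zero>\<^bsub>N\<^esub>"
        using right N.M.add.inv_solve_right
        by (simp add: N.M.minus_eq N.M.a_ac N.M.r_neg N.M.r_neg1 N.M.r_neg2)
      finally show "is_relation ?D ?\<alpha>" by (auto simp: is_relation_def \<delta>_def)
      fix u
      have "?\<alpha> u ^ p - ?\<alpha> u \<in> null"
      proof -
        have "?\<alpha> u ^ p - ((\<delta> ?s u - \<delta> y u) ^ p - \<delta> y' u ^ p) \<in> null" by (rule P.freshman_diff)
        from Q.add_N[OF this P.freshman_diff[of "\<delta> ?s u" "\<delta> y u"]] show ?thesis
          by (simp add: \<delta>_pow algebra_simps)
      qed
      then have 1: "- ((?\<alpha> u ^ p - ?\<alpha> u) * lift x) \<in> null" by (intro Q.uminus_N Q.mult_N_right)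
      have eq: "coord z u = ?\<alpha> u * lift x"
        unfolding right(1) coord_diff coord_of_\<delta> by (simp add: algebra_simps)
      have "coord z u - ?\<alpha> u ^ p * lift x = - ((?\<alpha> u ^ p - ?\<alpha> u) * lift x)"
        unfolding eq by (simp only: left_diff_distrib minus_diff_eq)
      then show "coord z u - ?\<alpha> u ^ p * lift x \<in> null" using 1 by (simp only:)
    qed
  next
    case middle
    let ?s = "a \<odot>\<^bsub>N\<^esub> y"
    let ?D = "{?s, y}" and ?\<alpha> = "\<lambda>u. lift a * \<delta> y u - \<delta> ?s u"
    have D: "finite ?D" "?D \<subseteq> carrier N" using middle by auto
    show ?thesis
    proof (rule relation_form_single[OF D])
      have "lc N (\<lambda>u. u) ?D ?\<alpha> = \<pi> (lift a) \<odot>\<^bsub>N\<^esub> y \<ominus>\<^bsub>N\<^esub> ?s"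
      proof -
        have img: "(\<lambda>u. u) ` ?D \<subseteq> carrier N" using D by simp
        have "lc N (\<lambda>u. u) ?D (\<lambda>u. lift a * \<delta> y u) = \<pi> (lift a) \<odot>\<^bsub>N\<^esub> lc N (\<lambda>u. u) ?D (\<delta> y)"
          by (rule lc_scale[OF N.module_axioms img D(1)])
        then show ?thesis using D by (simp only: lc_diff lc_\<delta> insertI1 insertI2)
      qed
      also have "\<dots> = \<zero>\<^bsub>N\<^esub>" using middle by (simp add: N.M.minus_eq N.M.r_neg)
      finally show "is_relation ?D ?\<alpha>" by (auto simp: is_relation_def \<delta>_def)
      fix u
      have "?\<alpha> u ^ p - (lift a ^ p * \<delta> y u - \<delta> ?s u) \<in> null"
        using P.freshman_diff[of "lift a * \<delta> y u" "\<delta> ?s u"] by (simp add: power_mult_distrib \<delta>_pow)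
      then have 1: "(?\<alpha> u ^ p - (lift a ^ p * \<delta> y u - \<delta> ?s u)) * lift x \<in> null" by (rule Q.mult_N_right)
      have "lift (F a \<otimes> x) - lift a ^ p * lift x \<in> null"
        using middle by (simp add: diff_in_null_iff \<pi>_mult F_\<pi>[symmetric])
      then have 2: "(lift (F a \<otimes> x) - lift a ^ p * lift x) * \<delta> y u \<in> null" by (rule Q.mult_N_right)
      have eq: "coord z u = lift (F a \<otimes> x) * \<delta> y u - lift x * \<delta> ?s u"
        unfolding middle(1) coord_diff coord_of_\<delta> by (simp add: algebra_simps)
      have "coord z u - ?\<alpha> u ^ p * lift x = (lift (F a \<otimes> x) - lift a ^ p * lift x) * \<delta> y u
          - (?\<alpha> u ^ p - (lift a ^ p * \<delta> y u - \<delta> ?s u)) * lift x"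
        unfolding eq by (simp add: algebra_simps)
      then show "coord z u - ?\<alpha> u ^ p * lift x \<in> null" using Q.diff_N[OF 2 1] by (simp only:)
    qed
  qed
qed

lemma relation_form_T:
  assumes "z \<in> T"
  shows "relation_form z"
  using assms unfolding tensor_kernel_def FA_simps
proof (induction z rule: generate.induct)
  case one
  show ?case using Q.zero_N by (intro relation_form_trivial) (simp add: coord_zero)
next
  case (incl h)
  then show ?case by (rule relation_form_relations)
next
  case (inv h)
  then have "Poly_Mapping.keys h \<subseteq> carrier A \<times> carrier N"
    using relations_carrier by (auto simp: free_Abelian_group_def)
  then show ?case using relation_form_uminus[OF relation_form_relations[OF inv]] by simp
next
  case (eng h1 h2)
  then show ?case using relation_form_add by simp
qed

end

section \<open>Flatness of the Frobenius map\<close>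

context frobenius_ring
begin

text \<open>By \<open>relation_form_T\<close>, the coordinates of the image of \<open>z\<close> are \<open>\<Sum> \<alpha> l y ^ p * c l\<close> with relations
\<open>\<alpha> l\<close> between elements of \<open>N'\<close>. At the places \<open>y\<close> outside the image of \<open>f\<close> they are zero, so \<open>c\<close> is a
relation between the \<open>p\<close>-th powers of the coefficients \<open>\<alpha> l y\<close>, and \<open>frobenius_syzygies\<close> gives
\<open>c l = \<Sum> K l d ^ p * v d\<close>. This replaces the relations \<open>\<alpha> l\<close> by \<open>\<beta> d = \<Sum> \<alpha> l * K l d\<close>, which involve
only elements of the image. As \<open>f\<close> is injective, the \<open>\<beta> d\<close> are relations between elements of \<open>N\<close>, and
they show that \<open>z\<close> is zero in the tensor product with \<open>N\<close>.\<close>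

lemma frobenius_tensor_injective:
  fixes N N' :: "('a, 'n) module"
  assumes coh: "coherent_ring A" and reg: "regular_ring TYPE('u) A" and ne: "\<one> \<noteq> \<zero>"
    and N: "module A N" and N': "module A N'" and f: "f \<in> mod_hom A N N'" and inj: "inj_on f (carrier N)"
    and z: "Poly_Mapping.keys z \<subseteq> carrier A \<times> carrier N"
    and fz: "frag_extend (\<lambda>(x, y). frag_of (x, f y)) z \<in> tensor_kernel A FA N'"
  shows "z \<in> tensor_kernel A FA N"
proof -
  interpret I: frobenius_tensor A \<pi> p N by (rule frobenius_tensor.intro[OF frobenius_ring_axioms N])
  interpret I': frobenius_tensor A \<pi> p N' by (rule frobenius_tensor.intro[OF frobenius_ring_axioms N'])
  define w where "w = frag_extend (\<lambda>(x, y). frag_of (x, f y)) z"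
  have fN: "f m \<in> carrier N'" if "m \<in> carrier N" for m using f that by (auto simp: mod_hom_def)
  have coord: "(\<forall>m\<in>carrier N. I'.coord (frag_extend (\<lambda>(x, y). frag_of (x, f y)) z) (f m) = I.coord z m) \<and>
      (\<forall>y. y \<notin> f ` carrier N \<longrightarrow> I'.coord (frag_extend (\<lambda>(x, y). frag_of (x, f y)) z) y = 0)"
    using z
  proof (induction z rule: frag_induction)
    case zero
    show ?case by (simp add: I.coord_zero I'.coord_zero)
  next
    case (one \<kappa>)
    then obtain b m where "\<kappa> = (b, m)" "m \<in> carrier N" by auto
    then show ?case using inj by (auto simp: I.coord_of I'.coord_of inj_on_def)
  next
    case (diff y z)
    then show ?case by (simp add: frag_extend_diff I.coord_diff I'.coord_diff)
  qed
  obtain D and k :: nat and c \<alpha> where D: "finite D" "D \<subseteq> carrier N'"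
    and \<alpha>: "\<And>l. l < k \<Longrightarrow> I'.is_relation D (\<alpha> l)"
    and eq: "\<And>y. I'.coord w y - (\<Sum>l<k. \<alpha> l y ^ p * c l) \<in> null"
    using I'.relation_form_T[OF fz] unfolding I'.relation_form_def w_def by blast
  define M where "M = (\<lambda>y l. \<alpha> l y)"
  define Y where "Y = D - f ` carrier N"
  have Y: "finite Y" using D by (simp add: Y_def)
  obtain E K where E: "finite E" and K: "\<And>e. Q.syz Y {..<k} E (\<lambda>i k. M i k ^ p ^ e) (\<lambda>k l. K k l ^ p ^ e)"
    using frobenius_syzygies[OF coh reg ne p_prime p_null Y finite_lessThan, of k M] by blast
  have "lin {..<k} (\<lambda>i k. M i k ^ p ^ 1) c y \<in> null" if "y \<in> Y" for y
  proof -
    have "I'.coord w y = 0" using coord that by (simp add: w_def Y_def)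
    then show ?thesis using Q.uminus_N[OF eq[of y]] by (simp add: lin_def M_def)
  qed
  then have "\<exists>v. \<forall>l\<in>{..<k}. c l - lin E (\<lambda>k l. K k l ^ p ^ 1) v l \<in> null"
    using K[of 1] unfolding Q.syz_def by blast
  then obtain v where v: "\<And>l. l < k \<Longrightarrow> c l - lin E (\<lambda>k l. K k l ^ p) v l \<in> null"
    unfolding power_one_right lessThan_iff Ball_def by blast
  define \<beta> where "\<beta> d = lin {..<k} M (\<lambda>l. K l d)" for d
  have \<beta>Y: "\<beta> d y \<in> null" if "d \<in> E" "y \<in> Y" for d y
    using K[of 0] that by (simp add: Q.syz_def \<beta>_def)
  have idD: "(\<lambda>u. u) ` D \<subseteq> carrier N'" using D by simp
  have \<beta>_rel: "lc N' (\<lambda>u. u) D (\<beta> d) = \<zero>\<^bsub>N'\<^esub>" for d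
  proof -
    have "lc N' (\<lambda>u. u) D (\<beta> d) = lc N' (\<lambda>l. lc N' (\<lambda>u. u) D (\<lambda>y. M y l)) {..<k} (\<lambda>l. K l d)"
      unfolding \<beta>_def by (rule lc_lin[OF N' idD D(1) finite_lessThan, symmetric])
    also have "\<dots> = lc N' (\<lambda>l. \<zero>\<^bsub>N'\<^esub>) {..<k} (\<lambda>l. K l d)"
      by (rule lc_fcong[OF N']) (use \<alpha> in \<open>auto simp: I'.is_relation_def M_def\<close>)
    also have "\<dots> = \<zero>\<^bsub>N'\<^esub>"
      unfolding lc_def by (rule I'.N.M.add.finprod_one_eqI) simp
    finally show ?thesis .
  qed
  define D1 where "D1 = {m \<in> carrier N. f m \<in> D}"
  have fD1: "f ` D1 = D \<inter> f ` carrier N" by (auto simp: D1_def)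
  have injD1: "inj_on f D1" by (rule inj_on_subset[OF inj]) (auto simp: D1_def)
  have D1: "finite D1" "D1 \<subseteq> carrier N"
    using finite_imageD[OF _ injD1] D fD1 by (auto simp: D1_def)
  have f0: "f \<zero>\<^bsub>N\<^esub> = \<zero>\<^bsub>N'\<^esub>" by (rule mod_hom_zero[OF N N' f])
  have \<beta>N: "lc N (\<lambda>u. u) D1 (\<lambda>m. \<beta> d (f m)) = \<zero>\<^bsub>N\<^esub>" if d: "d \<in> E" for d
  proof -
    have sub: "(\<lambda>u. u) ` D1 \<subseteq> carrier N" using D1 by simp
    have "f (lc N (\<lambda>u. u) D1 (\<lambda>m. \<beta> d (f m))) = lc N' f D1 (\<lambda>m. \<beta> d (f m))"
      by (rule mod_hom_lc[OF N N' f sub D1(1)])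
    also have "\<dots> = lc N' (\<lambda>u. u) (f ` D1) (\<beta> d)"
      unfolding lc_def by (rule I'.N.M.add.finprod_reindex[OF _ injD1, symmetric]) (use D1 fN in auto)
    also have "\<dots> = lc N' (\<lambda>u. u) D (\<beta> d)"
      by (rule lc_superset[OF N' D(1) _ idD, symmetric]) (use fD1 \<beta>Y[OF d] in \<open>auto simp: Y_def\<close>)
    finally have "f (lc N (\<lambda>u. u) D1 (\<lambda>m. \<beta> d (f m))) = f \<zero>\<^bsub>N\<^esub>" by (simp add: \<beta>_rel f0)
    then show ?thesis
      using inj lc_closed[OF N sub] I.N.M.zero_closed unfolding inj_on_def by blast
  qed
  define D2 where "D2 = D1 \<union> snd ` Poly_Mapping.keys z"
  have D2: "finite D2" "D2 \<subseteq> carrier N" using D1 z by (auto simp: D2_def)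
  have \<beta>N2: "lc N (\<lambda>u. u) D2 (\<lambda>m. \<beta> d (f m)) = \<zero>\<^bsub>N\<^esub>" if d: "d \<in> E" for d
  proof -
    have \<beta>0: "\<beta> d (f m) = 0" if "m \<in> D2 - D1" for m
    proof -
      have "f m \<notin> D" using that D2 by (auto simp: D1_def)
      then show ?thesis using \<alpha> by (simp add: \<beta>_def lin_def M_def I'.is_relation_def)
    qed
    have "lc N (\<lambda>u. u) D2 (\<lambda>m. \<beta> d (f m)) = lc N (\<lambda>u. u) D1 (\<lambda>m. \<beta> d (f m))"
    proof (rule lc_superset[OF N D2(1)])
      show "D1 \<subseteq> D2" by (simp add: D2_def)
      show "(\<lambda>u. u) ` D2 \<subseteq> carrier N" using D2 by simp
      show "\<beta> d (f m) \<in> null" if "m \<in> D2 - D1" for m using \<beta>0[OF that] Q.zero_N by simp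
    qed
    then show ?thesis using \<beta>N[OF d] by simp
  qed
  have \<beta>_coord: "\<pi> (I.coord z m) = \<pi> (\<Sum>d\<in>E. \<beta> d (f m) ^ p * v d)" if m: "m \<in> carrier N" for m
  proof -
    let ?y = "f m"
    have 1: "I.coord z m - (\<Sum>l<k. \<alpha> l ?y ^ p * c l) \<in> null"
      using eq[of ?y] coord m by (simp add: w_def)
    have 2: "(\<Sum>l<k. \<alpha> l ?y ^ p * c l) - (\<Sum>l<k. \<alpha> l ?y ^ p * lin E (\<lambda>k l. K k l ^ p) v l) \<in> null"
      unfolding sum_subtractf[symmetric] right_diff_distrib[symmetric]
      by (intro Q.sum_N Q.mult_N) (use v in auto)
    have "(\<Sum>l<k. \<alpha> l ?y ^ p * lin E (\<lambda>k l. K k l ^ p) v l)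
        = lin {..<k} (\<lambda>y l. M y l ^ p) (lin E (\<lambda>k l. K k l ^ p) v) ?y"
      by (simp add: lin_def M_def)
    also have "\<dots> = (\<Sum>d\<in>E. lin {..<k} (\<lambda>y l. M y l ^ p) (\<lambda>l. K l d ^ p) ?y * v d)"
      by (rule lin_lin_columns)
    finally have "(\<Sum>l<k. \<alpha> l ?y ^ p * lin E (\<lambda>k l. K k l ^ p) v l) - (\<Sum>d\<in>E. \<beta> d ?y ^ p * v d)
        = - (\<Sum>d\<in>E. (\<beta> d ?y ^ p - lin {..<k} (\<lambda>y l. M y l ^ p) (\<lambda>l. K l d ^ p) ?y) * v d)"
      by (simp add: left_diff_distrib sum_subtractf)
    also have "\<dots> \<in> null"
      unfolding \<beta>_def using freshman_power[OF p_prime p_null, of 1]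
      by (intro Q.uminus_N Q.sum_N Q.mult_N_right Q.freshman_lin) simp
    finally have 3: "(\<Sum>l<k. \<alpha> l ?y ^ p * lin E (\<lambda>k l. K k l ^ p) v l) - (\<Sum>d\<in>E. \<beta> d ?y ^ p * v d) \<in> null" .
    show ?thesis using Q.add_N[OF Q.add_N[OF 1 2] 3] by (simp add: diff_in_null_iff)
  qed
  have "z - (\<Sum>m\<in>D2. frag_of (\<pi> (I.coord z m), m)) \<in> I.T"
  proof (rule I.coord_normal_form[OF D2])
    show "Poly_Mapping.keys z \<subseteq> carrier A \<times> D2" using z by (force simp: D2_def)
  qed
  moreover have "(\<Sum>m\<in>D2. frag_of (\<pi> (I.coord z m), m)) \<in> I.T"
  proof -
    have 1: "(\<Sum>m\<in>D2. frag_of (\<pi> (I.coord z m), m) - (\<Sum>d\<in>E. frag_of (\<pi> (\<beta> d (f m) ^ p * v d), m))) \<in> I.T"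
      using D2 \<beta>_coord E by (intro I.T_sum) (auto intro!: I.T_sum_left)
    have 2: "(\<Sum>m\<in>D2. \<Sum>d\<in>E. frag_of (\<pi> (\<beta> d (f m) ^ p * v d), m)
        - frag_of (\<pi> (v d), \<pi> (\<beta> d (f m)) \<odot>\<^bsub>N\<^esub> m)) \<in> I.T"
    proof (intro I.T_sum)
      fix m d assume "m \<in> D2" "d \<in> E"
      then show "frag_of (\<pi> (\<beta> d (f m) ^ p * v d), m) - frag_of (\<pi> (v d), \<pi> (\<beta> d (f m)) \<odot>\<^bsub>N\<^esub> m) \<in> I.T"
        using I.T_middle[of "\<pi> (\<beta> d (f m))" "\<pi> (v d)" m] D2 by (auto simp: F_\<pi> \<pi>_mult)
    qed
    have "(\<Sum>m\<in>D2. frag_of (\<pi> (v d), \<pi> (\<beta> d (f m)) \<odot>\<^bsub>N\<^esub> m)) \<in> I.T" if d: "d \<in> E" for d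
    proof -
      have "frag_of (\<pi> (v d), \<zero>\<^bsub>N\<^esub>) - (\<Sum>m\<in>D2. frag_of (\<pi> (v d), \<pi> (\<beta> d (f m)) \<odot>\<^bsub>N\<^esub> m)) \<in> I.T"
        using I.T_lc_right[OF D2, of "\<pi> (v d)" "\<lambda>m. \<beta> d (f m)"] \<beta>N2[OF d] by simp
      from I.T_diff[OF I.T_zero_right[OF \<pi>_closed[of "v d"]] this] show ?thesis by simp
    qed
    then have 3: "(\<Sum>m\<in>D2. \<Sum>d\<in>E. frag_of (\<pi> (v d), \<pi> (\<beta> d (f m)) \<odot>\<^bsub>N\<^esub> m)) \<in> I.T"
      by (subst sum.swap) (rule I.T_sum)
    show ?thesis using I.T_add[OF I.T_add[OF 1 2] 3] by (simp add: sum_subtractf)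
  qed
  ultimately have "(z - (\<Sum>m\<in>D2. frag_of (\<pi> (I.coord z m), m))) + (\<Sum>m\<in>D2. frag_of (\<pi> (I.coord z m), m)) \<in> I.T"
    by (rule I.T_add)
  then show ?thesis by simp
qed

text \<open>What remains is the passage from elements to the cosets that make up the tensor product.\<close>

theorem frobenius_flat:
  assumes coh: "coherent_ring A" and reg: "regular_ring TYPE('u) A" and ne: "\<one> \<noteq> \<zero>"
  shows "flat_ring_hom TYPE('n) A A F"
  unfolding flat_ring_hom_def flat_module_def
proof (intro conjI allI impI)
  show "F \<in> ring_hom A A" by (rule F_hom)
  show "module A FA" by (rule module_FA)
  fix N N' :: "('a, 'n) module" and f
  assume N: "module A N" and N': "module A N'" and f: "f \<in> mod_hom A N N'" and inj: "inj_on f (carrier N)"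
  interpret I: frobenius_tensor A \<pi> p N by (rule frobenius_tensor.intro[OF frobenius_ring_axioms N])
  interpret I': frobenius_tensor A \<pi> p N' by (rule frobenius_tensor.intro[OF frobenius_ring_axioms N'])
  let ?f = "frag_extend (\<lambda>(x, y). frag_of (x, f y))"
  have coset: "\<exists>z\<in>carrier I.G. Z = {h + z |h. h \<in> I.T}" if "Z \<in> carrier (tensor_product A FA N)" for Z
    using that unfolding tensor_product_def FactGroup_def RCOSETS_def r_coset_def by auto
  have map: "tensor_map A FA N' f Z = {h + ?f z |h z. h \<in> I'.T \<and> z \<in> Z}" for Z
    unfolding tensor_map_def r_coset_def by auto
  show "inj_on (tensor_map A FA N' f) (carrier (tensor_product A FA N))"
  proof (rule inj_onI)
    fix Z1 Z2
    assume "Z1 \<in> carrier (tensor_product A FA N)" "Z2 \<in> carrier (tensor_product A FA N)"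
      and eq: "tensor_map A FA N' f Z1 = tensor_map A FA N' f Z2"
    then obtain z1 z2 where z1: "z1 \<in> carrier I.G" "Z1 = {h + z1 |h. h \<in> I.T}"
      and z2: "z2 \<in> carrier I.G" "Z2 = {h + z2 |h. h \<in> I.T}"
      using coset by meson
    have "0 + z1 \<in> Z1" unfolding z1(2) using I.T_zero by blast
    then have "0 + ?f (0 + z1) \<in> tensor_map A FA N' f Z1" unfolding map using I'.T_zero by blast
    then have "0 + ?f (0 + z1) \<in> tensor_map A FA N' f Z2" by (simp only: eq)
    then obtain h z' where h: "h \<in> I'.T" and z': "z' \<in> Z2" and hz': "0 + ?f (0 + z1) = h + ?f z'"
      unfolding map by blast
    obtain k where k: "k \<in> I.T" "z' = k + z2" using z' unfolding z2(2) by blast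
    have fh: "?f (z1 - (k + z2)) = h" using hz' by (simp add: frag_extend_diff k(2))
    have kz: "Poly_Mapping.keys (k + z2) \<subseteq> carrier A \<times> carrier N"
      using keys_add[of k z2] I.T_carrier[OF k(1)] z2(1) by auto
    then have "Poly_Mapping.keys (z1 - (k + z2)) \<subseteq> carrier A \<times> carrier N"
      using keys_diff[of z1 "k + z2"] z1(1) by auto
    then have "z1 - (k + z2) \<in> I.T"
      using frobenius_tensor_injective[OF coh reg ne N N' f inj] fh h by simp
    from I.T_add[OF this k(1)] have d: "z1 - z2 \<in> I.T" by simp
    show "Z1 = Z2" unfolding z1(2) z2(2)
    proof (intro equalityI subsetI)
      fix u assume "u \<in> {h + z1 |h. h \<in> I.T}"
      then obtain h where h: "h \<in> I.T" "u = h + z1" by blast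
      show "u \<in> {h + z2 |h. h \<in> I.T}"
        by (intro CollectI exI[of _ "h + (z1 - z2)"]) (simp add: h I.T_add[OF h(1) d])
    next
      fix u assume "u \<in> {h + z2 |h. h \<in> I.T}"
      then obtain h where h: "h \<in> I.T" "u = h + z2" by blast
      show "u \<in> {h + z1 |h. h \<in> I.T}"
        by (intro CollectI exI[of _ "h - (z1 - z2)"]) (simp add: h I.T_diff[OF h(1) d])
    qed
  qed
qed

section \<open>Tight closure in the presence of a value map\<close>

lemma exists_real_lower_bound:
  assumes "finite D" "\<And>d. d \<in> D \<Longrightarrow> (0::ereal) < g d"
  shows "\<exists>b>0. \<forall>d\<in>D. ereal b \<le> g d"
  using assms
proof (induction D rule: finite_induct)
  case empty
  show ?case by (intro exI[of _ 1]) simp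
next
  case (insert d D)
  then obtain b where b: "b > 0" "\<forall>d\<in>D. ereal b \<le> g d" by auto
  have "\<exists>b'>0. ereal b' \<le> g d"
    using insert.prems[of d] by (cases "g d") (auto intro: exI[of _ 1])
  then obtain b' where b': "b' > 0" "ereal b' \<le> g d" by blast
  have "ereal (min b b') \<le> g e" if "e \<in> insert d D" for e
    using that b(2) b'(2) by (auto intro: order_trans[of _ "ereal b"] order_trans[of _ "ereal b'"])
  then show ?case using b(1) b'(1) by (intro exI[of _ "min b b'"]) auto
qed

text \<open>Suppose that \<open>c * x\<^sup>q\<close> lies in the \<open>q\<close>-th bracket power of \<open>I\<close> for all large \<open>q\<close>. This is a relation
between the \<open>q\<close>-th powers of \<open>x\<close> and of the generators of \<open>I\<close>. By \<open>frobenius_syzygies\<close> its first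
coefficient \<open>c\<close> is a combination of the \<open>q\<close>-th powers of elements \<open>K 0 d\<close> that do not depend on \<open>q\<close>
and that multiply \<open>x\<close> into \<open>I\<close>. If \<open>x\<close> is not in \<open>I\<close>, then these elements are not units, so their
values are at least some \<open>b > 0\<close>, and the value of \<open>c\<close> is at least \<open>q * b\<close> for all large \<open>q\<close>. So \<open>c\<close>
is zero. But the value map makes \<open>A\<close> a domain, whose only minimal prime is zero.\<close>

theorem tight_closure_fg_ideal:
  assumes coh: "coherent_ring A" and reg: "regular_ring TYPE('u) A" and ne: "\<one> \<noteq> \<zero>"
    and v: "normalized_value_map A v" and I: "fg_ideal A I"
  shows "tight_closure A p I = I"
proof -
  have v_mult: "v (a \<otimes> b) = v a + v b" and v_add: "min (v a) (v b) \<le> v (a \<oplus> b)"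
    if "a \<in> carrier A" "b \<in> carrier A" for a b
    using v that by (auto simp: normalized_value_map_def value_map_def)
  have v_inf: "v a = \<infinity> \<longleftrightarrow> a = \<zero>" and v_nonneg: "0 \<le> v a" and v_minf: "v a \<noteq> -\<infinity>" if "a \<in> carrier A" for a
    using v that by (auto simp: normalized_value_map_def value_map_def)
  have v_pos: "0 < v a" if "a \<in> carrier A" "a \<notin> Units A" for a
    using v that by (auto simp: normalized_value_map_def)
  have v_pow: "ereal (real n * b) \<le> v (a [^] n)" if a: "a \<in> carrier A" and b: "ereal b \<le> v a" for a b and n :: nat
  proof (induction n)
    case 0
    show ?case using v_nonneg[of "\<one>"] by (simp add: zero_ereal_def[symmetric])
  next
    case (Suc n)
    have "ereal (real (Suc n) * b) = ereal (real n * b) + ereal b" by (simp add: algebra_simps)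
    also have "\<dots> \<le> v (a [^] n) + v a" by (intro add_mono Suc b)
    finally show ?case using a by (simp add: v_mult)
  qed
  have v_sum: "b \<le> v (\<pi> (\<Sum>d\<in>D. g d))" if "finite D" "\<And>d. d \<in> D \<Longrightarrow> b \<le> v (\<pi> (g d))" for b D and g :: "nat \<Rightarrow> 'r"
    using that
  proof (induction D rule: finite_induct)
    case empty
    show ?case using v_inf[of "\<zero>"] by simp
  next
    case (insert d D)
    have "b \<le> min (v (\<pi> (g d))) (v (\<pi> (\<Sum>d\<in>D. g d)))" using insert by auto
    also have "\<dots> \<le> v (\<pi> (g d) \<oplus> \<pi> (\<Sum>d\<in>D. g d))" by (rule v_add) auto
    finally show ?case using insert.hyps by (simp add: \<pi>_add)
  qed
  have dom: "domain A"
  proof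
    show "\<one> \<noteq> \<zero>" by (rule ne)
    show "a = \<zero> \<or> b = \<zero>" if "a \<otimes> b = \<zero>" "a \<in> carrier A" "b \<in> carrier A" for a b
    proof -
      have "v a + v b = \<infinity>" using that v_mult[of a b] v_inf[of "\<zero>"] by simp
      then have "v a = \<infinity> \<or> v b = \<infinity>" by simp
      then show ?thesis using that v_inf by blast
    qed
  qed
  have zero_minimal: "minimal_prime A {\<zero>}"
    unfolding minimal_prime_def
  proof (intro conjI allI impI)
    show "primeideal {\<zero>} A" by (rule domain.zeroprimeideal[OF dom])
    fix J assume "primeideal J A" "J \<subseteq> {\<zero>}"
    then interpret primeideal J A by simp
    show "J = {\<zero>}" using \<open>J \<subseteq> {\<zero>}\<close> zero_closed by auto
  qed
  obtain S where S: "finite S" "S \<subseteq> carrier A" and IS: "I = Idl S"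
    using I unfolding fg_ideal_def by blast
  interpret Id: ideal I A unfolding IS by (rule A.genideal_ideal[OF S(2)])
  obtain xs where xs: "set xs = S" using finite_list[OF S(1)] by blast
  define n where "n = length xs"
  define a where "a k = lift (xs ! k)" for k
  have S_eq: "(\<lambda>k. \<pi> (a k)) ` {..<n} = S"
  proof -
    have "(\<lambda>k. \<pi> (a k)) ` {..<n} = (\<lambda>k. xs ! k) ` {..<n}"
    proof (rule image_cong[OF refl])
      fix k assume "k \<in> {..<n}"
      then have "xs ! k \<in> carrier A" using S(2) nth_mem[of k xs] unfolding xs[symmetric] n_def by blast
      then show "\<pi> (a k) = xs ! k" by (simp add: a_def)
    qed
    also have "\<dots> = S" unfolding xs[symmetric] n_def by (auto simp: in_set_conv_nth)
    finally show ?thesis .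
  qed
  have I_eq: "I = {\<pi> (\<Sum>k<n. a k * u k) |u. True}"
    using Idl_eq[OF finite_lessThan, of a n] unfolding S_eq IS by simp
  have bracket: "bracket_power A I (p ^ e) \<subseteq> {\<pi> (\<Sum>k<n. a k ^ p ^ e * u k) |u. True}" for e
  proof -
    have img: "(\<lambda>k. \<pi> (a k ^ p ^ e)) ` {..<n} \<subseteq> carrier A" by auto
    have "(\<lambda>x. x [^] (p ^ e)) ` I \<subseteq> {\<pi> (\<Sum>k<n. a k ^ p ^ e * u k) |u. True}"
    proof
      fix y assume "y \<in> (\<lambda>x. x [^] (p ^ e)) ` I"
      then obtain u where y: "y = \<pi> (\<Sum>k<n. a k * u k) [^] (p ^ e)" unfolding I_eq by blast
      have "\<pi> ((\<Sum>k<n. a k * u k) ^ p ^ e) = \<pi> (\<Sum>k<n. (a k * u k) ^ p ^ e)"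
        using freshman_power[OF p_prime p_null, of e] unfolding Q.freshman_def
        by (simp add: diff_in_null_iff)
      then have "y = \<pi> (\<Sum>k<n. a k ^ p ^ e * u k ^ p ^ e)" by (simp add: y \<pi>_power[symmetric] power_mult_distrib)
      then show "y \<in> {\<pi> (\<Sum>k<n. a k ^ p ^ e * u k) |u. True}" by (intro CollectI exI[of _ "\<lambda>k. u k ^ p ^ e"]) simp
    qed
    then show ?thesis
      unfolding bracket_power_def Idl_eq[OF finite_lessThan, symmetric]
      by (rule A.genideal_minimal[OF A.genideal_ideal[OF img]])
  qed
  show ?thesis
  proof (intro equalityI subsetI)
    fix x assume x: "x \<in> I"
    have xA: "x \<in> carrier A" using x Id.Icarr by blast
    have "\<one> \<in> off_minimal_primes A"
    proof -
      have "\<one> \<notin> J" if "minimal_prime A J" for J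
      proof -
        interpret J: primeideal J A using that by (simp add: minimal_prime_def)
        show ?thesis using J.one_imp_carrier J.I_notcarr by auto
      qed
      then show ?thesis by (auto simp: off_minimal_primes_def)
    qed
    moreover have "\<one> \<otimes> x [^] (p ^ e) \<in> bracket_power A I (p ^ e)" for e
    proof -
      have "(\<lambda>x. x [^] (p ^ e)) ` I \<subseteq> carrier A" using Id.Icarr by auto
      then show ?thesis using A.genideal_self xA x by (auto simp: bracket_power_def)
    qed
    ultimately show "x \<in> tight_closure A p I"
      unfolding tight_closure_def using xA by blast
  next
    fix x assume "x \<in> tight_closure A p I"
    then obtain c e0 where x: "x \<in> carrier A" and c: "c \<in> off_minimal_primes A"
      and cx: "\<And>e. e \<ge> e0 \<Longrightarrow> c \<otimes> x [^] (p ^ e) \<in> bracket_power A I (p ^ e)"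
      by (auto simp: tight_closure_def)
    have cA: "c \<in> carrier A" and c0: "c \<noteq> \<zero>"
      using c zero_minimal by (auto simp: off_minimal_primes_def)
    show "x \<in> I"
    proof (rule ccontr)
      assume xI: "x \<notin> I"
      define r where "r k = (case k of 0 \<Rightarrow> lift x | Suc k \<Rightarrow> a k)" for k
      obtain D K where D: "finite D" and K: "\<And>e. Q.syz {0::nat} {..<Suc n} D (\<lambda>_ k. r k ^ p ^ e) (\<lambda>k l. K k l ^ p ^ e)"
        using frobenius_syzygies[OF coh reg ne p_prime p_null, of "{0::nat}" "{..<Suc n}" "\<lambda>_. r"] by auto
      have row: "lin {..<Suc n} (\<lambda>_ k. r k ^ q) u i = lift x ^ q * u 0 + (\<Sum>k<n. a k ^ q * u (Suc k))" for q u and i :: nat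
        unfolding lin_def sum.lessThan_Suc_shift by (simp add: r_def)
      have pos: "0 < v (\<pi> (K 0 d))" if d: "d \<in> D" for d
      proof (rule v_pos)
        show "\<pi> (K 0 d) \<notin> Units A"
        proof
          assume unit: "\<pi> (K 0 d) \<in> Units A"
          have "lin {..<Suc n} (\<lambda>_ k. r k ^ 1) (\<lambda>k. K k d) (0::nat) \<in> null"
            using K[of 0] d by (simp add: Q.syz_def)
          then have "lift x * K 0 d - (\<Sum>k<n. a k * - K (Suc k) d) \<in> null"
            unfolding row by (simp add: sum_negf)
          then have "\<pi> (lift x * K 0 d) = \<pi> (\<Sum>k<n. a k * - K (Suc k) d)" by (simp only: diff_in_null_iff)
          then have "x \<otimes> \<pi> (K 0 d) = \<pi> (\<Sum>k<n. a k * - K (Suc k) d)" using x by (simp only: \<pi>_mult \<pi>_lift)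
          then have "x \<otimes> \<pi> (K 0 d) \<in> I"
            unfolding I_eq by (intro CollectI exI[of _ "\<lambda>k. - K (Suc k) d"] conjI TrueI)
          then have "x \<otimes> \<pi> (K 0 d) \<otimes> inv \<pi> (K 0 d) \<in> I"
            by (rule Id.I_r_closed[OF _ A.Units_inv_closed[OF unit]])
          moreover have "x \<otimes> \<pi> (K 0 d) \<otimes> inv \<pi> (K 0 d) = x"
            using A.m_assoc[OF x \<pi>_closed A.Units_inv_closed[OF unit]] A.Units_r_inv[OF unit] x by simp
          ultimately show False using xI by simp
        qed
      qed simp
      obtain b where b: "b > 0" and vb: "\<And>d. d \<in> D \<Longrightarrow> ereal b \<le> v (\<pi> (K 0 d))"
        using exists_real_lower_bound[OF D, of "\<lambda>d. v (\<pi> (K 0 d))"] pos by blast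
      have vc: "ereal (real (p ^ e) * b) \<le> v c" if e: "e \<ge> e0" for e
      proof -
        let ?q = "p ^ e"
        obtain y where y: "c \<otimes> x [^] ?q = \<pi> (\<Sum>k<n. a k ^ ?q * y k)"
          using cx[OF e] bracket[of e] by blast
        define u where "u k = (case k of 0 \<Rightarrow> lift c | Suc k \<Rightarrow> - y k)" for k
        have "\<pi> (lift x ^ ?q * lift c) = \<pi> (\<Sum>k<n. a k ^ ?q * y k)"
          using y x cA by (simp add: \<pi>_mult \<pi>_power A.m_comm)
        then have "lift x ^ ?q * lift c - (\<Sum>k<n. a k ^ ?q * y k) \<in> null" by (simp only: diff_in_null_iff)
        then have "lin {..<Suc n} (\<lambda>_ k. r k ^ ?q) u (0::nat) \<in> null"
          unfolding row by (simp add: u_def sum_negf)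
        then obtain w where w: "\<forall>k\<in>{..<Suc n}. u k - lin D (\<lambda>k l. K k l ^ ?q) w k \<in> null"
          using K[of e] unfolding Q.syz_def by auto
        have "lift c - (\<Sum>d\<in>D. K 0 d ^ ?q * w d) \<in> null"
          using w[rule_format, of 0] by (simp add: u_def lin_def)
        then have c_eq: "c = \<pi> (\<Sum>d\<in>D. K 0 d ^ ?q * w d)" using cA by (simp add: diff_in_null_iff)
        show ?thesis unfolding c_eq
        proof (rule v_sum[OF D])
          fix d assume d: "d \<in> D"
          have "ereal (real ?q * b) + 0 \<le> v (\<pi> (K 0 d) [^] ?q) + v (\<pi> (w d))"
            by (intro add_mono v_pow vb d v_nonneg) auto
          then show "ereal (real ?q * b) \<le> v (\<pi> (K 0 d ^ ?q * w d))"
            by (simp add: \<pi>_mult \<pi>_power v_mult)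
        qed
      qed
      obtain t where t: "v c = ereal t"
        using v_inf[OF cA] v_minf[OF cA] c0 by (cases "v c") auto
      define e where "e = max e0 (nat \<lceil>t / b\<rceil>)"
      have "t / b \<le> real e" unfolding e_def by linarith
      then have "t \<le> real e * b" using b by (simp add: field_simps)
      also have "real e < real (p ^ e)"
        using power_gt_expt[of p e] prime_gt_1_nat[OF p_prime] by (simp only: of_nat_less_iff)
      then have "real e * b < real (p ^ e) * b" using b by simp
      finally have "t < real (p ^ e) * b" by simp
      moreover have "real (p ^ e) * b \<le> t" using vc[of e] t by (simp add: e_def)
      ultimately show False by simp
    qed
  qed
qed

end

section \<open>Coherent regular rings of prime characteristic\<close>

theorem lemma2p1:
  fixes A :: "('a, 'k) ring_scheme" and p :: nat
  assumes "cring A"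
    and "Factorial_Ring.prime p" and "ring_char A = p"
    and "coherent_ring A"
    and "regular_ring TYPE('u) A"
  shows "flat_ring_hom TYPE('n) A A (frobenius A p) \<and>
    (\<forall>v. normalized_value_map A v \<longrightarrow>
      (\<forall>I. fg_ideal A I \<longrightarrow> tight_closure A p I = I))"
proof -
  interpret A: cring A by fact
  obtain \<pi> :: "('a multiset \<Rightarrow>\<^sub>0 int) \<Rightarrow> 'a" where "ring_presentation A \<pi>"
    using exists_presentation[OF assms(1)] .
  then interpret ring_presentation A \<pi> .
  have ord: "A.add.ord \<one>\<^bsub>A\<^esub> = p" using assms(3) by (simp add: ring_char_def)
  have "\<one>\<^bsub>A\<^esub> [^]\<^bsub>add_monoid A\<^esub> p = \<zero>\<^bsub>A\<^esub>"
    using A.add.pow_ord_eq_1[of "\<one>\<^bsub>A\<^esub>"] ord by (simp add: add_pow_def)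
  then have "of_nat p \<in> null" by (simp add: null_def \<pi>_of_nat)
  then interpret frobenius_ring A \<pi> p
    by unfold_locales (use assms(2) in auto)
  have ne: "\<one>\<^bsub>A\<^esub> \<noteq> \<zero>\<^bsub>A\<^esub>"
  proof
    assume "\<one>\<^bsub>A\<^esub> = \<zero>\<^bsub>A\<^esub>"
    then have "p = 1" using A.add.ord_id ord by simp
    then show False using assms(2) by simp
  qed
  show ?thesis
    using frobenius_flat[OF assms(4,5) ne] tight_closure_fg_ideal[OF assms(4,5) ne] by blast
qed

end
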